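(* SESCAD (ESCAD restricted to simple digraphs) is fixed-parameter tractable parameterized by the vertex integrity of the input graph.
   Context: SESCAD: the input is a simple digraph $G$ (no loops, no parallel arcs) and an integer $k$; the question is whether there exists $R\subseteq E(G)$ with $|R|\le k$ such that every strongly connected component of $G-R$ is Eulerian (every vertex has equal in- and out-degree counting only arcs of $G-R$ with both endpoints in its strongly connected component). An undirected graph has vertex integrity $k$ if there is a vertex set $M$ with $|M|\le k$ whose removal leaves connected components each of size at most $k-|M|$; a digraph has vertex integrity $k$ if its underlying undirected graph does. *)

theory Defs
  imports "Graph_Theory.Graph_Theory" "HOL-Library.Log_Nat"
begin

section \<open>The problem and its parameter\<close>

text \<open>
  A simple digraph is a \<^locale>\<open>pair_digraph\<close>: finite, loop-free, with arcs given as a set of pairs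
  (hence no parallel arcs; a pair of opposite arcs is allowed).
\<close>

definition remove_arcs :: "'a pair_pre_digraph \<Rightarrow> ('a \<times> 'a) set \<Rightarrow> 'a pair_pre_digraph" where
  "remove_arcs G R = G\<lparr>parcs := parcs G - R\<rparr>"

text \<open>
  Applied to a strongly connected component \<open>H\<close>, which is an induced subgraph, only arcs with both
  endpoints in \<open>H\<close> are counted.
\<close>
definition eulerian :: "('a, 'b) pre_digraph \<Rightarrow> bool" where
  "eulerian H \<longleftrightarrow> (\<forall>v\<in>verts H. in_degree H v = out_degree H v)"

definition sescad :: "'a pair_pre_digraph \<times> int \<Rightarrow> bool" where
  "sescad = (\<lambda>(G, k). \<exists>R \<subseteq> parcs G. int (card R) \<le> k \<and>
     (\<forall>H \<in> pre_digraph.sccs (with_proj (remove_arcs G R)). eulerian H))"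

text \<open>
  The underlying undirected graph is represented by the symmetric digraph \<^const>\<open>mk_symmetric\<close>;
  its strongly connected components are the connected components of the undirected graph.
\<close>
definition undirected_components :: "('a, 'b) pre_digraph \<Rightarrow> ('a, 'a \<times> 'a) pre_digraph set" where
  "undirected_components G = pre_digraph.sccs (with_proj (mk_symmetric G))"

definition has_vertex_integrity :: "'a pair_pre_digraph \<Rightarrow> nat \<Rightarrow> bool" where
  "has_vertex_integrity G p \<longleftrightarrow> (\<exists>M \<subseteq> pverts G. card M \<le> p \<and>
     (\<forall>C \<in> undirected_components (with_proj G \<restriction> (pverts G - M)). card (verts C) \<le> p - card M))"

definition vertex_integrity :: "'a pair_pre_digraph \<Rightarrow> nat" where
  "vertex_integrity G = (LEAST p. has_vertex_integrity G p)"

text \<open>The minimum is taken over a nonempty set.\<close>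
lemma has_vertex_integrity_card:
  assumes "pair_digraph G"
  shows "has_vertex_integrity G (card (pverts G))"
proof -
  have "undirected_components (with_proj G \<restriction> (pverts G - pverts G)) = {}"
    by (auto simp add: undirected_components_def pre_digraph.sccs_def strongly_connected_def
        induced_subgraph_def subgraph_def)
  then show ?thesis
    unfolding has_vertex_integrity_def by (intro exI[of _ "pverts G"]) auto
qed


section \<open>Machine model\<close>

text \<open>
  Random access machines under the uniform cost criterion, as structured programs. The memory
  consists of unbounded arrays of natural numbers, named by strings; a program uses finitely many
  of them, and scalar registers are the cells with index \<open>0\<close>.

  The only arithmetic operations are addition and truncated subtraction. There is deliberately no
  multiplication: the length of the stored numbers then grows by at most a constant per step, so
  that running times agree with those of Turing machines up to a polynomial.
\<close>

type_synonym store = "string \<Rightarrow> nat \<Rightarrow> nat"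

datatype aexp =
    Const nat
  | Cell string aexp
  | Plus aexp aexp
  | Minus aexp aexp

fun aval :: "aexp \<Rightarrow> store \<Rightarrow> nat" where
  "aval (Const n) s = n"
| "aval (Cell x a) s = s x (aval a s)"
| "aval (Plus a b) s = aval a s + aval b s"
| "aval (Minus a b) s = aval a s - aval b s"

datatype bexp =
    Less aexp aexp
  | Equal aexp aexp
  | Not bexp
  | And bexp bexp

fun bval :: "bexp \<Rightarrow> store \<Rightarrow> bool" where
  "bval (Less a b) s \<longleftrightarrow> aval a s < aval b s"
| "bval (Equal a b) s \<longleftrightarrow> aval a s = aval b s"
| "bval (Not b) s \<longleftrightarrow> \<not> bval b s"
| "bval (And b c) s \<longleftrightarrow> bval b s \<and> bval c s"

text \<open>\<open>Store x i a\<close> writes the value of \<open>a\<close> to the cell of array \<open>x\<close> whose index is the value of \<open>i\<close>.\<close>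
datatype com =
    Skip
  | Store string aexp aexp
  | Seq com com
  | Cond bexp com com
  | While bexp com

text \<open>
  \<open>exec c s t s'\<close>: started in \<open>s\<close>, the program \<open>c\<close> halts in \<open>s'\<close> after \<open>t\<close> steps. Expressions occurring
  in a program have constant size, so evaluating one is charged a single step.
\<close>
inductive exec :: "com \<Rightarrow> store \<Rightarrow> nat \<Rightarrow> store \<Rightarrow> bool" where
  Skip: "exec Skip s 1 s"
| Store: "exec (Store x i a) s 1 (s(x := (s x)(aval i s := aval a s)))"
| Seq: "exec c1 s t1 s1 \<Longrightarrow> exec c2 s1 t2 s2 \<Longrightarrow> exec (Seq c1 c2) s (t1 + t2) s2"
| CondTrue: "bval b s \<Longrightarrow> exec c1 s t s' \<Longrightarrow> exec (Cond b c1 c2) s (t + 1) s'"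
| CondFalse: "\<not> bval b s \<Longrightarrow> exec c2 s t s' \<Longrightarrow> exec (Cond b c1 c2) s (t + 1) s'"
| WhileFalse: "\<not> bval b s \<Longrightarrow> exec (While b c) s 1 s"
| WhileTrue: "bval b s \<Longrightarrow> exec c s t1 s1 \<Longrightarrow> exec (While b c) s1 t2 s2 \<Longrightarrow>
    exec (While b c) s (t1 + t2 + 1) s2"

inductive_cases SkipE: "exec Skip s t s'"
inductive_cases StoreE: "exec (Store x i a) s t s'"
inductive_cases SeqE: "exec (Seq c1 c2) s t s'"
inductive_cases CondE: "exec (Cond b c1 c2) s t s'"
inductive_cases WhileE: "exec (While b c) s t s'"

lemma exec_deterministic:
  assumes "exec c s t s'" and "exec c s u s''"
  shows "t = u \<and> s' = s''"
  using assms
proof (induction arbitrary: u s'' rule: exec.induct)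
  case (Skip s)
  then show ?case by (auto elim: SkipE)
next
  case (Store x i a s)
  then show ?case by (auto elim: StoreE)
next
  case (Seq c1 s t1 s1 c2 t2 s2)
  from Seq.prems obtain u1 v u2
    where "exec c1 s u1 v" "exec c2 v u2 s''" "u = u1 + u2"
    by (rule SeqE)
  with Seq.IH show ?case by metis
next
  case (CondTrue b s c1 t s' c2)
  from CondTrue.prems CondTrue.hyps(1) obtain u1 where "exec c1 s u1 s''" "u = u1 + 1"
    by (elim CondE) simp_all
  with CondTrue.IH show ?case by metis
next
  case (CondFalse b s c2 t s' c1)
  from CondFalse.prems CondFalse.hyps(1) obtain u1 where "exec c2 s u1 s''" "u = u1 + 1"
    by (elim CondE) simp_all
  with CondFalse.IH show ?case by metis
next
  case (WhileFalse b s c)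
  from WhileFalse.prems show ?case
    by (rule WhileE) (use WhileFalse.hyps in simp_all)
next
  case (WhileTrue b s c t1 s1 t2 s2)
  from WhileTrue.prems obtain u1 v u2
    where "exec c s u1 v" "exec (While b c) v u2 s''" "u = u1 + u2 + 1"
    by (rule WhileE) (use WhileTrue.hyps(1) in simp_all)
  with WhileTrue.IH show ?case by metis
qed

text \<open>The input is a word over the natural numbers; all cells not holding it are initially \<open>0\<close>.\<close>
definition input_store :: "nat list \<Rightarrow> store" where
  "input_store w = (\<lambda>x i.
     if x = ''in'' \<and> i < length w then w ! i
     else if x = ''len'' \<and> i = 0 then length w
     else 0)"

definition output_of :: "store \<Rightarrow> nat" where
  "output_of s = s ''out'' 0"

text \<open>Length of the input in bits, each number being written in binary and followed by a separator.\<close>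
definition input_size :: "nat list \<Rightarrow> nat" where
  "input_size w = (\<Sum>a\<leftarrow>w. floorlog 2 a + 1)"

definition computable :: "(nat \<Rightarrow> nat) \<Rightarrow> bool" where
  "computable f \<longleftrightarrow> (\<exists>c. \<forall>n. \<exists>t s. exec c (input_store [n]) t s \<and> output_of s = f n)"


section \<open>Fixed-parameter tractability\<close>

text \<open>
  \<open>inst\<close> is the set of instances, \<open>enc x w\<close> means that \<open>w\<close> is an encoding of the instance \<open>x\<close>,
  \<open>yes x\<close> that \<open>x\<close> is a yes-instance, and \<open>par\<close> is the parameter. The parameter value is not part of
  the input.
\<close>
definition fixed_parameter_tractable ::
    "'i set \<Rightarrow> ('i \<Rightarrow> nat list \<Rightarrow> bool) \<Rightarrow> ('i \<Rightarrow> bool) \<Rightarrow> ('i \<Rightarrow> nat) \<Rightarrow> bool" where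
  "fixed_parameter_tractable inst enc yes par \<longleftrightarrow>
     (\<exists>c f d. computable f \<and>
        (\<forall>x\<in>inst. \<forall>w. enc x w \<longrightarrow>
           (\<exists>t s. exec c (input_store w) t s \<and>
              output_of s = (if yes x then 1 else 0) \<and>
              t \<le> f (par x) * input_size w ^ d)))"

text \<open>
  An instance is encoded by the sign and the absolute value of \<open>k\<close>, the number of vertices, the
  vertices, and the arcs as consecutive pairs of vertices. Vertices and arcs may be listed in any
  order, without repetition.
\<close>
definition sescad_encoding :: "nat pair_pre_digraph \<times> int \<Rightarrow> nat list \<Rightarrow> bool" where
  "sescad_encoding = (\<lambda>(G, k) w. \<exists>vs es.
     distinct vs \<and> set vs = pverts G \<and> distinct es \<and> set es = parcs G \<and>
     w = [if k < 0 then 1 else 0, nat \<bar>k\<bar>, length vs] @ vs @ concat (map (\<lambda>(u, v). [u, v]) es))"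

definition sescad_instances :: "(nat pair_pre_digraph \<times> int) set" where
  "sescad_instances = {(G, k). pair_digraph G}"

end

theory Submission
  imports Defs "HOL-Library.Disjoint_Sets" "HOL-Library.Multiset"
begin

text \<open>A set of deleted arcs is a solution iff the vertices carry levels
such that remaining arcs never go down and every level is balanced by its own arcs. The
vertices of degree greater than \<open>q\<close> are called hubs. For \<open>q\<close> twice the vertex integrity there are
few hubs and removing them leaves small components, so the algorithm takes the least \<open>q\<close> for which
both are bounded in \<open>q\<close>; few levels then suffice, and a hub-free component together with a partial
solution on it is described by a bounded number, its code. With the levels of the hubs
fixed, the remaining condition is that the imbalances which the codes cause at the hubs sum to zero. A family
of bounded integer vectors with zero sum splits into zero-sum groups of bounded size; applied to the
difference of a given and an optimal solution, this shows that a non-optimal solution is improved by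
changing the codes of boundedly many components. Validity and cost depend only on the multiset of
codes, so it suffices to change the first component that carries a given code, and the improving change
is found by running through boundedly many lists of pairs of codes. Starting from the solution that
deletes every arc, each round lowers the cost, so there are at most as many rounds as arcs.\<close>

section \<open>Zero-sum decompositions and local search\<close>

text \<open>A set witnessing the vertex integrity \<open>p\<close> is not at hand, and
  \<open>p\<close> is not part of the input. Degrees replace the witness: a vertex outside it has at
  most \<open>p\<close> neighbours, hence at most \<open>2 * p\<close> arcs, so the hubs for
  \<open>q = 2 * p\<close> lie in the witness. Its other members have few arcs and glue together
  only few components. This gives the bound \<open>(q + 2) ^ 3\<close> and ends the search for
  \<open>q\<close> at \<open>2 * p\<close> or before.

  With \<open>y = (q + 2) ^ 3\<close>, the single number \<open>X = 4 * (y + 1) ^ 2\<close> exceeds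
  all local names, levels and slot numbers of a block, so codes are written in base
  \<open>X\<close>. For fixed hub levels the task is an integer program with boundedly many
  constraints, and the bounded zero-sum groups play the part of a Graver basis for it.

  Every loop runs up to a register that its stage of the program never overwrites. The time is then
  polynomial in the largest such register, with an exponent fixed by the program text, and these
  registers are bounded by the input length plus a function of \<open>2 * p\<close>.\<close>

text \<open>Take a zero-sum subset of least size and order it with all prefix sums in
  \<open>[-B, B]\<close>. If it had more than \<open>2 * B + 1\<close> elements, two prefixes would
  have equal sums, and the elements between them would form a smaller zero-sum subset.\<close>

lemma zero_sum_subset:
  fixes f :: "'a \<Rightarrow> int"
  assumes "finite I" "I \<noteq> {}" "\<And>i. i \<in> I \<Longrightarrow> \<bar>f i\<bar> \<le> int B" "sum f I = 0"
  shows "\<exists>J\<subseteq>I. J \<noteq> {} \<and> sum f J = 0 \<and> card J \<le> 2 * B + 1"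
proof -
  let ?P = "\<lambda>J. J \<subseteq> I \<and> J \<noteq> {} \<and> sum f J = 0"
  have "?P I" using assms by auto
  then obtain J where J: "?P J" and min: "\<And>K. ?P K \<Longrightarrow> card J \<le> card K"
    using ex_has_least_nat[of ?P I card] by blast
  have fin: "finite J" using J assms(1) finite_subset by blast
  have "card J \<le> 2 * B + 1"
  proof (rule ccontr)
    assume large: "\<not> card J \<le> 2 * B + 1"
    text \<open>Order \<open>J\<close> such that all prefix sums stay in \<open>[-B, B]\<close>.\<close>
    have "\<exists>xs. distinct xs \<and> length xs = n \<and> set xs \<subseteq> J \<and>
        (\<forall>k\<le>n. \<bar>sum f (set (take k xs))\<bar> \<le> int B)" if "n \<le> card J" for n
      using that
    proof (induction n)
      case (Suc n)
      then obtain xs where xs: "distinct xs" "length xs = n" "set xs \<subseteq> J"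
        "\<And>k. k \<le> n \<Longrightarrow> \<bar>sum f (set (take k xs))\<bar> \<le> int B" by auto
      have "card (set xs) < card J" using xs Suc.prems by (simp add: distinct_card)
      then have ne: "J - set xs \<noteq> {}" using xs(3) by auto
      have s: "\<bar>sum f (set xs)\<bar> \<le> int B" using xs(4)[of n] xs(2) by simp
      have tot: "sum f (J - set xs) = - sum f (set xs)"
        using J fin xs(3) by (simp add: sum_diff)
      \<comment> \<open>The remaining elements sum to minus the current prefix sum, so one of them
        has the opposite weak sign; adding it keeps the sum in the interval.\<close>
      have "\<exists>x\<in>J - set xs. \<bar>sum f (set xs) + f x\<bar> \<le> int B"
      proof (cases "sum f (set xs) \<le> 0")
        case True
        then have "\<exists>x\<in>J - set xs. f x \<ge> 0"
          using tot sum_strict_mono[of "J - set xs" f "\<lambda>_. 0"] ne fin by (auto simp: not_le[symmetric])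
        then obtain x where "x \<in> J - set xs" "f x \<ge> 0" by blast
        moreover have "\<bar>f x\<bar> \<le> int B" using calculation J assms(3) by blast
        ultimately show ?thesis using True s by (intro bexI[of _ x]) auto
      next
        case False
        have "\<exists>x\<in>J - set xs. f x \<le> 0"
        proof (rule ccontr)
          assume "\<not> ?thesis"
          then have "sum f (J - set xs) > 0" using ne fin by (intro sum_pos) (auto simp: not_le)
          then show False using tot False by simp
        qed
        then obtain x where "x \<in> J - set xs" "f x \<le> 0" by blast
        moreover have "\<bar>f x\<bar> \<le> int B" using calculation J assms(3) by blast
        ultimately show ?thesis using False s by (intro bexI[of _ x]) auto
      qed
      then obtain x where x: "x \<in> J" "x \<notin> set xs" "\<bar>sum f (set xs) + f x\<bar> \<le> int B" by blast
      have "\<bar>sum f (set (take k (xs @ [x])))\<bar> \<le> int B" if "k \<le> Suc n" for k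
      proof (cases "k \<le> n")
        case True
        then show ?thesis using xs by simp
      next
        case False
        then have "k = Suc n" using that by simp
        then show ?thesis using x xs(2) by (simp add: add.commute)
      qed
      then show ?case using xs x by (intro exI[of _ "xs @ [x]"]) auto
    qed simp
    from this[of "card J"] obtain xs where xs: "distinct xs" "length xs = card J" "set xs \<subseteq> J"
      "\<And>k. k \<le> card J \<Longrightarrow> \<bar>sum f (set (take k xs))\<bar> \<le> int B" by auto
    let ?s = "\<lambda>k. sum f (set (take k xs))"
    \<comment> \<open>Only the \<open>2 * B + 2\<close> shortest prefixes are compared: one more
      than there are possible sums, and the segment between two of them is still shorter than
      \<open>J\<close>.\<close>
    have sub: "?s ` {..2 * B + 1} \<subseteq> {- int B..int B}"
    proof (intro image_subsetI)
      fix k assume "k \<in> {..2 * B + 1}"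
      then have "k \<le> card J" using large by simp
      from xs(4)[OF this] show "?s k \<in> {- int B..int B}" by (auto simp: abs_le_iff)
    qed
    have "card {- int B..int B} = 2 * B + 1" by simp
    then have "card (?s ` {..2 * B + 1}) < card {..2 * B + 1}"
      using card_mono[OF _ sub] by simp
    then have "\<not> inj_on ?s {..2 * B + 1}" using card_image by fastforce
    then obtain a b where "a \<noteq> b" "a \<le> 2 * B + 1" "b \<le> 2 * B + 1" "?s a = ?s b"
      unfolding inj_on_def by blast
    then obtain a b where ab: "a < b" "b \<le> 2 * B + 1" "?s a = ?s b"
      by (metis linorder_neqE_nat)
    let ?K = "set (take b xs) - set (take a xs)"
    have ss: "set (take a xs) \<subseteq> set (take b xs)" using ab by (simp add: set_take_subset_set_take)
    have "sum f ?K = 0" using ss ab by (simp add: sum_diff)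
    moreover have cb: "card (set (take b xs)) = b" "card (set (take a xs)) = a"
      using xs ab large by (simp_all add: distinct_card)
    then have "card ?K = b - a" using ss by (simp add: card_Diff_subset)
    then have "?K \<noteq> {}" using ab by (metis card.empty zero_less_diff less_numeral_extra(3))
    moreover have "?K \<subseteq> I" using xs(3) J set_take_subset[of b xs] by blast
    ultimately have "card J \<le> card ?K" using min by blast
    then show False using \<open>card ?K = b - a\<close> ab large by simp
  qed
  then show ?thesis using J by blast
qed

lemma zero_sum_partition_int:
  fixes f :: "'a \<Rightarrow> int"
  assumes "finite I" "\<And>i. i \<in> I \<Longrightarrow> \<bar>f i\<bar> \<le> int B" "sum f I = 0"
  shows "\<exists>P. partition_on I P \<and> (\<forall>J\<in>P. sum f J = 0 \<and> card J \<le> 2 * B + 1)"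
  using assms
proof (induction I rule: finite_psubset_induct)
  case (psubset I)
  show ?case
  proof (cases "I = {}")
    case True
    then show ?thesis by (intro exI[of _ "{}"]) (auto simp: partition_on_def)
  next
    case False
    from zero_sum_subset[OF psubset.hyps(1) False psubset.prems] obtain J where
      J: "J \<subseteq> I" "J \<noteq> {}" "sum f J = 0" "card J \<le> 2 * B + 1" by blast
    have "I - J \<subset> I" "sum f (I - J) = 0"
      using J psubset by (auto simp: sum_diff)
    from psubset.IH[OF this(1) _ this(2)] psubset.prems obtain P where
      P: "partition_on (I - J) P" "\<forall>J\<in>P. sum f J = 0 \<and> card J \<le> 2 * B + 1" by auto
    have "partition_on I (insert J P)"
      using P(1) J by (auto simp: partition_on_def disjoint_def)
    then show ?thesis using P(2) J by (intro exI[of _ "insert J P"]) auto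
  qed
qed

text \<open>For one more coordinate, a group of at most \<open>g = group_bound B m\<close> vectors
  counts as one integer of absolute value at most \<open>g * B\<close>; then up to
  \<open>2 * (g * B) + 1\<close> such groups, of at most \<open>g\<close> vectors each, are
  merged.\<close>

fun group_bound :: "nat \<Rightarrow> nat \<Rightarrow> nat" where
  "group_bound B 0 = 1"
| "group_bound B (Suc m) = (2 * (group_bound B m * B) + 1) * group_bound B m"

text \<open>Induction on the coordinates: groups with sum zero in the old coordinates keep it under
  any merging, so the integer case is applied to the sums of the groups in the new
  coordinate.\<close>

lemma zero_sum_partition:
  fixes e :: "'i \<Rightarrow> 'd \<Rightarrow> int"
  assumes "finite D" "finite I" "\<And>i d. i \<in> I \<Longrightarrow> d \<in> D \<Longrightarrow> \<bar>e i d\<bar> \<le> int B"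
    "\<And>d. d \<in> D \<Longrightarrow> (\<Sum>i\<in>I. e i d) = 0"
  shows "\<exists>P. partition_on I P \<and>
    (\<forall>J\<in>P. (\<forall>d\<in>D. (\<Sum>i\<in>J. e i d) = 0) \<and> card J \<le> group_bound B (card D))"
  using assms(1,3,4)
proof (induction D rule: finite_induct)
  case empty
  have "partition_on I ((\<lambda>i. {i}) ` I)" by (auto simp: partition_on_def disjoint_def)
  then show ?case by (intro exI[of _ "(\<lambda>i. {i}) ` I"]) auto
next
  case (insert x D)
  let ?g = "group_bound B (card D)"
  from insert.IH insert.prems obtain P where P: "partition_on I P"
    "\<And>J d. J \<in> P \<Longrightarrow> d \<in> D \<Longrightarrow> (\<Sum>i\<in>J. e i d) = 0" "\<And>J. J \<in> P \<Longrightarrow> card J \<le> ?g"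
    by (metis insertCI)
  have finP: "finite P" "\<And>J. J \<in> P \<Longrightarrow> finite J"
    using P(1) assms(2) finite_elements by (auto simp: partition_on_def intro: finite_subset)
  have disj: "\<And>A C. A \<in> P \<Longrightarrow> C \<in> P \<Longrightarrow> A \<noteq> C \<Longrightarrow> A \<inter> C = {}"
    using P(1) by (auto simp: partition_on_def disjoint_def)
  let ?F = "\<lambda>J. \<Sum>i\<in>J. e i x"
  have "\<bar>?F J\<bar> \<le> int (?g * B)" if "J \<in> P" for J
  proof -
    have "J \<subseteq> I" using that P(1) by (auto simp: partition_on_def)
    then have "\<bar>?F J\<bar> \<le> (\<Sum>i\<in>J. int B)"
      using insert.prems(1) by (intro order_trans[OF sum_abs] sum_mono) auto
    also have "\<dots> = int (card J * B)" by simp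
    also have "\<dots> \<le> int (?g * B)" using P(3)[OF that] by (simp only: of_nat_le_iff mult_le_mono1)
    finally show ?thesis .
  qed
  moreover have "sum ?F P = 0"
  proof -
    have "sum ?F P = (\<Sum>i\<in>\<Union>P. e i x)"
      using sum.Union_disjoint[of P "\<lambda>i. e i x"] finP disj by auto
    also have "\<Union>P = I" using P(1) by (auto simp: partition_on_def)
    finally show ?thesis using insert.prems(2)[of x] by simp
  qed
  ultimately obtain Q where Q: "partition_on P Q"
    "\<And>K. K \<in> Q \<Longrightarrow> sum ?F K = 0" "\<And>K. K \<in> Q \<Longrightarrow> card K \<le> 2 * (?g * B) + 1"
    using zero_sum_partition_int[OF finP(1), of ?F "?g * B"] by blast
  have KP: "K \<subseteq> P" "finite K" "K \<noteq> {}" if "K \<in> Q" for K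
    using that Q(1) finP(1) by (auto simp: partition_on_def intro: finite_subset)
  have su: "(\<Sum>i\<in>\<Union>K. e i d) = (\<Sum>J\<in>K. \<Sum>i\<in>J. e i d)" if "K \<in> Q" for K d
  proof -
    have "\<forall>A\<in>K. finite A" "\<forall>A\<in>K. \<forall>B\<in>K. A \<noteq> B \<longrightarrow> A \<inter> B = {}"
      using KP(1)[OF that] finP(2) disj by blast+
    then show ?thesis using sum.Union_disjoint[of K "\<lambda>i. e i d"] by simp
  qed
  have "partition_on I (\<Union> ` Q)"
  proof (rule partition_onI)
    show "\<Union> (\<Union> ` Q) = I" using Q(1) P(1) by (auto simp: partition_on_def)
    show "{} \<notin> \<Union> ` Q"
    proof
      assume "{} \<in> \<Union> ` Q"
      then obtain K where "K \<in> Q" "{} = \<Union>K" by blast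
      with KP[of K] P(1) show False by (fastforce simp: partition_on_def)
    qed
    fix p p' assume "p \<in> \<Union> ` Q" "p' \<in> \<Union> ` Q" "p \<noteq> p'"
    then obtain K K' where K: "K \<in> Q" "K' \<in> Q" "p = \<Union>K" "p' = \<Union>K'" "K \<noteq> K'" by blast
    then have "K \<inter> K' = {}" using Q(1) by (auto simp: partition_on_def disjoint_def)
    then have "A \<inter> C = {}" if "A \<in> K" "C \<in> K'" for A C
      using disj[of A C] that KP(1)[OF K(1)] KP(1)[OF K(2)] by blast
    then show "disjnt p p'" using K by (auto simp: disjnt_def)
  qed
  moreover have "(\<Sum>i\<in>\<Union>K. e i d) = 0" if "K \<in> Q" "d \<in> insert x D" for K d
  proof (cases "d = x")
    case True
    then show ?thesis using su that Q(2) by simp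
  next
    case False
    then show ?thesis using su that P(2) KP(1)[OF that(1)] by (simp add: subset_eq)
  qed
  moreover have "card (\<Union>K) \<le> group_bound B (card (insert x D))" if "K \<in> Q" for K
  proof -
    have "card (\<Union>K) \<le> (\<Sum>J\<in>K. card J)" by (rule card_Union_le_sum_card)
    also have "\<dots> \<le> (\<Sum>J\<in>K. ?g)" using P(3) KP(1)[OF that] by (intro sum_mono) auto
    also have "\<dots> = card K * ?g" by simp
    also have "\<dots> \<le> (2 * (?g * B) + 1) * ?g" using Q(3)[OF that] by (rule mult_le_mono1)
    finally show ?thesis using insert.hyps by simp
  qed
  ultimately show ?case by (intro exI[of _ "\<Union> ` Q"]) auto
qed

lemma group_bound_le:
  assumes "B \<ge> 1"
  shows "group_bound B m \<le> (3 * B) ^ (2 ^ m)"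
proof -
  \<comment> \<open>The extra factor \<open>3 * B\<close> makes the recursion a squaring: \<open>3 *
    B * group_bound B (Suc m) <= (3 * B * group_bound B m) ^ 2\<close>.\<close>
  have "group_bound B m \<ge> 1 \<and> 3 * B * group_bound B m \<le> (3 * B) ^ (2 ^ m)"
  proof (induction m)
    case (Suc m)
    let ?g = "group_bound B m"
    have "?g * B \<ge> 1" using Suc assms by (metis mult_le_mono nat_mult_1)
    then have "2 * (?g * B) + 1 \<le> 3 * (?g * B)" by simp
    then have "3 * B * group_bound B (Suc m) \<le> 3 * B * (3 * (?g * B) * ?g)"
      by (simp del: One_nat_def)
    also have "\<dots> = (3 * B * ?g) ^ 2" by (simp add: power2_eq_square)
    also have "\<dots> \<le> ((3 * B) ^ (2 ^ m)) ^ 2" using Suc by (intro power_mono) auto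
    also have "\<dots> = (3 * B) ^ (2 ^ Suc m)" by (simp only: power_mult[symmetric] power_Suc mult.commute)
    finally show ?case using Suc by simp
  qed (use assms in simp)
  moreover have "group_bound B m \<le> 3 * B * group_bound B m" using assms by simp
  ultimately show ?thesis by linarith
qed

section \<open>Realising an exchange by moves on codes\<close>

text \<open>A move names codes, not blocks, so the number of possible moves does not depend on the
  size of the graph.\<close>

definition rewrite_first :: "'b list \<Rightarrow> 'c \<times> 'c \<Rightarrow> ('b \<Rightarrow> 'c) \<Rightarrow> 'b \<Rightarrow> 'c" where
  "rewrite_first bs m f = (case find (\<lambda>b. f b = fst m) bs of None \<Rightarrow> f | Some b \<Rightarrow> f(b := snd m))"

lemma image_mset_upd:
  assumes "finite V" "b \<in> V"
  shows "image_mset (f(b := w)) (mset_set V) = add_mset w (image_mset f (mset_set V) - {#f b#})"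
proof -
  have "mset_set V = add_mset b (mset_set (V - {b}))"
    using assms by (simp add: mset_set.remove)
  moreover have "image_mset (f(b := w)) (mset_set (V - {b})) = image_mset f (mset_set (V - {b}))"
    using assms by (intro image_mset_cong) auto
  ultimately show ?thesis by simp
qed

text \<open>The move meant for \<open>b\<close> may hit an earlier block \<open>b'\<close> with the
  same code. This exchanges the roles of the two blocks but not the multiset of codes, and
  \<open>b'\<close> accepts the new code because it shares the code \<open>f b\<close> with
  \<open>b\<close>.\<close>

lemma rewrite_first_fold:
  assumes "\<And>b b' c c'. matchp b c \<Longrightarrow> matchp b' c \<Longrightarrow> matchp b c' \<Longrightarrow> matchp b' c'"
    and "\<And>b. b \<in> set bs \<Longrightarrow> matchp b (f b)" "\<And>b. b \<in> set bs \<Longrightarrow> matchp b (f' b)"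
    and "distinct js" "set js \<subseteq> set bs"
  defines "y \<equiv> \<lambda>js b. if b \<in> set js then f' b else f b"
  shows "image_mset (fold (rewrite_first bs) (map (\<lambda>b. (f b, f' b)) js) f) (mset_set (set bs)) =
      image_mset (y js) (mset_set (set bs)) \<and>
    (\<forall>b\<in>set bs. matchp b (fold (rewrite_first bs) (map (\<lambda>b. (f b, f' b)) js) f b))"
  using assms(4,5)
proof (induction js rule: rev_induct)
  case Nil
  then show ?case using assms(2) by (auto simp: y_def intro!: image_mset_cong)
next
  case (snoc b js)
  let ?V = "mset_set (set bs)"
  define f2 where "f2 = fold (rewrite_first bs) (map (\<lambda>b. (f b, f' b)) js) f"
  have IH: "image_mset f2 ?V = image_mset (y js) ?V" "\<And>b. b \<in> set bs \<Longrightarrow> matchp b (f2 b)"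
    using snoc by (auto simp: f2_def)
  have b: "b \<in> set bs" "b \<notin> set js" using snoc.prems by auto
  \<comment> \<open>The block \<open>b\<close> has not been exchanged in \<open>y js\<close>, so its
    old code still occurs, although possibly at another block in \<open>f2\<close>.\<close>
  have "f b \<in># image_mset (y js) ?V" using b by (auto simp: y_def)
  then have "f b \<in># image_mset f2 ?V" using IH by simp
  then have "find (\<lambda>x. f2 x = f b) bs \<noteq> None" by (auto simp: find_None_iff)
  then obtain b' where b': "find (\<lambda>x. f2 x = f b) bs = Some b'" by blast
  then have b'V: "b' \<in> set bs" "f2 b' = f b" by (auto simp: find_Some_iff)
  have step: "fold (rewrite_first bs) (map (\<lambda>b. (f b, f' b)) (js @ [b])) f = f2(b' := f' b)"
    using b' by (simp add: rewrite_first_def f2_def)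
  have "y (js @ [b]) = (y js)(b := f' b)" using b by (auto simp: y_def)
  then have "image_mset (y (js @ [b])) ?V = add_mset (f' b) (image_mset (y js) ?V - {#f b#})"
    using image_mset_upd[of "set bs" b "y js" "f' b"] b by (simp add: y_def)
  also have "\<dots> = image_mset (f2(b' := f' b)) ?V"
    using image_mset_upd[of "set bs" b' f2 "f' b"] b'V IH(1) by simp
  finally have 1: "image_mset (f2(b' := f' b)) ?V = image_mset (y (js @ [b])) ?V" by simp
  have "matchp b' (f' b)"
    using assms(1)[of b "f b" b' "f' b"] assms(2,3) IH(2)[OF b'V(1)] b b'V by simp
  then have "\<forall>x\<in>set bs. matchp x ((f2(b' := f' b)) x)" using IH(2) by simp
  with 1 show ?case unfolding step by blast
qed

text \<open>Separates what a block decides alone, \<open>matchp\<close> and \<open>okp\<close>, from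
  the sums over \<open>D\<close>, the only condition that couples different blocks.\<close>

definition valid_choice ::
    "'b set \<Rightarrow> ('b \<Rightarrow> 'c \<Rightarrow> bool) \<Rightarrow> ('c \<Rightarrow> bool) \<Rightarrow> 'd set \<Rightarrow> ('c \<Rightarrow> 'd \<Rightarrow> int) \<Rightarrow> ('b \<Rightarrow> 'c) \<Rightarrow> bool" where
  "valid_choice V matchp okp D con f \<longleftrightarrow>
     (\<forall>b\<in>V. matchp b (f b) \<and> okp (f b)) \<and> (\<forall>d\<in>D. (\<Sum>b\<in>V. con (f b) d) = 0)"

text \<open>The vectors \<open>con (f' b) - con (f b)\<close> sum to zero over all blocks and have
  entries of size at most \<open>2 * B\<close>, hence split into small zero-sum groups. The total
  change of cost is negative, so it is negative on some group; exchanging on this group alone keeps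
  the sums and lowers the cost.\<close>

theorem improving_rewriting:
  fixes con :: "'c \<Rightarrow> 'd \<Rightarrow> int" and cst :: "'c \<Rightarrow> nat"
  assumes tr: "\<And>b b' c c'. matchp b c \<Longrightarrow> matchp b' c \<Longrightarrow> matchp b c' \<Longrightarrow> matchp b' c'"
    and "distinct bs" "finite D"
    and bound: "\<And>c d. d \<in> D \<Longrightarrow> \<bar>con c d\<bar> \<le> int B"
    and f: "valid_choice (set bs) matchp okp D con f"
    and f': "valid_choice (set bs) matchp okp D con f'"
    and less: "(\<Sum>b\<in>set bs. cst (f' b)) < (\<Sum>b\<in>set bs. cst (f b))"
  shows "\<exists>ms. length ms \<le> group_bound (2 * B) (card D) \<and> set ms \<subseteq> f ` set bs \<times> f' ` set bs \<and>
    valid_choice (set bs) matchp okp D con (fold (rewrite_first bs) ms f) \<and>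
    (\<Sum>b\<in>set bs. cst (fold (rewrite_first bs) ms f b)) < (\<Sum>b\<in>set bs. cst (f b))"
proof -
  let ?V = "set bs"
  define e where "e b d = con (f' b) d - con (f b) d" for b d
  have "\<bar>e b d\<bar> \<le> int (2 * B)" if "d \<in> D" for b d
    using bound[OF that, of "f b"] bound[OF that, of "f' b"] by (simp add: e_def)
  moreover have "(\<Sum>b\<in>?V. e b d) = 0" if "d \<in> D" for d
    using f f' that by (simp add: e_def valid_choice_def sum_subtractf)
  ultimately obtain P where P: "partition_on ?V P"
    "\<And>J d. J \<in> P \<Longrightarrow> d \<in> D \<Longrightarrow> (\<Sum>b\<in>J. e b d) = 0" "\<And>J. J \<in> P \<Longrightarrow> card J \<le> group_bound (2 * B) (card D)"
    using zero_sum_partition[of D ?V e "2 * B"] assms(3) by auto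
  define k where "k b = int (cst (f' b)) - int (cst (f b))" for b
  have "\<exists>J\<in>P. sum k J < 0"
  proof (rule ccontr)
    assume "\<not> ?thesis"
    then have "(\<Sum>J\<in>P. sum k J) \<ge> 0" by (intro sum_nonneg[of P "sum k"]) (auto simp: not_less)
    moreover have "\<forall>A\<in>P. finite A" "\<forall>A\<in>P. \<forall>B\<in>P. A \<noteq> B \<longrightarrow> A \<inter> B = {}"
      using P(1) by (auto simp: partition_on_def disjoint_def intro: finite_subset[of _ "set bs"])
    then have "(\<Sum>J\<in>P. sum k J) = sum k (\<Union>P)"
      using sum.Union_disjoint[of P k] by simp
    moreover have "\<Union>P = ?V" using P(1) by (auto simp: partition_on_def)
    ultimately have "(\<Sum>b\<in>?V. int (cst (f b))) \<le> (\<Sum>b\<in>?V. int (cst (f' b)))"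
      by (simp add: k_def sum_subtractf)
    then have "int (\<Sum>b\<in>?V. cst (f b)) \<le> int (\<Sum>b\<in>?V. cst (f' b))" by simp
    then show False using less by (simp only: of_nat_le_iff)
  qed
  then obtain J where J: "J \<in> P" "sum k J < 0" by blast
  have JV: "J \<subseteq> ?V" using J P(1) by (auto simp: partition_on_def)
  then have "finite J" using finite_subset by blast
  then obtain js where js: "distinct js" "set js = J" using finite_distinct_list by blast
  define y where "y b = (if b \<in> J then f' b else f b)" for b
  have sumy: "(\<Sum>b\<in>?V. h (y b)) = (\<Sum>b\<in>?V. h (f b)) + (\<Sum>b\<in>J. h (f' b) - h (f b))" for h :: "'c \<Rightarrow> int"
  proof -
    have "(\<Sum>b\<in>?V. h (y b)) = (\<Sum>b\<in>?V. h (f b) + (if b \<in> J then h (f' b) - h (f b) else 0))"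
      by (intro sum.cong) (auto simp: y_def)
    also have "\<dots> = (\<Sum>b\<in>?V. h (f b)) + (\<Sum>b\<in>?V. if b \<in> J then h (f' b) - h (f b) else 0)"
      by (rule sum.distrib)
    also have "(\<Sum>b\<in>?V. if b \<in> J then h (f' b) - h (f b) else 0) = (\<Sum>b\<in>J. h (f' b) - h (f b))"
      using JV by (subst sum.inter_restrict[symmetric]) (auto simp: Int_absorb1)
    finally show ?thesis .
  qed
  define ms where "ms = map (\<lambda>b. (f b, f' b)) js"
  define f2 where "f2 = fold (rewrite_first bs) ms f"
  have mt: "\<And>b. b \<in> ?V \<Longrightarrow> matchp b (f b)" "\<And>b. b \<in> ?V \<Longrightarrow> matchp b (f' b)"
    using f f' by (auto simp: valid_choice_def)
  have f2: "image_mset f2 (mset_set ?V) = image_mset y (mset_set ?V)" "\<And>b. b \<in> ?V \<Longrightarrow> matchp b (f2 b)"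
    using rewrite_first_fold[of matchp bs f f' js, OF tr mt js(1)] js(2) JV
    by (auto simp: f2_def ms_def y_def[abs_def])
  \<comment> \<open>Sums over the codes see only their multiset, so it does not matter at which
    blocks the moves have put them.\<close>
  have sums: "(\<Sum>b\<in>?V. h (f2 b)) = (\<Sum>b\<in>?V. h (y b))" for h :: "'c \<Rightarrow> int"
  proof -
    have "(\<Sum>b\<in>?V. h (g b)) = sum_mset (image_mset h (image_mset g (mset_set ?V)))" for g :: "_ \<Rightarrow> 'c"
      by (simp add: sum_unfold_sum_mset multiset.map_comp comp_def)
    then show ?thesis using f2(1) by simp
  qed
  have "f2 ` ?V = y ` ?V"
    using arg_cong[OF f2(1), of set_mset] by simp
  moreover have "\<forall>b\<in>?V. okp (y b)" using f f' by (auto simp: valid_choice_def y_def)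
  ultimately have "\<forall>b\<in>?V. okp (f2 b)" by (metis imageE imageI)
  moreover have "(\<Sum>b\<in>?V. con (f2 b) d) = 0" if "d \<in> D" for d
    using sums[of "\<lambda>c. con c d"] sumy[of "\<lambda>c. con c d"] f P(2)[OF J(1) that] that
    by (simp add: e_def valid_choice_def)
  ultimately have "valid_choice ?V matchp okp D con f2"
    using f2(2) by (auto simp: valid_choice_def)
  moreover have "(\<Sum>b\<in>?V. int (cst (f2 b))) < (\<Sum>b\<in>?V. int (cst (f b)))"
    using sums[of "\<lambda>c. int (cst c)"] sumy[of "\<lambda>c. int (cst c)"] J(2) by (simp add: k_def)
  then have "int (\<Sum>b\<in>?V. cst (f2 b)) < int (\<Sum>b\<in>?V. cst (f b))" by simp
  then have "(\<Sum>b\<in>?V. cst (f2 b)) < (\<Sum>b\<in>?V. cst (f b))" by (simp only: of_nat_less_iff)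
  moreover have "length ms \<le> group_bound (2 * B) (card D)"
    using P(3)[OF J(1)] js distinct_card[of js] by (simp add: ms_def)
  moreover have "set ms \<subseteq> f ` ?V \<times> f' ` ?V" using js JV by (auto simp: ms_def)
  ultimately show ?thesis unfolding f2_def by blast
qed

section \<open>Eulerian components and level functions\<close>

text \<open>Level functions certify solutions: arcs between levels only go up, and each level is balanced.\<close>

definition levelled :: "'a set \<Rightarrow> ('a \<times> 'a) set \<Rightarrow> ('a \<Rightarrow> nat) \<Rightarrow> bool" where
  "levelled V F lab \<longleftrightarrow> (\<forall>(u, v)\<in>F. lab u \<le> lab v) \<and>
     (\<forall>v\<in>V. card {u. (u, v) \<in> F \<and> lab u = lab v} = card {u. (v, u) \<in> F \<and> lab u = lab v})"

text \<open>Count the arcs with tail in \<open>T\<close> and those with head in \<open>T\<close>: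
  balance makes both numbers equal, and closure puts the first set inside the second. So the two
  sets coincide and no arc enters \<open>T\<close> from outside.\<close>

lemma balanced_closed:
  assumes "finite A" "finite T" "\<And>a b. (a, b) \<in> A \<Longrightarrow> a \<in> T \<Longrightarrow> b \<in> T"
    "\<And>x. x \<in> T \<Longrightarrow> card {u. (u, x) \<in> A} = card {u. (x, u) \<in> A}"
    "(a, b) \<in> A" "b \<in> T"
  shows "a \<in> T"
proof -
  let ?O = "{e\<in>A. fst e \<in> T}" and ?I = "{e\<in>A. snd e \<in> T}"
  have O: "?O = (SIGMA x:T. {u. (x, u) \<in> A})" by auto
  have I: "?I = (\<lambda>(x, u). (u, x)) ` (SIGMA x:T. {u. (u, x) \<in> A})" by force
  have fin: "finite {u. (u, x) \<in> A}" "finite {u. (x, u) \<in> A}" for x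
    using finite_subset[of "{u. (u, x) \<in> A}" "fst ` A"] finite_subset[of "{u. (x, u) \<in> A}" "snd ` A"] assms(1)
    by force+
  have "card ?I = (\<Sum>x\<in>T. card {u. (u, x) \<in> A})"
    unfolding I by (subst card_image) (auto simp: inj_on_def fin assms(2))
  also have "\<dots> = (\<Sum>x\<in>T. card {u. (x, u) \<in> A})" using assms(4) by (intro sum.cong) auto
  also have "\<dots> = card ?O" unfolding O by (simp add: fin assms(2))
  finally have "card ?O = card ?I" by simp
  moreover have "?O \<subseteq> ?I" using assms(3) by auto
  moreover have "finite ?I" using assms(1) by simp
  ultimately have "?O = ?I" by (intro card_subset_eq) auto
  moreover have "(a, b) \<in> ?I" using assms(5,6) by simp
  ultimately have "(a, b) \<in> ?O" by (simp only:)
  then show ?thesis by simp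
qed

lemma reachable_pair:
  assumes "pair_wf_digraph P"
  shows "reachable (with_proj P) u v \<longleftrightarrow> u \<in> pverts P \<and> (u, v) \<in> (parcs P)\<^sup>*"
proof
  assume "reachable (with_proj P) u v"
  then show "u \<in> pverts P \<and> (u, v) \<in> (parcs P)\<^sup>*"
    using reachable_rtranclI[of "with_proj P" u v] by (auto elim: reachable_in_vertsE)
next
  interpret pair_wf_digraph P by fact
  assume "u \<in> pverts P \<and> (u, v) \<in> (parcs P)\<^sup>*"
  then have "(u, v) \<in> (parcs P)\<^sup>*" "u \<in> pverts P" by auto
  then show "reachable (with_proj P) u v"
  proof (induction rule: rtrancl_induct)
    case base
    then show ?case by simp
  next
    case (step y z)
    then show ?case using reachable_adj_trans[of u y z] by simp
  qed
qed

lemma sccs_pair: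
  assumes "pair_wf_digraph P"
  shows "pre_digraph.sccs (with_proj P) = induce_subgraph (with_proj P) `
    {S. S \<noteq> {} \<and> S \<subseteq> pverts P \<and> (\<forall>u\<in>S. \<forall>v\<in>S. (u, v) \<in> (parcs P)\<^sup>*) \<and>
      (\<forall>u\<in>S. \<forall>v\<in>pverts P - S. (u, v) \<notin> (parcs P)\<^sup>* \<or> (v, u) \<notin> (parcs P)\<^sup>*)}"
proof -
  interpret pair_wf_digraph P by fact
  have "sccs_verts = {S. S \<noteq> {} \<and> S \<subseteq> pverts P \<and> (\<forall>u\<in>S. \<forall>v\<in>S. (u, v) \<in> (parcs P)\<^sup>*) \<and>
      (\<forall>u\<in>S. \<forall>v\<in>pverts P - S. (u, v) \<notin> (parcs P)\<^sup>* \<or> (v, u) \<notin> (parcs P)\<^sup>*)}"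
    (is "_ = ?R")
  proof (rule set_eqI)
    fix S
    have "S \<in> sccs_verts \<longleftrightarrow> S \<noteq> {} \<and> (\<forall>u\<in>S. \<forall>v\<in>S. u \<in> pverts P \<and> (u, v) \<in> (parcs P)\<^sup>*) \<and>
        (\<forall>u\<in>S. \<forall>v. v \<notin> S \<longrightarrow> \<not> (u \<in> pverts P \<and> (u, v) \<in> (parcs P)\<^sup>*) \<or>
          \<not> (v \<in> pverts P \<and> (v, u) \<in> (parcs P)\<^sup>*))"
      by (simp add: sccs_verts_def reachable_pair[OF assms])
    also have "\<dots> \<longleftrightarrow> S \<in> ?R" by blast
    finally show "S \<in> sccs_verts \<longleftrightarrow> S \<in> ?R" .
  qed
  then show ?thesis using sccs_conv_sccs_verts by simp
qed

lemma eulerian_induce: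
  assumes "S \<subseteq> pverts P"
  shows "eulerian (with_proj P \<restriction> S) \<longleftrightarrow>
    (\<forall>v\<in>S. card {u\<in>S. (u, v) \<in> parcs P} = card {u\<in>S. (v, u) \<in> parcs P})"
proof -
  have "in_degree (with_proj P \<restriction> S) v = card {u\<in>S. (u, v) \<in> parcs P}" if "v \<in> S" for v
  proof -
    have "in_arcs (with_proj P \<restriction> S) v = (\<lambda>u. (u, v)) ` {u\<in>S. (u, v) \<in> parcs P}"
      using that by (auto simp: in_arcs_def)
    then show ?thesis by (simp add: in_degree_def card_image inj_on_def)
  qed
  moreover have "out_degree (with_proj P \<restriction> S) v = card {u\<in>S. (v, u) \<in> parcs P}" if "v \<in> S" for v
  proof -
    have "out_arcs (with_proj P \<restriction> S) v = (\<lambda>u. (v, u)) ` {u\<in>S. (v, u) \<in> parcs P}"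
      using that by (auto simp: out_arcs_def)
    then show ?thesis by (simp add: out_degree_def card_image inj_on_def)
  qed
  ultimately show ?thesis by (simp add: eulerian_def)
qed

text \<open>From Eulerian components, the level of a vertex is the number of vertices that reach it.
  Conversely, balance forces every arc inside a level to lie on a closed walk, so an arc lies inside
  a component exactly if its ends have the same level.\<close>

lemma eulerian_sccs_iff_levelled:
  assumes "pair_wf_digraph P" "finite (pverts P)"
  shows "(\<forall>H\<in>pre_digraph.sccs (with_proj P). eulerian H) \<longleftrightarrow> (\<exists>lab. levelled (pverts P) (parcs P) lab)"
proof
  let ?V = "pverts P" and ?F = "parcs P"
  have FV: "u \<in> ?V" "v \<in> ?V" if "(u, v) \<in> ?F" for u v
    using that assms(1) by (auto simp: pair_wf_digraph_def)
  have star: "v \<in> ?V" if "(u, v) \<in> ?F\<^sup>*" "u \<in> ?V" for u v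
    using that by (induction rule: rtrancl_induct) (auto dest: FV)
  have finF: "finite ?F"
    using FV assms(2) by (intro finite_subset[of ?F "?V \<times> ?V"]) auto
  {
    assume eul: "\<forall>H\<in>pre_digraph.sccs (with_proj P). eulerian H"
    define lab where "lab v = card {w\<in>?V. (w, v) \<in> ?F\<^sup>*}" for v
    have sub: "{w\<in>?V. (w, u) \<in> ?F\<^sup>*} \<subseteq> {w\<in>?V. (w, v) \<in> ?F\<^sup>*}" if "(u, v) \<in> ?F" for u v
      using that by auto
    have le: "lab u \<le> lab v" if "(u, v) \<in> ?F" for u v
      unfolding lab_def using sub[OF that] assms(2) by (intro card_mono) auto
    \<comment> \<open>Along an arc the sets of vertices reaching its ends are nested, so equal
      cardinality means equal sets, and then \<open>v\<close> itself reaches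
      \<open>u\<close>.\<close>
    have eq: "lab u = lab v \<longleftrightarrow> (v, u) \<in> ?F\<^sup>*" if "(u, v) \<in> ?F" for u v
    proof
      assume "lab u = lab v"
      then have "{w\<in>?V. (w, u) \<in> ?F\<^sup>*} = {w\<in>?V. (w, v) \<in> ?F\<^sup>*}"
        unfolding lab_def using sub[OF that] assms(2) by (intro card_subset_eq) auto
      moreover have "v \<in> {w\<in>?V. (w, v) \<in> ?F\<^sup>*}" using FV[OF that] by simp
      ultimately show "(v, u) \<in> ?F\<^sup>*" by blast
    next
      assume "(v, u) \<in> ?F\<^sup>*"
      then have "{w\<in>?V. (w, v) \<in> ?F\<^sup>*} \<subseteq> {w\<in>?V. (w, u) \<in> ?F\<^sup>*}" by (auto intro: rtrancl_trans)
      then show "lab u = lab v" unfolding lab_def using sub[OF that] by (simp add: subset_antisym)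
    qed
    have "card {u. (u, v) \<in> ?F \<and> lab u = lab v} = card {u. (v, u) \<in> ?F \<and> lab u = lab v}" if v: "v \<in> ?V" for v
    proof -
      let ?S = "{u\<in>?V. (v, u) \<in> ?F\<^sup>* \<and> (u, v) \<in> ?F\<^sup>*}"
      have "with_proj P \<restriction> ?S \<in> pre_digraph.sccs (with_proj P)"
        unfolding sccs_pair[OF assms(1)]
        by (rule imageI) (use v in \<open>auto intro: rtrancl_trans\<close>)
      then have "card {u\<in>?S. (u, v) \<in> ?F} = card {u\<in>?S. (v, u) \<in> ?F}"
        using eul eulerian_induce[of ?S P] v by auto
      moreover have "{u\<in>?S. (u, v) \<in> ?F} = {u. (u, v) \<in> ?F \<and> lab u = lab v}"
        using eq FV by (auto dest: r_into_rtrancl)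
      moreover have "{u\<in>?S. (v, u) \<in> ?F} = {u. (v, u) \<in> ?F \<and> lab u = lab v}"
        using eq[of v] FV by (auto dest: r_into_rtrancl) (metis r_into_rtrancl)+
      ultimately show ?thesis by simp
    qed
    then show "\<exists>lab. levelled ?V ?F lab" using le unfolding levelled_def by blast
  next
    assume "\<exists>lab. levelled ?V ?F lab"
    then obtain lab where lev: "levelled ?V ?F lab" by blast
    have le: "lab u \<le> lab v" if "(u, v) \<in> ?F" for u v
      using lev that by (auto simp: levelled_def)
    have bal: "card {u. (u, v) \<in> ?F \<and> lab u = lab v} = card {u. (v, u) \<in> ?F \<and> lab u = lab v}" if "v \<in> ?V" for v
      using lev that by (auto simp: levelled_def)
    have le': "lab u \<le> lab v" if "(u, v) \<in> ?F\<^sup>*" for u v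
      using that by (induction rule: rtrancl_induct) (auto dest: le)
    define A where "A = {(a, b) \<in> ?F. lab a = lab b}"
    \<comment> \<open>The set \<open>T\<close> of vertices that \<open>b\<close> reaches along arcs
      inside its level is closed under these arcs and balanced, so \<open>balanced_closed\<close>
      puts the tail \<open>a\<close> of the arc into \<open>b\<close> in \<open>T\<close> as
      well.\<close>
    have bk: "(b, a) \<in> ?F\<^sup>*" if ab: "(a, b) \<in> A" for a b
    proof -
      let ?T = "{x. (b, x) \<in> A\<^sup>*}"
      have AF: "A \<subseteq> ?F" by (auto simp: A_def)
      have "?T \<subseteq> ?V" using star[of b] FV[of a b] rtrancl_mono[OF AF] ab AF by blast
      then have "finite ?T" using assms(2) finite_subset by blast
      have "a \<in> ?T"
      proof (rule balanced_closed[OF _ \<open>finite ?T\<close> _ _ ab])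
        show "finite A" using finF AF finite_subset by blast
        fix x assume "x \<in> ?T"
        then have "x \<in> ?V" using \<open>?T \<subseteq> ?V\<close> by blast
        then show "card {u. (u, x) \<in> A} = card {u. (x, u) \<in> A}"
          using bal[of x] by (simp add: A_def eq_commute)
      qed auto
      then show ?thesis using rtrancl_mono[OF AF] by blast
    qed
    show "\<forall>H\<in>pre_digraph.sccs (with_proj P). eulerian H"
    proof
      fix H assume "H \<in> pre_digraph.sccs (with_proj P)"
      then obtain S where H: "H = with_proj P \<restriction> S" and S: "S \<subseteq> ?V"
        "\<And>u v. u \<in> S \<Longrightarrow> v \<in> S \<Longrightarrow> (u, v) \<in> ?F\<^sup>*"
        "\<And>u v. u \<in> S \<Longrightarrow> v \<in> ?V - S \<Longrightarrow> (u, v) \<notin> ?F\<^sup>* \<or> (v, u) \<notin> ?F\<^sup>*"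
        unfolding sccs_pair[OF assms(1)] by blast
      have "{u\<in>S. (u, v) \<in> ?F} = {u. (u, v) \<in> ?F \<and> lab u = lab v}" if v: "v \<in> S" for v
      proof (intro set_eqI iffI)
        fix u assume "u \<in> {u\<in>S. (u, v) \<in> ?F}"
        then show "u \<in> {u. (u, v) \<in> ?F \<and> lab u = lab v}"
          using le[of u v] le'[OF S(2)[of v u]] v by auto
      next
        fix u assume "u \<in> {u. (u, v) \<in> ?F \<and> lab u = lab v}"
        then have "(u, v) \<in> ?F\<^sup>*" "(v, u) \<in> ?F\<^sup>*" "(u, v) \<in> ?F" using bk[of u v] by (auto simp: A_def)
        then show "u \<in> {u\<in>S. (u, v) \<in> ?F}" using S(3)[OF v, of u] FV by blast
      qed
      moreover have "{u\<in>S. (v, u) \<in> ?F} = {u. (v, u) \<in> ?F \<and> lab u = lab v}" if v: "v \<in> S" for v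
      proof (intro set_eqI iffI)
        fix u assume "u \<in> {u\<in>S. (v, u) \<in> ?F}"
        then show "u \<in> {u. (v, u) \<in> ?F \<and> lab u = lab v}"
          using le[of v u] le'[OF S(2)[of u v]] v by auto
      next
        fix u assume "u \<in> {u. (v, u) \<in> ?F \<and> lab u = lab v}"
        then have "(u, v) \<in> ?F\<^sup>*" "(v, u) \<in> ?F\<^sup>*" "(v, u) \<in> ?F" using bk[of v u] by (auto simp: A_def)
        then show "u \<in> {u\<in>S. (v, u) \<in> ?F}" using S(3)[OF v, of u] FV by blast
      qed
      ultimately show "eulerian H" unfolding H using eulerian_induce[OF S(1)] bal S(1) by auto
    qed
  }
qed

lemma sescad_iff:
  assumes "pair_digraph G"
  shows "sescad (G, k) \<longleftrightarrow>
    (\<exists>R\<subseteq>parcs G. int (card R) \<le> k \<and> (\<exists>lab. levelled (pverts G) (parcs G - R) lab))"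
proof -
  interpret pair_digraph G by fact
  have "pair_wf_digraph (remove_arcs G R)" for R
    using wellformed by (auto simp: pair_wf_digraph_def remove_arcs_def)
  moreover have "pverts (remove_arcs G R) = pverts G" "parcs (remove_arcs G R) = parcs G - R" for R
    by (auto simp: remove_arcs_def)
  ultimately show ?thesis
    using eulerian_sccs_iff_levelled[of "remove_arcs G _"] finite_verts by (simp add: sescad_def)
qed

section \<open>Bounding the levels\<close>

text \<open>The order is kept for the pairs that an arc can join: those with a member of
  \<open>M\<close> and those within a block. The new level lists the position relative to the levels
  of \<open>M\<close> first and the rank inside the block second. The first is at most
  \<open>2 * y\<close>, the second at most \<open>y\<close>, so fewer than
  \<open>4 * (y + 1) ^ 2\<close> values suffice.\<close>

lemma compress_levels:
  fixes lab :: "'a \<Rightarrow> nat"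
  assumes "finite V" "M \<subseteq> V" "card M \<le> y" "\<And>v. v \<in> V - M \<Longrightarrow> card {w\<in>V. blk w = blk v} \<le> y"
  shows "\<exists>lab'. (\<forall>v\<in>V. lab' v < 4 * (y + 1) ^ 2) \<and>
    (\<forall>u\<in>V. \<forall>v\<in>V. u \<in> M \<or> v \<in> M \<or> blk u = blk v \<longrightarrow> (lab' u \<le> lab' v \<longleftrightarrow> lab u \<le> (lab v :: nat)))"
proof -
  define L where "L v = {l\<in>lab ` M. l < lab v}" for v
  define L' where "L' v = {l\<in>lab ` M. l \<le> lab v}" for v
  \<comment> \<open>On a level of \<open>M\<close> the rank is 0, because vertices of different
    blocks that share such a level must receive the same new level as the vertex of
    \<open>M\<close>.\<close>
  define r where "r v = (if lab v \<in> lab ` M then 0 else card {l\<in>lab ` {w\<in>V. blk w = blk v}. l < lab v})" for v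
  \<comment> \<open>Adding the strict and the weak count separates a level of \<open>M\<close> from
    the open gaps on either side of it.\<close>
  define S where "S v = card (L v) + card (L' v)" for v
  define f where "f v = (y + 1) * S v + r v" for v
  have finM: "finite M" using assms(1,2) finite_subset by blast
  have fin: "finite (L v)" "finite (L' v)" for v using finM by (auto simp: L_def L'_def)
  have cM: "card (lab ` M) \<le> y" using card_image_le[OF finM, of lab] assms(3) by simp
  have S: "S v \<le> 2 * y" for v
  proof -
    have "card (L v) \<le> card (lab ` M)" "card (L' v) \<le> card (lab ` M)"
      using finM by (auto simp: L_def L'_def intro!: card_mono)
    then show ?thesis using cM by (simp add: S_def)
  qed
  have r: "r v \<le> y" if "v \<in> V" for v
  proof (cases "lab v \<in> lab ` M")
    case False
    then have "v \<in> V - M" using that by auto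
    have "card {l\<in>lab ` {w\<in>V. blk w = blk v}. l < lab v} \<le> card (lab ` {w\<in>V. blk w = blk v})"
      using assms(1) by (intro card_mono) auto
    also have "\<dots> \<le> card {w\<in>V. blk w = blk v}" using assms(1) by (intro card_image_le) auto
    also have "\<dots> \<le> y" by (rule assms(4)) fact
    finally show ?thesis by (simp add: r_def)
  qed (simp add: r_def)
  have bound: "f v < 4 * (y + 1) ^ 2" if "v \<in> V" for v
  proof -
    have "f v \<le> (y + 1) * (2 * y) + y" unfolding f_def using S[of v] r[OF that] by (intro add_mono mult_le_mono2) auto
    also have "\<dots> < 4 * (y + 1) ^ 2" by (simp add: power2_eq_square)
    finally show ?thesis .
  qed
  have eq: "f u = f v" if "lab u = lab v" "u \<in> M \<or> v \<in> M \<or> blk u = blk v" for u v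
  proof -
    have "S u = S v" using that by (simp add: S_def L_def L'_def)
    moreover have "r u = r v"
    proof (cases "lab v \<in> lab ` M")
      case True
      then show ?thesis using that(1) by (simp add: r_def)
    next
      case False
      then have "u \<notin> M" "v \<notin> M" using that(1) by (metis imageI)+
      then show ?thesis using that by (simp add: r_def)
    qed
    ultimately show ?thesis by (simp add: f_def)
  qed
  have lt: "f u < f v" if lt: "lab u < lab v" and uv: "u \<in> V" "v \<in> V" "u \<in> M \<or> v \<in> M \<or> blk u = blk v" for u v
  proof -
    have sub: "L u \<subseteq> L v" "L' u \<subseteq> L' v" using lt by (auto simp: L_def L'_def)
    have le: "card (L u) \<le> card (L v)" "card (L' u) \<le> card (L' v)" using sub fin by (auto intro: card_mono)
    show ?thesis
    proof (cases "S u < S v")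
      case True
      have "f u < (y + 1) * (S u + 1)" using r[OF uv(1)] by (simp add: f_def)
      also have "\<dots> \<le> (y + 1) * S v" using True by (intro mult_le_mono2) simp
      finally show ?thesis by (simp add: f_def)
    next
      case False
      have "card (L u) = card (L v)" "card (L' u) = card (L' v)" using False le by (auto simp: S_def)
      then have "L u = L v" "L' u = L' v" 
        using card_subset_eq[OF fin(1) sub(1)] card_subset_eq[OF fin(2) sub(2)] by blast+
      have "lab u \<notin> lab ` M"
      proof
        assume "lab u \<in> lab ` M"
        then have "lab u \<in> L v" using lt by (simp add: L_def)
        then show False using \<open>L u = L v\<close> by (auto simp: L_def)
      qed
      moreover have "lab v \<notin> lab ` M"
      proof
        assume "lab v \<in> lab ` M"
        then have "lab v \<in> L' v" by (simp add: L'_def)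
        then have "lab v \<in> L' u" using \<open>L' u = L' v\<close> by simp
        then show False using lt by (simp add: L'_def)
      qed
      ultimately have "blk u = blk v" using uv(3) by auto
      have ps: "{l\<in>lab ` {w\<in>V. blk w = blk u}. l < lab u} \<subset> {l\<in>lab ` {w\<in>V. blk w = blk v}. l < lab v}"
        using \<open>blk u = blk v\<close> lt uv(1) by auto
      then have "r u < r v" using \<open>lab u \<notin> lab ` M\<close> \<open>lab v \<notin> lab ` M\<close> assms(1)
        psubset_card_mono[OF _ ps] by (simp add: r_def)
      moreover have "S u = S v" using False le by (simp add: S_def)
      ultimately show ?thesis by (simp add: f_def)
    qed
  qed
  show ?thesis
  proof (intro exI[of _ f] conjI ballI impI)
    fix u v assume uv: "u \<in> V" "v \<in> V" "u \<in> M \<or> v \<in> M \<or> blk u = blk v"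
    show "f u \<le> f v \<longleftrightarrow> lab u \<le> lab v"
      using eq[of u v] lt[of u v] lt[of v u] uv by (cases "lab u" "lab v" rule: linorder_cases) auto
  qed (rule bound)
qed

section \<open>High-degree vertices and vertex integrity\<close>

definition arc_degree :: "'a pair_pre_digraph \<Rightarrow> 'a \<Rightarrow> nat" where
  "arc_degree G v = card {e\<in>parcs G. fst e = v \<or> snd e = v}"

definition hubs :: "'a pair_pre_digraph \<Rightarrow> nat \<Rightarrow> 'a set" where
  "hubs G q = {v\<in>pverts G. q < arc_degree G v}"

text \<open>All hubs form one class, so a single bound on the class sizes limits both the number of
  hubs and the components that remain without them.\<close>

definition links :: "'a pair_pre_digraph \<Rightarrow> nat \<Rightarrow> ('a \<times> 'a) set" where
  "links G q = {(u, v). u \<in> pverts G \<and> v \<in> pverts G \<and>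
     (if u \<in> hubs G q then v \<in> hubs G q else v \<notin> hubs G q \<and> ((u, v) \<in> parcs G \<or> (v, u) \<in> parcs G))}"

text \<open>A vertex outside the witness \<open>M\<close> has its neighbours in \<open>M\<close> and
  in its own component, at most \<open>p\<close> of them, each joined by at most two arcs; so hubs
  lie in \<open>M\<close>. A class can pass through the other members of \<open>M\<close>, but these
  have at most \<open>2 * p\<close> neighbours each and hence open at most \<open>2 * p\<close>
  further components of size at most \<open>p\<close>.\<close>

theorem links_class_bound:
  assumes G: "pair_digraph G" and vi: "has_vertex_integrity G p"
  shows "card {u. (v, u) \<in> (links G (2 * p))\<^sup>*} \<le> (2 * p + 2) ^ 3"
proof -
  interpret pair_digraph G by fact
  let ?V = "pverts G" and ?E = "parcs G" and ?q = "2 * p"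
  let ?H = "hubs G ?q"
  from vi obtain M where M: "M \<subseteq> ?V" "card M \<le> p"
    "\<And>C. C \<in> undirected_components (with_proj G \<restriction> (?V - M)) \<Longrightarrow> card (verts C) \<le> p - card M"
    unfolding has_vertex_integrity_def by blast
  have finM: "finite M" using M(1) finite_verts finite_subset by blast
  define A where "A = {(a, b). a \<notin> M \<and> b \<notin> M \<and> ((a, b) \<in> ?E \<or> (b, a) \<in> ?E)}"
  have EV: "a \<in> ?V" "b \<in> ?V" if "(a, b) \<in> ?E" for a b using that by (auto dest: in_arcsD1 in_arcsD2)
  define U where "U = mk_symmetric (with_proj G \<restriction> (?V - M))"
  have U: "pverts U = ?V - M" "parcs U = A"
    using EV by (auto simp: U_def parcs_mk_symmetric A_def)
  have wfU: "pair_wf_digraph U" unfolding pair_wf_digraph_def U using EV by (auto simp: A_def)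
  define C where "C v = {z. (v, z) \<in> A\<^sup>*}" for v
  have symA: "(b, a) \<in> A\<^sup>*" if "(a, b) \<in> A\<^sup>*" for a b
    using that by (rule sym_rtrancl[THEN symD, rotated]) (auto simp: sym_def A_def)
  have CV: "C v \<subseteq> ?V - M" if "v \<in> ?V - M" for v
  proof
    fix z assume "z \<in> C v"
    then have "(v, z) \<in> A\<^sup>*" by (simp add: C_def)
    then show "z \<in> ?V - M" using that by (induction rule: rtrancl_induct) (use EV in \<open>auto simp: A_def\<close>)
  qed
  have cardC: "card (C v) \<le> p - card M" if v: "v \<in> ?V - M" for v
  proof -
    have "with_proj U \<restriction> C v \<in> pre_digraph.sccs (with_proj U)"
      unfolding sccs_pair[OF wfU] U
      by (rule imageI) (use v CV[OF v] in \<open>auto simp: C_def intro: rtrancl_trans symA\<close>)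
    then show ?thesis using M(3)[of "with_proj U \<restriction> C v"] by (simp add: undirected_components_def U_def)
  qed
  define Nb where "Nb v = {u. (v, u) \<in> ?E \<or> (u, v) \<in> ?E}" for v
  have finC: "finite (C v)" if "v \<in> ?V - M" for v using CV[OF that] finite_verts finite_subset by blast
  have hubM: "?H \<subseteq> M"
  proof
    fix v assume v: "v \<in> ?H"
    show "v \<in> M"
    proof (rule ccontr)
      assume "v \<notin> M"
      then have vV: "v \<in> ?V - M" using v by (auto simp: hubs_def)
      have "Nb v \<subseteq> M \<union> C v" using \<open>v \<notin> M\<close> by (auto simp: Nb_def C_def A_def)
      then have "card (Nb v) \<le> card (M \<union> C v)" using finM finC[OF vV] by (intro card_mono) auto
      also have "\<dots> \<le> card M + card (C v)" by (rule card_Un_le)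
      also have "\<dots> \<le> p" using cardC[OF vV] M(2) by simp
      finally have nb: "card (Nb v) \<le> p" .
      have finN: "finite (Nb v)" using \<open>Nb v \<subseteq> M \<union> C v\<close> finM finC[OF vV] finite_subset by blast
      have "{e\<in>?E. fst e = v \<or> snd e = v} \<subseteq> Pair v ` Nb v \<union> (\<lambda>u. (u, v)) ` Nb v"
        by (auto simp: Nb_def)
      then have "arc_degree G v \<le> card (Pair v ` Nb v \<union> (\<lambda>u. (u, v)) ` Nb v)"
        unfolding arc_degree_def using finN by (intro card_mono) auto
      also have "\<dots> \<le> card (Pair v ` Nb v) + card ((\<lambda>u. (u, v)) ` Nb v)" by (rule card_Un_le)
      also have "\<dots> \<le> card (Nb v) + card (Nb v)" by (intro add_mono card_image_le finN)
      finally have "arc_degree G v \<le> ?q" using nb by simp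
      then show False using v by (simp add: hubs_def)
    qed
  qed
  have NbH: "finite (Nb w)" "card (Nb w) \<le> ?q" if "w \<in> M - ?H" for w
  proof -
    let ?D = "{e\<in>?E. fst e = w \<or> snd e = w}"
    have sub: "Nb w \<subseteq> (\<lambda>e. if fst e = w then snd e else fst e) ` ?D"
    proof
      fix u assume "u \<in> Nb w"
      then have "(w, u) \<in> ?D \<or> (u, w) \<in> ?D" by (auto simp: Nb_def)
      then show "u \<in> (\<lambda>e. if fst e = w then snd e else fst e) ` ?D"
      proof
        assume "(w, u) \<in> ?D"
        then show ?thesis by (rule rev_image_eqI) simp
      next
        assume "(u, w) \<in> ?D"
        then show ?thesis by (rule rev_image_eqI) simp
      qed
    qed
    have finD: "finite ?D" using finite_arcs by simp
    show "finite (Nb w)" using sub finD finite_subset by blast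
    have "card (Nb w) \<le> card ((\<lambda>e. if fst e = w then snd e else fst e) ` ?D)"
      using finD by (intro card_mono[OF _ sub]) simp
    also have "\<dots> \<le> card ?D" by (rule card_image_le[OF finD])
    finally show "card (Nb w) \<le> ?q" using that M(1) by (auto simp: hubs_def arc_degree_def)
  qed
  show ?thesis
  proof (cases "v \<in> ?V")
    case False
    then have "{u. (v, u) \<in> (links G ?q)\<^sup>*} \<subseteq> {v}"
      by (auto simp: links_def elim: converse_rtranclE)
    then have "card {u. (v, u) \<in> (links G ?q)\<^sup>*} \<le> card {v}" by (intro card_mono) auto
    also have "\<dots> \<le> (2 * p + 2) ^ 3" by (simp add: one_le_power)
    finally show ?thesis .
  next
    case vV: True
    \<comment> \<open>If \<open>v\<close> is outside \<open>M\<close>, its own component is reached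
      without crossing \<open>M\<close>; every other component is entered from a member of
      \<open>M\<close> that is no hub.\<close>
    define W where "W = (if v \<in> M then {} else C v)"
    define X where "X = M \<union> W \<union> (\<Union>w\<in>M - ?H. \<Union>x\<in>Nb w - M. C x)"
    have "(v, u) \<in> (links G ?q)\<^sup>* \<Longrightarrow> u \<in> X" for u
    proof (induction rule: rtrancl_induct)
      case base
      then show ?case by (auto simp: X_def W_def C_def)
    next
      case (step u u')
      show ?case
      proof (cases "u' \<in> M")
        case False
        then have nh: "u' \<notin> ?H" "u \<notin> ?H" "u' \<in> Nb u" using step.hyps(2) hubM by (auto simp: links_def Nb_def split: if_splits)
        show ?thesis
        proof (cases "u \<in> M")
          case True
          then have "u' \<in> C u'" "u' \<in> Nb u - M" "u \<in> M - ?H" using nh False by (auto simp: C_def)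
          then show ?thesis by (auto simp: X_def)
        next
          case uM: False
          then have a: "(u, u') \<in> A" using nh False by (auto simp: A_def Nb_def)
          then have "u \<in> C x \<Longrightarrow> u' \<in> C x" for x by (auto simp: C_def intro: rtrancl.rtrancl_into_rtrancl)
          then show ?thesis using step.IH uM by (auto simp: X_def W_def split: if_splits)
        qed
      qed (simp add: X_def)
    qed
    then have sub: "{u. (v, u) \<in> (links G ?q)\<^sup>*} \<subseteq> X" by blast
    have W: "finite W" "card W \<le> p"
      using finC[of v] cardC[of v] vV by (auto simp: W_def)
    have Cx: "finite (C x)" "card (C x) \<le> p" if "x \<in> Nb w - M" for x w
    proof -
      have "x \<in> ?V - M" using that EV by (auto simp: Nb_def)
      from finC[OF this] cardC[OF this] show "finite (C x)" "card (C x) \<le> p" by auto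
    qed
    have Y: "finite (\<Union>x\<in>Nb w - M. C x)" "card (\<Union>x\<in>Nb w - M. C x) \<le> ?q * p" if "w \<in> M - ?H" for w
    proof -
      show "finite (\<Union>x\<in>Nb w - M. C x)" using NbH(1)[OF that] Cx(1) by blast
      have "card (\<Union>x\<in>Nb w - M. C x) \<le> (\<Sum>x\<in>Nb w - M. card (C x))"
        using NbH(1)[OF that] by (intro card_UN_le) auto
      also have "\<dots> \<le> (\<Sum>x\<in>Nb w - M. p)" using Cx(2) by (intro sum_mono) blast
      also have "\<dots> = card (Nb w - M) * p" by simp
      also have "\<dots> \<le> ?q * p" 
        by (intro mult_le_mono1 le_trans[OF card_mono[OF NbH(1)[OF that] Diff_subset] NbH(2)[OF that]])
      finally show "card (\<Union>x\<in>Nb w - M. C x) \<le> ?q * p" .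
    qed
    have "card (\<Union>w\<in>M - ?H. \<Union>x\<in>Nb w - M. C x) \<le> (\<Sum>w\<in>M - ?H. card (\<Union>x\<in>Nb w - M. C x))"
      using finM by (intro card_UN_le) auto
    also have "\<dots> \<le> (\<Sum>w\<in>M - ?H. ?q * p)" using Y(2) by (intro sum_mono) blast
    also have "\<dots> = card (M - ?H) * (?q * p)" by simp
    also have "\<dots> \<le> p * (?q * p)" 
      by (intro mult_le_mono1 le_trans[OF card_mono[OF finM Diff_subset] M(2)])
    finally have Z: "card (\<Union>w\<in>M - ?H. \<Union>x\<in>Nb w - M. C x) \<le> p * (?q * p)" .
    have finX: "finite X" using finM W Y(1) by (auto simp: X_def)
    have "card X \<le> card M + card W + card (\<Union>w\<in>M - ?H. \<Union>x\<in>Nb w - M. C x)"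
      unfolding X_def by (meson add_mono card_Un_le le_trans le_refl)
    also have "\<dots> \<le> p + p + p * (?q * p)" using M(2) W(2) Z by simp
    also have "\<dots> \<le> (2 * p + 2) ^ 3" by (simp add: power3_eq_cube algebra_simps)
    finally have "card X \<le> (2 * p + 2) ^ 3" .
    then show ?thesis using card_mono[OF finX sub] by simp
  qed
qed

section \<open>Numbers as sequences of digits\<close>

definition dig :: "nat \<Rightarrow> nat \<Rightarrow> nat \<Rightarrow> nat" where
  "dig B c p = c div B ^ p mod B"

lemma dig_less: "0 < B \<Longrightarrow> dig B c p < B"
  by (simp add: dig_def)

lemma ex_digits:
  assumes "\<And>p. p < n \<Longrightarrow> a p < B"
  shows "\<exists>c < B ^ n. \<forall>p<n. dig B c p = a p"
  using assms
proof (induction n arbitrary: a)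
  case (Suc n)
  from Suc.IH[of "\<lambda>p. a (Suc p)"] Suc.prems obtain c where
    c: "c < B ^ n" "\<And>p. p < n \<Longrightarrow> dig B c p = a (Suc p)" by auto
  have a0: "a 0 < B" using Suc.prems by simp
  have "B * c + a 0 < B * (c + 1)" using a0 by simp
  also have "\<dots> \<le> B * B ^ n" using c(1) by (intro mult_le_mono2) simp
  finally have "B * c + a 0 < B ^ Suc n" by simp
  moreover have "dig B (B * c + a 0) p = a p" if "p < Suc n" for p
  proof (cases p)
    case 0
    then show ?thesis using a0 by (simp add: dig_def)
  next
    case (Suc p')
    have "(B * c + a 0) div B = c" using a0 by simp
    then have "(B * c + a 0) div B ^ Suc p' = c div B ^ p'" by (simp add: div_mult2_eq)
    then show ?thesis using c(2)[of p'] Suc that by (simp add: dig_def)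
  qed
  ultimately show ?case by blast
qed simp

section \<open>Configurations of blocks\<close>

text \<open>A code describes a block of the graph together with a partial solution on it: digits
  \<open>4 t\<close> and \<open>4 t + 1\<close> are the local names of the endpoints of the \<open>t\<close>-th arc (or \<open>0\<close>), digit
  \<open>4 t + 2\<close> tells whether this arc is kept, and digit \<open>4 l + 3\<close> is the level of the vertex with
  local name \<open>l\<close>. Local names above \<open>y\<close> belong to hubs, whose levels are read from a common code \<open>z\<close>.\<close>

definition slots :: "nat \<Rightarrow> nat" where
  "slots y = 4 * (y + 1) ^ 2"

definition src :: "nat \<Rightarrow> nat \<Rightarrow> nat \<Rightarrow> nat" where "src X c t = dig X c (4 * t)"
definition dst :: "nat \<Rightarrow> nat \<Rightarrow> nat \<Rightarrow> nat" where "dst X c t = dig X c (4 * t + 1)"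
definition kept :: "nat \<Rightarrow> nat \<Rightarrow> nat \<Rightarrow> nat" where "kept X c t = dig X c (4 * t + 2)"
definition level :: "nat \<Rightarrow> nat \<Rightarrow> nat \<Rightarrow> nat \<Rightarrow> nat \<Rightarrow> nat" where
  "level X y z c l = dig X (if y < l then z else c) (4 * l + 3)"

text \<open>A slot without arc has source 0, while local names start at 1. The nested conditionals
  are those of the machine expressions that will evaluate these sums.\<close>

definition code_cost :: "nat \<Rightarrow> nat \<Rightarrow> nat" where
  "code_cost X c = (\<Sum>t<X. if src X c t = 0 then 0 else if kept X c t = 0 then 1 else 0)"

definition descents :: "nat \<Rightarrow> nat \<Rightarrow> nat \<Rightarrow> nat \<Rightarrow> nat" where
  "descents X y z c = (\<Sum>t<X. if src X c t = 0 then 0 else if kept X c t = 0 then 0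
     else if level X y z c (dst X c t) < level X y z c (src X c t) then 1 else 0)"

definition outs :: "nat \<Rightarrow> nat \<Rightarrow> nat \<Rightarrow> nat \<Rightarrow> nat \<Rightarrow> nat" where
  "outs X y z c l = (\<Sum>t<X. if src X c t = l then if kept X c t = 0 then 0
     else if level X y z c (src X c t) = level X y z c (dst X c t) then 1 else 0 else 0)"

definition ins :: "nat \<Rightarrow> nat \<Rightarrow> nat \<Rightarrow> nat \<Rightarrow> nat \<Rightarrow> nat" where
  "ins X y z c l = (\<Sum>t<X. if dst X c t = l then if kept X c t = 0 then 0
     else if level X y z c (src X c t) = level X y z c (dst X c t) then 1 else 0 else 0)"

text \<open>The names from 1 to \<open>y\<close> belong to vertices that are no hubs. All arcs at
  such a vertex lie in one block, so its balance is decided by a single code; at a hub a code only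
  contributes an imbalance.\<close>

definition code_ok :: "nat \<Rightarrow> nat \<Rightarrow> nat \<Rightarrow> nat \<Rightarrow> bool" where
  "code_ok X y z c \<longleftrightarrow> descents X y z c = 0 \<and> (\<forall>l<y. outs X y z c (Suc l) = ins X y z c (Suc l))"

definition imbalance :: "nat \<Rightarrow> nat \<Rightarrow> nat \<Rightarrow> nat \<Rightarrow> nat \<Rightarrow> int" where
  "imbalance X y z c l = int (outs X y z c l) - int (ins X y z c l)"

lemma abs_imbalance_le: "\<bar>imbalance X y z c l\<bar> \<le> int X"
proof -
  have "outs X y z c l \<le> (\<Sum>t<X. 1)" "ins X y z c l \<le> (\<Sum>t<X. 1)"
    unfolding outs_def ins_def by (intro sum_mono; simp)+
  then show ?thesis by (simp add: imbalance_def)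
qed

lemma sum_indicator: "finite A \<Longrightarrow> (\<Sum>j\<in>A. if P j then 1 else 0) = card {j\<in>A. P j}"
  using sum.inter_filter[of A "\<lambda>_. 1::nat" P] by simp

section \<open>Blocks, local names and the meaning of codes\<close>

text \<open>Interface between the graph and its codes. A block is named by some vertex, and a
  configuration assigns a code to every vertex in \<open>V\<close>; vertices that name no block are
  matched by codes without arcs. The hubs \<open>M\<close> form one block. An arc belongs to the
  block of an end that is no hub, or to the hub block if there is none, and \<open>sl\<close> is its
  slot there.\<close>

locale block_structure =
  fixes V M :: "nat set" and es :: "(nat \<times> nat) list" and blk ln eb sl :: "nat \<Rightarrow> nat" and y X :: nat
  assumes X: "X = slots y"
    and finite_V: "finite V" and M_subset: "M \<subseteq> V"
    and distinct_es: "distinct es" and es_subset: "set es \<subseteq> V \<times> V"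
    and blk_V: "\<And>v. v \<in> V \<Longrightarrow> blk v \<in> V"
    and eb: "\<And>j. j < length es \<Longrightarrow> eb j = (if fst (es ! j) \<in> M then blk (snd (es ! j)) else blk (fst (es ! j)))"
    and blk_arc: "\<And>u v. (u, v) \<in> set es \<Longrightarrow> u \<notin> M \<Longrightarrow> v \<notin> M \<Longrightarrow> blk u = blk v"
    and blk_M: "\<And>u v. u \<in> M \<Longrightarrow> v \<in> V \<Longrightarrow> blk v = blk u \<longleftrightarrow> v \<in> M"
    and ln_inj: "\<And>u v. u \<in> V \<Longrightarrow> v \<in> V \<Longrightarrow> blk u = blk v \<Longrightarrow> ln u = ln v \<Longrightarrow> u = v"
    and ln_pos: "\<And>v. v \<in> V \<Longrightarrow> 1 \<le> ln v"
    and ln_le: "\<And>v. v \<in> V \<Longrightarrow> ln v \<le> 2 * y"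
    and ln_M: "\<And>v. v \<in> V \<Longrightarrow> y < ln v \<longleftrightarrow> v \<in> M"
    and blk_card: "\<And>v. v \<in> V \<Longrightarrow> card {w\<in>V. blk w = blk v} \<le> y"
    and sl_inj: "\<And>i j. i < length es \<Longrightarrow> j < length es \<Longrightarrow> eb i = eb j \<Longrightarrow> sl i = sl j \<Longrightarrow> i = j"
    and sl_less: "\<And>j. j < length es \<Longrightarrow> sl j < X"
begin

abbreviation "tlv j \<equiv> fst (es ! j)"
abbreviation "hdv j \<equiv> snd (es ! j)"

text \<open>At most one summand differs from 0, since the arcs of a block have distinct slots; the
  value 0 marks an empty slot. The sum form lets the machine evaluate it by a loop.\<close>

definition tail_at :: "nat \<Rightarrow> nat \<Rightarrow> nat" where
  "tail_at b t = (\<Sum>j<length es. if eb j = b then if sl j = t then ln (tlv j) else 0 else 0)"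

definition head_at :: "nat \<Rightarrow> nat \<Rightarrow> nat" where
  "head_at b t = (\<Sum>j<length es. if eb j = b then if sl j = t then ln (hdv j) else 0 else 0)"

text \<open>A fitting code lists the arcs of the block in terms of local names only. Blocks that
  share one code therefore share all of them, which is what moving codes between blocks relies
  on.\<close>

definition matches :: "nat \<Rightarrow> nat \<Rightarrow> bool" where
  "matches b c \<longleftrightarrow> (\<forall>t<X. src X c t = tail_at b t \<and> dst X c t = head_at b t)"

definition valid :: "nat \<Rightarrow> (nat \<Rightarrow> nat) \<Rightarrow> bool" where
  "valid z cf \<longleftrightarrow> valid_choice V matches (code_ok X y z) {l. y < l \<and> l < X} (imbalance X y z) cf"

lemma X_large: "2 * y + 1 < X" "0 < X" "1 < X"
  by (auto simp: X slots_def power2_eq_square)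

lemma arc_V: "j < length es \<Longrightarrow> tlv j \<in> V" "j < length es \<Longrightarrow> hdv j \<in> V"
  using subsetD[OF es_subset nth_mem[of j es]] by (auto simp: mem_Times_iff)

lemma ln_nz: "j < length es \<Longrightarrow> ln (tlv j) \<noteq> 0"
  using ln_pos[OF arc_V(1)] by fastforce

lemma eb_V: "j < length es \<Longrightarrow> eb j \<in> V"
  using eb arc_V blk_V by simp

lemma eb_tl: "j < length es \<Longrightarrow> tlv j \<notin> M \<Longrightarrow> eb j = blk (tlv j)"
  using eb by simp

lemma eb_hd: "j < length es \<Longrightarrow> hdv j \<notin> M \<Longrightarrow> eb j = blk (hdv j)"
  using eb[of j] blk_arc[of "tlv j" "hdv j"] by (auto simp: nth_mem)

lemma matches_exchange: "matches b c \<Longrightarrow> matches b' c \<Longrightarrow> matches b c' \<Longrightarrow> matches b' c'"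
  by (simp add: matches_def)

lemma at_sl:
  assumes "j < length es"
  shows "tail_at (eb j) (sl j) = ln (tlv j)" "head_at (eb j) (sl j) = ln (hdv j)"
proof -
  have *: "(if eb i = eb j then if sl i = sl j then f i else 0 else 0) = (if i = j then f i else 0)"
    if "i < length es" for i and f :: "nat \<Rightarrow> nat"
    using sl_inj[OF that assms] by auto
  have "tail_at (eb j) (sl j) = (\<Sum>i<length es. if i = j then ln (tlv i) else 0)"
    unfolding tail_at_def by (intro sum.cong refl) (rule *, simp)
  then show "tail_at (eb j) (sl j) = ln (tlv j)" using assms by simp
  have "head_at (eb j) (sl j) = (\<Sum>i<length es. if i = j then ln (hdv i) else 0)"
    unfolding head_at_def by (intro sum.cong refl) (rule *, simp)
  then show "head_at (eb j) (sl j) = ln (hdv j)" using assms by simp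
qed

lemma at_none:
  assumes "\<And>j. j < length es \<Longrightarrow> eb j = b \<Longrightarrow> sl j \<noteq> t"
  shows "tail_at b t = 0" "head_at b t = 0"
  using assms unfolding tail_at_def head_at_def by (auto intro!: sum.neutral)

lemma at_less: "tail_at b t < X" "head_at b t < X"
proof -
  have "tail_at b t < X \<and> head_at b t < X"
  proof (cases "\<exists>j<length es. eb j = b \<and> sl j = t")
    case True
    then obtain j where j: "j < length es" "eb j = b" "sl j = t" by blast
    then have "tail_at b t = ln (tlv j)" "head_at b t = ln (hdv j)" using at_sl by auto
    then show ?thesis using ln_le[OF arc_V(1)[OF j(1)]] ln_le[OF arc_V(2)[OF j(1)]] X_large by simp
  next
    case False
    then show ?thesis using at_none[of b t] X_large by auto
  qed
  then show "tail_at b t < X" "head_at b t < X" by auto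
qed

abbreviation arcs_of :: "nat \<Rightarrow> nat set" where
  "arcs_of b \<equiv> {j \<in> {..<length es}. eb j = b}"

text \<open>Transfers sums over the slots of a code to the arcs of the block; the assumption on
  \<open>F 0 0\<close> makes the empty slots vanish.\<close>

lemma sum_slots:
  fixes F :: "nat \<Rightarrow> nat \<Rightarrow> nat \<Rightarrow> nat"
  assumes "matches b c" "\<And>t. F 0 0 t = 0"
  shows "(\<Sum>t<X. F (src X c t) (dst X c t) t) = (\<Sum>j\<in>arcs_of b. F (ln (tlv j)) (ln (hdv j)) (sl j))"
proof -
  have "(\<Sum>t<X. F (src X c t) (dst X c t) t) = (\<Sum>t\<in>sl ` arcs_of b. F (src X c t) (dst X c t) t)"
  proof (rule sum.mono_neutral_right)
    show "\<forall>t\<in>{..<X} - sl ` arcs_of b. F (src X c t) (dst X c t) t = 0"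
    proof
      fix t assume t: "t \<in> {..<X} - sl ` arcs_of b"
      then have "tail_at b t = 0" "head_at b t = 0" by (intro at_none; force)+
      then show "F (src X c t) (dst X c t) t = 0" using assms t by (simp add: matches_def)
    qed
  qed (use sl_less in auto)
  also have "\<dots> = (\<Sum>j\<in>arcs_of b. F (src X c (sl j)) (dst X c (sl j)) (sl j))"
    by (rule sum.reindex_cong[OF _ refl refl]) (use sl_inj in \<open>auto simp: inj_on_def\<close>)
  also have "\<dots> = (\<Sum>j\<in>arcs_of b. F (ln (tlv j)) (ln (hdv j)) (sl j))"
    using assms(1) sl_less at_sl by (intro sum.cong) (auto simp: matches_def)
  finally show ?thesis .
qed

definition keep :: "(nat \<Rightarrow> nat) \<Rightarrow> nat \<Rightarrow> bool" where
  "keep cf j \<longleftrightarrow> kept X (cf (eb j)) (sl j) \<noteq> 0"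

definition lab :: "nat \<Rightarrow> (nat \<Rightarrow> nat) \<Rightarrow> nat \<Rightarrow> nat" where
  "lab z cf v = level X y z (cf (blk v)) (ln v)"

definition deleted :: "(nat \<Rightarrow> nat) \<Rightarrow> (nat \<times> nat) set" where
  "deleted cf = (!) es ` {j \<in> {..<length es}. \<not> keep cf j}"

text \<open>The block of an arc knows the levels of both ends: an end that is no hub lies in this
  block, and the level of a hub comes from \<open>z\<close> whichever block asks.\<close>

lemma level_tl: "j < length es \<Longrightarrow> level X y z (cf (eb j)) (ln (tlv j)) = lab z cf (tlv j)"
  using ln_M[OF arc_V(1)] eb_tl by (auto simp: level_def lab_def)

lemma level_hd: "j < length es \<Longrightarrow> level X y z (cf (eb j)) (ln (hdv j)) = lab z cf (hdv j)"
  using ln_M[OF arc_V(2)] eb_hd by (auto simp: level_def lab_def)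

lemma inj_es: "inj_on ((!) es) {..<length es}"
  using distinct_es by (auto simp: inj_on_def nth_eq_iff_index_eq)

lemma sum_arcs_of: "(\<Sum>b\<in>V. \<Sum>j\<in>arcs_of b. h j) = (\<Sum>j<length es. h j)" for h :: "nat \<Rightarrow> nat"
  using sum.group[of "{..<length es}" V eb h] eb_V finite_V by auto

lemma cost_eq:
  assumes "\<And>b. b \<in> V \<Longrightarrow> matches b (cf b)"
  shows "(\<Sum>b\<in>V. code_cost X (cf b)) = card (deleted cf)"
proof -
  have "code_cost X (cf b) = (\<Sum>j\<in>arcs_of b. if \<not> keep cf j then 1 else 0)" if "b \<in> V" for b
    unfolding code_cost_def
    using sum_slots[OF assms[OF that], of "\<lambda>s d t. if s = 0 then 0 else if kept X (cf b) t = 0 then 1 else 0"]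
      ln_nz by (auto simp: keep_def intro!: sum.cong)
  then have "(\<Sum>b\<in>V. code_cost X (cf b)) = (\<Sum>j<length es. if \<not> keep cf j then 1 else 0)"
    using sum_arcs_of[of "\<lambda>j. if \<not> keep cf j then 1 else 0"] by simp
  also have "\<dots> = card {j \<in> {..<length es}. \<not> keep cf j}"
    by (rule sum_indicator) simp
  also have "\<dots> = card (deleted cf)"
    unfolding deleted_def by (subst card_image) (auto intro: inj_on_subset[OF inj_es])
  finally show ?thesis .
qed

abbreviation flat :: "nat \<Rightarrow> (nat \<Rightarrow> nat) \<Rightarrow> nat \<Rightarrow> bool" where
  "flat z cf j \<equiv> keep cf j \<and> lab z cf (tlv j) = lab z cf (hdv j)"

lemma outs_eq:
  assumes "matches b (cf b)" "1 \<le> l"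
  shows "outs X y z (cf b) l = (\<Sum>j\<in>arcs_of b. if ln (tlv j) = l \<and> flat z cf j then 1 else 0)"
proof -
  let ?F = "\<lambda>s d t. if s = l then if kept X (cf b) t = 0 then 0
     else if level X y z (cf b) s = level X y z (cf b) d then 1 else (0::nat) else 0"
  have "outs X y z (cf b) l = (\<Sum>t<X. ?F (src X (cf b) t) (dst X (cf b) t) t)"
    by (simp add: outs_def)
  also have "\<dots> = (\<Sum>j\<in>arcs_of b. ?F (ln (tlv j)) (ln (hdv j)) (sl j))"
    by (rule sum_slots) (use assms in auto)
  also have "\<dots> = (\<Sum>j\<in>arcs_of b. if ln (tlv j) = l \<and> flat z cf j then 1 else 0)"
    using level_tl[of _ z cf] level_hd[of _ z cf] by (intro sum.cong refl) (auto simp: keep_def)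
  finally show ?thesis .
qed

lemma ins_eq:
  assumes "matches b (cf b)" "1 \<le> l"
  shows "ins X y z (cf b) l = (\<Sum>j\<in>arcs_of b. if ln (hdv j) = l \<and> flat z cf j then 1 else 0)"
proof -
  let ?F = "\<lambda>s d t. if d = l then if kept X (cf b) t = 0 then 0
     else if level X y z (cf b) s = level X y z (cf b) d then 1 else (0::nat) else 0"
  have "ins X y z (cf b) l = (\<Sum>t<X. ?F (src X (cf b) t) (dst X (cf b) t) t)"
    by (simp add: ins_def)
  also have "\<dots> = (\<Sum>j\<in>arcs_of b. ?F (ln (tlv j)) (ln (hdv j)) (sl j))"
    by (rule sum_slots) (use assms in auto)
  also have "\<dots> = (\<Sum>j\<in>arcs_of b. if ln (hdv j) = l \<and> flat z cf j then 1 else 0)"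
    using level_tl[of _ z cf] level_hd[of _ z cf] by (intro sum.cong refl) (auto simp: keep_def)
  finally show ?thesis .
qed

definition out_at :: "nat \<Rightarrow> (nat \<Rightarrow> nat) \<Rightarrow> nat \<Rightarrow> nat" where
  "out_at z cf v = (\<Sum>j<length es. if tlv j = v \<and> flat z cf j then 1 else 0)"

definition in_at :: "nat \<Rightarrow> (nat \<Rightarrow> nat) \<Rightarrow> nat \<Rightarrow> nat" where
  "in_at z cf v = (\<Sum>j<length es. if hdv j = v \<and> flat z cf j then 1 else 0)"

lemma at_card:
  "out_at z cf v = card {u. (v, u) \<in> set es - deleted cf \<and> lab z cf u = lab z cf v}"
  "in_at z cf v = card {u. (u, v) \<in> set es - deleted cf \<and> lab z cf u = lab z cf v}"
proof -
  have del: "es ! j \<in> deleted cf \<longleftrightarrow> \<not> keep cf j" if "j < length es" for j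
    using that inj_es by (auto simp: deleted_def inj_on_def)
  have "out_at z cf v = card {j. j < length es \<and> tlv j = v \<and> flat z cf j}"
    unfolding out_at_def by (subst sum_indicator) (simp_all add: lessThan_def)
  also have "\<dots> = card ((\<lambda>j. hdv j) ` {j. j < length es \<and> tlv j = v \<and> flat z cf j})"
  proof (rule card_image[symmetric], rule inj_onI)
    fix i j
    assume "i \<in> {j. j < length es \<and> tlv j = v \<and> flat z cf j}" "j \<in> {j. j < length es \<and> tlv j = v \<and> flat z cf j}"
      "hdv i = hdv j"
    then have "es ! i = es ! j" "i < length es" "j < length es" by (simp_all add: prod_eq_iff)
    then show "i = j" using distinct_es nth_eq_iff_index_eq by blast
  qed
  also have "(\<lambda>j. hdv j) ` {j. j < length es \<and> tlv j = v \<and> flat z cf j} =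
      {u. (v, u) \<in> set es - deleted cf \<and> lab z cf u = lab z cf v}"
  proof (intro set_eqI iffI)
    fix u assume "u \<in> (\<lambda>j. hdv j) ` {j. j < length es \<and> tlv j = v \<and> flat z cf j}"
    then obtain j where j: "j < length es" "tlv j = v" "flat z cf j" "u = hdv j" by blast
    then have "es ! j = (v, u)" by (simp add: prod_eq_iff)
    then show "u \<in> {u. (v, u) \<in> set es - deleted cf \<and> lab z cf u = lab z cf v}"
      using j del[OF j(1)] nth_mem[OF j(1)] by auto
  next
    fix u assume u: "u \<in> {u. (v, u) \<in> set es - deleted cf \<and> lab z cf u = lab z cf v}"
    then obtain j where j: "j < length es" "es ! j = (v, u)" by (auto simp: in_set_conv_nth)
    then have "keep cf j" using u del[OF j(1)] by auto
    then have "j \<in> {j. j < length es \<and> tlv j = v \<and> flat z cf j}" using j u by auto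
    then show "u \<in> (\<lambda>j. hdv j) ` {j. j < length es \<and> tlv j = v \<and> flat z cf j}"
      using j by (intro image_eqI[of _ _ j]) simp_all
  qed
  finally show "out_at z cf v = card {u. (v, u) \<in> set es - deleted cf \<and> lab z cf u = lab z cf v}" .
  have "in_at z cf v = card {j. j < length es \<and> hdv j = v \<and> flat z cf j}"
    unfolding in_at_def by (subst sum_indicator) (simp_all add: lessThan_def)
  also have "\<dots> = card ((\<lambda>j. tlv j) ` {j. j < length es \<and> hdv j = v \<and> flat z cf j})"
  proof (rule card_image[symmetric], rule inj_onI)
    fix i j
    assume "i \<in> {j. j < length es \<and> hdv j = v \<and> flat z cf j}" "j \<in> {j. j < length es \<and> hdv j = v \<and> flat z cf j}"
      "tlv i = tlv j"
    then have "es ! i = es ! j" "i < length es" "j < length es" by (simp_all add: prod_eq_iff)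
    then show "i = j" using distinct_es nth_eq_iff_index_eq by blast
  qed
  also have "(\<lambda>j. tlv j) ` {j. j < length es \<and> hdv j = v \<and> flat z cf j} =
      {u. (u, v) \<in> set es - deleted cf \<and> lab z cf u = lab z cf v}"
  proof (intro set_eqI iffI)
    fix u assume "u \<in> (\<lambda>j. tlv j) ` {j. j < length es \<and> hdv j = v \<and> flat z cf j}"
    then obtain j where j: "j < length es" "hdv j = v" "flat z cf j" "u = tlv j" by blast
    then have "es ! j = (u, v)" by (simp add: prod_eq_iff)
    then show "u \<in> {u. (u, v) \<in> set es - deleted cf \<and> lab z cf u = lab z cf v}"
      using j del[OF j(1)] nth_mem[OF j(1)] by auto
  next
    fix u assume u: "u \<in> {u. (u, v) \<in> set es - deleted cf \<and> lab z cf u = lab z cf v}"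
    then obtain j where j: "j < length es" "es ! j = (u, v)" by (auto simp: in_set_conv_nth)
    then have "keep cf j" using u del[OF j(1)] by auto
    then have "j \<in> {j. j < length es \<and> hdv j = v \<and> flat z cf j}" using j u by auto
    then show "u \<in> (\<lambda>j. tlv j) ` {j. j < length es \<and> hdv j = v \<and> flat z cf j}"
      using j by (intro image_eqI[of _ _ j]) simp_all
  qed
  finally show "in_at z cf v = card {u. (u, v) \<in> set es - deleted cf \<and> lab z cf u = lab z cf v}" .
qed

text \<open>All arcs at a vertex that is no hub lie in its block. Among their ends its name is
  unique: other vertices of the block have other names, and the names of hubs exceed
  \<open>y\<close>.\<close>

lemma local_sum:
  assumes "w \<in> {tlv, hdv}" "v \<in> V" "v \<notin> M"
  shows "(\<Sum>j\<in>arcs_of (blk v). if ln (w j) = ln v \<and> P j then 1 else 0) =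
    (\<Sum>j<length es. if w j = v \<and> P j then 1 else (0::nat))"
proof -
  have w: "w j \<in> V" "w j \<notin> M \<Longrightarrow> eb j = blk (w j)" if "j < length es" for j
    using assms(1) that arc_V eb_tl eb_hd by auto
  have "(\<Sum>j<length es. if w j = v \<and> P j then 1 else (0::nat)) =
      (\<Sum>j\<in>arcs_of (blk v). if w j = v \<and> P j then 1 else 0)"
  proof (rule sum.mono_neutral_right)
    show "\<forall>j\<in>{..<length es} - arcs_of (blk v). (if w j = v \<and> P j then 1 else (0::nat)) = 0"
    proof
      fix j assume j: "j \<in> {..<length es} - arcs_of (blk v)"
      have "w j \<noteq> v"
      proof
        assume "w j = v"
        then have "eb j = blk v" using w(2)[of j] j assms(3) by simp
        then show False using j by simp
      qed
      then show "(if w j = v \<and> P j then 1 else (0::nat)) = 0" by simp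
    qed
  qed auto
  also have "\<dots> = (\<Sum>j\<in>arcs_of (blk v). if ln (w j) = ln v \<and> P j then 1 else 0)"
  proof (intro sum.cong refl)
    fix j assume j: "j \<in> arcs_of (blk v)"
    have "w j = v" if "ln (w j) = ln v"
    proof (rule ln_inj[OF w(1) assms(2) _ that])
      have "w j \<notin> M" using ln_M[OF w(1), of j] ln_M[OF assms(2)] assms(3) that j by simp
      then show "blk (w j) = blk v" using w(2)[of j] j by simp
    qed (use j in simp)
    then have "w j = v \<longleftrightarrow> ln (w j) = ln v" by blast
    then show "(if w j = v \<and> P j then 1 else (0::nat)) = (if ln (w j) = ln v \<and> P j then 1 else 0)" by simp
  qed
  finally show ?thesis by simp
qed

text \<open>The hubs share one block, so a name above \<open>y\<close> identifies a hub across all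
  blocks.\<close>

lemma hub_sum:
  assumes "w \<in> {tlv, hdv}" "v \<in> M"
  shows "(\<Sum>j<length es. if ln (w j) = ln v \<and> P j then 1 else 0) =
    (\<Sum>j<length es. if w j = v \<and> P j then 1 else (0::nat))"
proof (intro sum.cong refl)
  fix j assume j: "j \<in> {..<length es}"
  have "w j \<in> V" using assms(1) j arc_V by auto
  have vV: "v \<in> V" using assms(2) M_subset by blast
  have "w j = v" if "ln (w j) = ln v"
  proof (rule ln_inj[OF \<open>w j \<in> V\<close> vV _ that])
    have "w j \<in> M" using ln_M[OF \<open>w j \<in> V\<close>] ln_M[OF vV] assms(2) that by simp
    then show "blk (w j) = blk v" using blk_M[OF assms(2) \<open>w j \<in> V\<close>] by simp
  qed
  then have "w j = v \<longleftrightarrow> ln (w j) = ln v" by blast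
  then show "(if ln (w j) = ln v \<and> P j then 1 else (0::nat)) = (if w j = v \<and> P j then 1 else 0)" by simp
qed

text \<open>Decoding condition by condition: no descents means that kept arcs never go down, the
  local part of \<open>code_ok\<close> is balance outside \<open>M\<close>, and vanishing total
  imbalances are balance on \<open>M\<close>.\<close>

lemma valid_iff_levelled:
  assumes m: "\<And>b. b \<in> V \<Longrightarrow> matches b (cf b)"
  shows "valid z cf \<longleftrightarrow> levelled V (set es - deleted cf) (lab z cf)"
proof -
  have del: "es ! j \<in> deleted cf \<longleftrightarrow> \<not> keep cf j" if "j < length es" for j
    using that inj_es by (auto simp: deleted_def inj_on_def)
  have desc: "descents X y z (cf b) = 0 \<longleftrightarrow> (\<forall>j\<in>arcs_of b. keep cf j \<longrightarrow> lab z cf (tlv j) \<le> lab z cf (hdv j))"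
    if b: "b \<in> V" for b
  proof -
    let ?F = "\<lambda>s d t. if s = 0 then 0 else if kept X (cf b) t = 0 then 0
      else if level X y z (cf b) d < level X y z (cf b) s then 1 else (0::nat)"
    have "descents X y z (cf b) = (\<Sum>t<X. ?F (src X (cf b) t) (dst X (cf b) t) t)"
      by (simp add: descents_def)
    also have "\<dots> = (\<Sum>j\<in>arcs_of b. ?F (ln (tlv j)) (ln (hdv j)) (sl j))"
      by (rule sum_slots) (use m b in auto)
    also have "\<dots> = (\<Sum>j\<in>arcs_of b. if keep cf j \<and> lab z cf (hdv j) < lab z cf (tlv j) then 1 else 0)"
    proof (intro sum.cong refl)
      fix j assume "j \<in> arcs_of b"
      then have j: "j < length es" "eb j = b" by auto
      show "?F (ln (tlv j)) (ln (hdv j)) (sl j) = (if keep cf j \<and> lab z cf (hdv j) < lab z cf (tlv j) then 1 else 0)"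
        using level_tl[OF j(1), of z cf] level_hd[OF j(1), of z cf] ln_nz[OF j(1)] j(2)
        by (auto simp: keep_def)
    qed
    finally have eq: "descents X y z (cf b) =
        (\<Sum>j\<in>arcs_of b. if keep cf j \<and> lab z cf (hdv j) < lab z cf (tlv j) then 1 else 0)" .
    have fin: "finite (arcs_of b)" by simp
    show ?thesis unfolding eq sum_eq_0_iff[OF fin]
      by (rule ball_cong[OF refl]) (simp add: not_less)
  qed
  have "(\<forall>b\<in>V. descents X y z (cf b) = 0) \<longleftrightarrow> (\<forall>j<length es. keep cf j \<longrightarrow> lab z cf (tlv j) \<le> lab z cf (hdv j))"
    using desc eb_V by auto
  also have "\<dots> \<longleftrightarrow> (\<forall>(u, v)\<in>set es - deleted cf. lab z cf u \<le> lab z cf v)"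
  proof -
    have iff: "e \<in> set es - deleted cf \<longleftrightarrow> (\<exists>j<length es. keep cf j \<and> es ! j = e)" for e
      using del by (auto simp: in_set_conv_nth)
    have "set es - deleted cf = (!) es ` {j. j < length es \<and> keep cf j}"
      by (rule set_eqI) (unfold iff image_iff Bex_def mem_Collect_eq, metis)
    then show ?thesis by (auto simp: case_prod_beta)
  qed
  finally have 1: "(\<forall>b\<in>V. descents X y z (cf b) = 0) \<longleftrightarrow> (\<forall>(u, v)\<in>set es - deleted cf. lab z cf u \<le> lab z cf v)" .
  have 2: "(\<forall>b\<in>V. \<forall>l<y. outs X y z (cf b) (Suc l) = ins X y z (cf b) (Suc l)) \<longleftrightarrow>
      (\<forall>v\<in>V - M. out_at z cf v = in_at z cf v)"
  proof
    assume h: "\<forall>b\<in>V. \<forall>l<y. outs X y z (cf b) (Suc l) = ins X y z (cf b) (Suc l)"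
    show "\<forall>v\<in>V - M. out_at z cf v = in_at z cf v"
    proof
      fix v assume v: "v \<in> V - M"
      then obtain l where l: "ln v = Suc l" "l < y" using ln_pos[of v] ln_M[of v] by (cases "ln v") auto
      have "outs X y z (cf (blk v)) (ln v) = ins X y z (cf (blk v)) (ln v)"
        using h blk_V v l by simp
      then show "out_at z cf v = in_at z cf v"
        using outs_eq[where cf = cf and l = "ln v" and z = z, OF m[OF blk_V[of v]]]
          ins_eq[where cf = cf and l = "ln v" and z = z, OF m[OF blk_V[of v]]] v ln_pos[of v]
          local_sum[of tlv v "flat z cf"] local_sum[of hdv v "flat z cf"]
        by (simp add: out_at_def in_at_def)
    qed
  next
    assume h: "\<forall>v\<in>V - M. out_at z cf v = in_at z cf v"
    show "\<forall>b\<in>V. \<forall>l<y. outs X y z (cf b) (Suc l) = ins X y z (cf b) (Suc l)"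
    proof (intro ballI allI impI)
      fix b l assume b: "b \<in> V" and l: "l < y"
      show "outs X y z (cf b) (Suc l) = ins X y z (cf b) (Suc l)"
      proof (cases "\<exists>v\<in>V. blk v = b \<and> ln v = Suc l")
        case True
        then obtain v where v: "v \<in> V" "blk v = b" "ln v = Suc l" by blast
        then have "v \<notin> M" using ln_M[of v] l by simp
        then show ?thesis
          using h v outs_eq[where cf = cf and l = "Suc l" and z = z, OF m[OF b]] ins_eq[where cf = cf and l = "Suc l" and z = z, OF m[OF b]]
            local_sum[of tlv v "flat z cf"] local_sum[of hdv v "flat z cf"]
          by (simp add: out_at_def in_at_def)
      next
        case False
        \<comment> \<open>No vertex of the block bears this name, and hubs have larger names, so
          both counts are 0.\<close>
        have "ln (tlv j) \<noteq> Suc l" "ln (hdv j) \<noteq> Suc l" if "j \<in> arcs_of b" for j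
        proof -
          have j: "j < length es" "eb j = b" using that by auto
          have "ln (w j) \<noteq> Suc l" if w: "w j \<in> V" "w j \<notin> M \<Longrightarrow> eb j = blk (w j)" for w
          proof
            assume w': "ln (w j) = Suc l"
            then have "w j \<notin> M" using ln_M[OF w(1)] l by simp
            then show False using False w w' j by auto
          qed
          from this[of tlv] this[of hdv] show "ln (tlv j) \<noteq> Suc l" "ln (hdv j) \<noteq> Suc l"
            using arc_V[OF j(1)] eb_tl[OF j(1)] eb_hd[OF j(1)] by blast+
        qed
        then show ?thesis
          using outs_eq[where cf = cf and l = "Suc l" and z = z, OF m[OF b]] ins_eq[where cf = cf and l = "Suc l" and z = z, OF m[OF b]]
          by (simp add: sum.neutral)
      qed
    qed
  qed
  have su: "(\<Sum>b\<in>V. imbalance X y z (cf b) l) =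
      int (\<Sum>j<length es. if ln (tlv j) = l \<and> flat z cf j then 1 else 0) -
      int (\<Sum>j<length es. if ln (hdv j) = l \<and> flat z cf j then 1 else 0)" if l: "y < l" for l
  proof -
    have "(\<Sum>b\<in>V. outs X y z (cf b) l) = (\<Sum>j<length es. if ln (tlv j) = l \<and> flat z cf j then 1 else 0)"
      using outs_eq[where cf = cf and l = l and z = z, OF m] l
        sum_arcs_of[of "\<lambda>j. if ln (tlv j) = l \<and> flat z cf j then 1 else 0"] by simp
    moreover have "(\<Sum>b\<in>V. ins X y z (cf b) l) = (\<Sum>j<length es. if ln (hdv j) = l \<and> flat z cf j then 1 else 0)"
      using ins_eq[where cf = cf and l = l and z = z, OF m] l
        sum_arcs_of[of "\<lambda>j. if ln (hdv j) = l \<and> flat z cf j then 1 else 0"] by simp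
    ultimately show ?thesis
      by (simp only: imbalance_def sum_subtractf of_nat_sum[symmetric])
  qed
  have 3: "(\<forall>l\<in>{l. y < l \<and> l < X}. (\<Sum>b\<in>V. imbalance X y z (cf b) l) = 0) \<longleftrightarrow>
      (\<forall>v\<in>M. out_at z cf v = in_at z cf v)"
  proof
    assume h: "\<forall>l\<in>{l. y < l \<and> l < X}. (\<Sum>b\<in>V. imbalance X y z (cf b) l) = 0"
    show "\<forall>v\<in>M. out_at z cf v = in_at z cf v"
    proof
      fix v assume v: "v \<in> M"
      then have "y < ln v" "ln v < X" using ln_M[of v] ln_le[of v] M_subset X_large by auto
      then show "out_at z cf v = in_at z cf v"
        using h su[of "ln v"] hub_sum[of tlv v "flat z cf"] hub_sum[of hdv v "flat z cf"] v
        by (simp add: out_at_def in_at_def del: of_nat_sum)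
    qed
  next
    assume h: "\<forall>v\<in>M. out_at z cf v = in_at z cf v"
    show "\<forall>l\<in>{l. y < l \<and> l < X}. (\<Sum>b\<in>V. imbalance X y z (cf b) l) = 0"
    proof
      fix l assume "l \<in> {l. y < l \<and> l < X}"
      then have l: "y < l" by simp
      show "(\<Sum>b\<in>V. imbalance X y z (cf b) l) = 0"
      proof (cases "\<exists>v\<in>M. ln v = l")
        case True
        then obtain v where "v \<in> M" "ln v = l" by blast
        then show ?thesis
          using h su[OF l] hub_sum[of tlv v "flat z cf"] hub_sum[of hdv v "flat z cf"]
          by (simp add: out_at_def in_at_def del: of_nat_sum)
      next
        case False
        then have "ln (tlv j) \<noteq> l" "ln (hdv j) \<noteq> l" if "j < length es" for j
          using that arc_V[of j] ln_M[of "tlv j"] ln_M[of "hdv j"] l by blast+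
        then show ?thesis using su[OF l] by (simp add: sum.neutral)
      qed
    qed
  qed
  have "valid z cf \<longleftrightarrow> (\<forall>b\<in>V. descents X y z (cf b) = 0) \<and>
      (\<forall>b\<in>V. \<forall>l<y. outs X y z (cf b) (Suc l) = ins X y z (cf b) (Suc l)) \<and>
      (\<forall>l\<in>{l. y < l \<and> l < X}. (\<Sum>b\<in>V. imbalance X y z (cf b) l) = 0)"
    unfolding valid_def valid_choice_def code_ok_def using m by blast
  also have "\<dots> \<longleftrightarrow> (\<forall>(u, v)\<in>set es - deleted cf. lab z cf u \<le> lab z cf v) \<and>
      (\<forall>v\<in>V. in_at z cf v = out_at z cf v)"
    unfolding 1 2 3 using M_subset by (auto simp: eq_commute)
  finally show ?thesis unfolding levelled_def at_card .
qed


text \<open>An arc touches \<open>M\<close> or stays inside a block, so levels are compared only for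
  pairs on which the order is preserved.\<close>

lemma levelled_order_cong:
  assumes "F \<subseteq> set es"
    "\<And>u v. u \<in> V \<Longrightarrow> v \<in> V \<Longrightarrow> u \<in> M \<or> v \<in> M \<or> blk u = blk v \<Longrightarrow> l' u \<le> l' v \<longleftrightarrow> l u \<le> (l v :: nat)"
    "levelled V F l"
  shows "levelled V F l'"
proof -
  have cmp: "(l' u \<le> l' v \<longleftrightarrow> l u \<le> l v) \<and> (l' u = l' v \<longleftrightarrow> l u = l v) \<and> (l' v = l' u \<longleftrightarrow> l v = l u)" if "(u, v) \<in> F" for u v
  proof -
    have "(u, v) \<in> set es" using that assms(1) by blast
    moreover from this have "u \<in> V" "v \<in> V" using es_subset by auto
    moreover from calculation have "u \<in> M \<or> v \<in> M \<or> blk u = blk v" using blk_arc by blast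
    ultimately show ?thesis using assms(2)[of u v] assms(2)[of v u] by (auto simp: order_eq_iff)
  qed
  then have "{u. (u, v) \<in> F \<and> l' u = l' v} = {u. (u, v) \<in> F \<and> l u = l v}"
    "{u. (v, u) \<in> F \<and> l' u = l' v} = {u. (v, u) \<in> F \<and> l u = l v}" for v
    by auto
  then show ?thesis using assms(3) cmp unfolding levelled_def by auto
qed

text \<open>The digits can be prescribed independently. \<open>S\<close> is the set whose levels are
  stored: empty for the initial code, \<open>M\<close> for the common code of the hub levels, a
  block otherwise. \<open>R\<close> is the set of deleted arcs.\<close>

lemma ex_code:
  assumes "inj_on ln S" "S \<subseteq> V" "\<And>v. v \<in> V \<Longrightarrow> l v < X"
  shows "\<exists>c < X ^ (4 * X). matches b c \<and> (\<forall>v\<in>S. dig X c (4 * ln v + 3) = l v) \<and>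
    (\<forall>j<length es. eb j = b \<longrightarrow> (kept X c (sl j) \<noteq> 0 \<longleftrightarrow> es ! j \<notin> R)) \<and>
    (set es \<subseteq> R \<longrightarrow> (\<forall>t<X. kept X c t = 0))"
proof -
  define a where "a p = (let t = p div 4 in if p mod 4 = 0 then tail_at b t else if p mod 4 = 1 then head_at b t
    else if p mod 4 = 2 then (if \<exists>j<length es. eb j = b \<and> sl j = t \<and> es ! j \<notin> R then 1 else 0)
    else if t \<in> ln ` S then l (inv_into S ln t) else 0)" for p
  have "a p < X" for p
    using at_less assms(2,3) inv_into_into[of "p div 4" ln S] X_large by (auto simp: a_def Let_def subset_iff)
  then obtain c where c: "c < X ^ (4 * X)" "\<And>p. p < 4 * X \<Longrightarrow> dig X c p = a p"
    using ex_digits[of "4 * X" a X] by blast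
  have a: "a (4 * t) = tail_at b t" "a (4 * t + 1) = head_at b t"
    "a (4 * t + 2) = (if \<exists>j<length es. eb j = b \<and> sl j = t \<and> es ! j \<notin> R then 1 else 0)"
    "a (4 * t + 3) = (if t \<in> ln ` S then l (inv_into S ln t) else 0)" for t
  proof -
    have "(4 * t + 1) div 4 = t" "(4 * t + 1) mod 4 = 1" "(4 * t + 2) div 4 = t" "(4 * t + 2) mod 4 = 2"
      "(4 * t + 3) div 4 = t" "(4 * t + 3) mod 4 = 3" by presburger+
    then show "a (4 * t) = tail_at b t" "a (4 * t + 1) = head_at b t"
      "a (4 * t + 2) = (if \<exists>j<length es. eb j = b \<and> sl j = t \<and> es ! j \<notin> R then 1 else 0)"
      "a (4 * t + 3) = (if t \<in> ln ` S then l (inv_into S ln t) else 0)"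
      by (simp_all add: a_def)
  qed
  have "matches b c" using c(2) a by (simp add: matches_def src_def dst_def)
  moreover have "dig X c (4 * ln v + 3) = l v" if v: "v \<in> S" for v
  proof -
    have "ln v < X" using ln_le[of v] v assms(2) X_large by auto
    then show ?thesis using c(2)[of "4 * ln v + 3"] a(4)[of "ln v"] v assms(1) by simp
  qed
  moreover have "kept X c (sl j) \<noteq> 0 \<longleftrightarrow> es ! j \<notin> R" if "j < length es" "eb j = b" for j
    using c(2)[of "4 * sl j + 2"] a(3)[of "sl j"] sl_less[of j] sl_inj[of _ j] that
    by (auto simp: kept_def)
  moreover have "kept X c t = 0" if "set es \<subseteq> R" "t < X" for t
  proof -
    have "\<not> (\<exists>j<length es. eb j = b \<and> sl j = t \<and> es ! j \<notin> R)" using that(1) nth_mem by blast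
    then show ?thesis using c(2)[of "4 * t + 2"] a(3)[of t] that(2) by (simp add: kept_def)
  qed
  ultimately show ?thesis using c(1) by blast
qed

lemma ex_initial: "\<exists>c < X ^ (4 * X). matches b c \<and> (\<forall>t<X. kept X c t = 0)"
  using ex_code[of "{}" "\<lambda>_. 0" b "set es"] X_large by auto

lemma initial_valid:
  assumes "\<And>b. b \<in> V \<Longrightarrow> matches b (cf b) \<and> (\<forall>t<X. kept X (cf b) t = 0)"
  shows "valid z cf"
proof -
  have "descents X y z (cf b) = 0" "outs X y z (cf b) l = 0" "ins X y z (cf b) l = 0" if "b \<in> V" for b l
    using assms[OF that] by (auto simp: descents_def outs_def ins_def)
  then show ?thesis using assms by (simp add: valid_def valid_choice_def code_ok_def imbalance_def)
qed

text \<open>Forward, the levels of a solution are compressed below \<open>X\<close> and written into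
  codes; backward, \<open>deleted\<close> and \<open>lab\<close> read a solution off a valid
  configuration.\<close>

theorem sescad_iff_codes:
  assumes G: "pair_digraph G" "pverts G = V" "parcs G = set es" and Z: "X ^ (4 * X) \<le> Z"
  shows "sescad (G, k) \<longleftrightarrow> (\<exists>z<Z. \<exists>cf. (\<forall>b\<in>V. cf b < X ^ (4 * X)) \<and> valid z cf \<and>
    int (\<Sum>b\<in>V. code_cost X (cf b)) \<le> k)"
proof
  assume "sescad (G, k)"
  then obtain R l0 where R: "R \<subseteq> set es" "int (card R) \<le> k" "levelled V (set es - R) l0"
    using sescad_iff[OF G(1)] G by auto
  \<comment> \<open>If nonempty, \<open>M\<close> is itself a block.\<close>
  have "card M \<le> y"
  proof (cases "M = {}")
    case False
    then obtain u where u: "u \<in> M" by blast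
    then have "{w\<in>V. blk w = blk u} = M" using blk_M M_subset by blast
    then show ?thesis using blk_card[of u] u M_subset by auto
  qed simp
  from compress_levels[OF finite_V M_subset this, of blk l0] blk_card obtain l where
    "\<forall>v\<in>V. l v < X" "\<forall>u\<in>V. \<forall>v\<in>V. u \<in> M \<or> v \<in> M \<or> blk u = blk v \<longrightarrow> (l u \<le> l v \<longleftrightarrow> l0 u \<le> l0 v)"
    unfolding X slots_def by blast
  then have l: "\<And>v. v \<in> V \<Longrightarrow> l v < X"
    "\<And>u v. u \<in> V \<Longrightarrow> v \<in> V \<Longrightarrow> u \<in> M \<or> v \<in> M \<or> blk u = blk v \<Longrightarrow> l u \<le> l v \<longleftrightarrow> l0 u \<le> l0 v"
    by blast+
  have lev: "levelled V (set es - R) l"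
    by (rule levelled_order_cong[OF _ l(2) R(3)]) auto
  have "inj_on ln M" using ln_inj blk_M M_subset by (intro inj_onI) (metis subsetD)
  \<comment> \<open>Only the level digits of \<open>z\<close> are read, so any block may supply its
    arc digits; 0 is taken.\<close>
  from ex_code[where b = 0 and R = R and l = l, OF this M_subset l(1)] obtain z where
    z: "z < X ^ (4 * X)" "\<And>v. v \<in> M \<Longrightarrow> dig X z (4 * ln v + 3) = l v" by blast
  have "\<exists>c < X ^ (4 * X). matches b c \<and> (\<forall>v\<in>{v\<in>V. blk v = b}. dig X c (4 * ln v + 3) = l v) \<and>
    (\<forall>j<length es. eb j = b \<longrightarrow> (kept X c (sl j) \<noteq> 0 \<longleftrightarrow> es ! j \<notin> R))" for b
  proof -
    have "inj_on ln {v\<in>V. blk v = b}" using ln_inj by (intro inj_onI) auto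
    from ex_code[where b = b and R = R and l = l, OF this _ l(1)] show ?thesis by blast
  qed
  then obtain cf where cf: "\<And>b. cf b < X ^ (4 * X)" "\<And>b. matches b (cf b)"
    "\<And>b v. v \<in> V \<Longrightarrow> blk v = b \<Longrightarrow> dig X (cf b) (4 * ln v + 3) = l v"
    "\<And>b j. j < length es \<Longrightarrow> eb j = b \<Longrightarrow> kept X (cf b) (sl j) \<noteq> 0 \<longleftrightarrow> es ! j \<notin> R"
    by (simp only: mem_Collect_eq Ball_def) metis
  have lab: "lab z cf v = l v" if "v \<in> V" for v
    using z(2)[of v] cf(3)[OF that refl] ln_M[OF that] by (simp add: lab_def level_def)
  have "keep cf j \<longleftrightarrow> es ! j \<notin> R" if "j < length es" for j
    using cf(4)[OF that refl] by (simp add: keep_def)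
  then have del: "deleted cf = R"
    using R(1) by (auto simp: deleted_def in_set_conv_nth subset_iff image_iff) metis
  have "levelled V (set es - R) (lab z cf)"
    by (rule levelled_order_cong[OF _ _ lev]) (use lab in auto)
  then have "valid z cf" using valid_iff_levelled[of cf z] cf(2) del by simp
  moreover have "int (\<Sum>b\<in>V. code_cost X (cf b)) \<le> k" using cost_eq[of cf] cf(2) del R(2) by simp
  ultimately show "\<exists>z<Z. \<exists>cf. (\<forall>b\<in>V. cf b < X ^ (4 * X)) \<and> valid z cf \<and>
    int (\<Sum>b\<in>V. code_cost X (cf b)) \<le> k" using less_le_trans[OF z(1) Z] cf(1) by blast
next
  assume "\<exists>z<Z. \<exists>cf. (\<forall>b\<in>V. cf b < X ^ (4 * X)) \<and> valid z cf \<and>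
    int (\<Sum>b\<in>V. code_cost X (cf b)) \<le> k"
  then obtain z cf where v: "valid z cf" "int (\<Sum>b\<in>V. code_cost X (cf b)) \<le> k" by blast
  then have m: "\<And>b. b \<in> V \<Longrightarrow> matches b (cf b)" by (simp add: valid_def valid_choice_def)
  have "deleted cf \<subseteq> set es" by (auto simp: deleted_def)
  moreover have "levelled V (set es - deleted cf) (lab z cf)" using valid_iff_levelled[of cf z] m v(1) by simp
  moreover have "int (card (deleted cf)) \<le> k" using cost_eq[of cf] m v(2) by simp
  ultimately show "sescad (G, k)" unfolding sescad_iff[OF G(1)] G(2,3) by blast
qed

end

section \<open>Enumerating bounded improvements\<close>

text \<open>A list of \<open>g\<close> moves becomes one number below \<open>W ^ (2 * g)\<close>, so
  all lists are run through by a single counting loop.\<close>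

definition moves :: "nat \<Rightarrow> nat \<Rightarrow> nat \<Rightarrow> (nat \<times> nat) list" where
  "moves W g w = map (\<lambda>i. (dig W w (2 * i), dig W w (2 * i + 1))) [0..<g]"

text \<open>Shorter lists are filled up with moves from 0 to 0, which by
  \<open>rewrite_first_same\<close> change nothing.\<close>

lemma ex_moves:
  assumes "length ms \<le> g" "set ms \<subseteq> {..<W} \<times> {..<W}" "0 < W"
  shows "\<exists>w < W ^ (2 * g). moves W g w = ms @ replicate (g - length ms) (0, 0)"
proof -
  define xs where "xs = ms @ replicate (g - length ms) (0, 0)"
  have len: "length xs = g" using assms(1) by (simp add: xs_def)
  have xs: "fst (xs ! i) < W" "snd (xs ! i) < W" if "i < g" for i
  proof -
    have "xs ! i \<in> {..<W} \<times> {..<W}"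
      using nth_mem[of i xs] that len assms(2,3) by (auto simp: xs_def)
    then show "fst (xs ! i) < W" "snd (xs ! i) < W" by auto
  qed
  define a where "a p = (if even p then fst (xs ! (p div 2)) else snd (xs ! (p div 2)))" for p
  have "a p < W" if "p < 2 * g" for p using xs[of "p div 2"] that by (auto simp: a_def)
  then obtain w where w: "w < W ^ (2 * g)" "\<And>p. p < 2 * g \<Longrightarrow> dig W w p = a p"
    using ex_digits[of "2 * g" a W] by blast
  have "moves W g w = xs"
  proof (rule nth_equalityI)
    fix i assume "i < length (moves W g w)"
    then have "i < g" by (simp add: moves_def)
    then show "moves W g w ! i = xs ! i"
      using w(2)[of "2 * i"] w(2)[of "2 * i + 1"] by (simp add: moves_def a_def)
  qed (simp add: moves_def len)
  then show ?thesis using w(1) by (auto simp: xs_def)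
qed

lemma rewrite_first_same: "rewrite_first bs (c, c) f = f"
  by (auto simp: rewrite_first_def find_Some_iff split: option.split)

lemma fold_rewrite_less:
  assumes "\<And>b. b \<in> V \<Longrightarrow> f b < W" "0 < W"
  shows "b \<in> V \<Longrightarrow> fold (rewrite_first bs) (moves W g w) f b < W"
proof -
  have "\<forall>b\<in>V. fold (rewrite_first bs) ms f b < W" if "\<forall>m\<in>set ms. snd m < W" for ms
    using that assms(1)
  proof (induction ms arbitrary: f)
    case (Cons m ms)
    have "\<forall>b\<in>V. rewrite_first bs m f b < W"
      using Cons.prems by (auto simp: rewrite_first_def split: option.split)
    then show ?case using Cons by simp
  qed simp
  moreover have "\<forall>m\<in>set (moves W g w). snd m < W" using dig_less[OF assms(2)] by (auto simp: moves_def)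
  ultimately show "b \<in> V \<Longrightarrow> fold (rewrite_first bs) (moves W g w) f b < W" by blast
qed

text \<open>At most \<open>X\<close> coordinates are coupled, and imbalances of size at most
  \<open>X\<close> differ by at most \<open>2 * X\<close>; \<open>group_bound_le\<close> turns this
  into \<open>(6 * X) ^ (2 ^ X)\<close>, the origin of the number \<open>g\<close> of moves that are
  tried together.\<close>

theorem (in block_structure) local_search:
  assumes bs: "distinct bs" "set bs = V" and g: "(6 * X) ^ (2 ^ X) \<le> g"
    and "valid z cf" "\<And>b. b \<in> V \<Longrightarrow> cf b < W" "valid z f'" "\<And>b. b \<in> V \<Longrightarrow> f' b < W" "0 < W"
    and less: "(\<Sum>b\<in>V. code_cost X (f' b)) < (\<Sum>b\<in>V. code_cost X (cf b))"
  shows "\<exists>w < W ^ (2 * g). valid z (fold (rewrite_first bs) (moves W g w) cf) \<and>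
    (\<Sum>b\<in>V. code_cost X (fold (rewrite_first bs) (moves W g w) cf b)) < (\<Sum>b\<in>V. code_cost X (cf b))"
proof -
  let ?D = "{l. y < l \<and> l < X}"
  have "\<exists>ms. length ms \<le> group_bound (2 * X) (card ?D) \<and> set ms \<subseteq> cf ` set bs \<times> f' ` set bs \<and>
      valid_choice (set bs) matches (code_ok X y z) ?D (imbalance X y z) (fold (rewrite_first bs) ms cf) \<and>
      (\<Sum>b\<in>set bs. code_cost X (fold (rewrite_first bs) ms cf b)) < (\<Sum>b\<in>set bs. code_cost X (cf b))"
  proof (rule improving_rewriting)
    show "matches b' c'" if "matches b c" "matches b' c" "matches b c'" for b b' c c'
      using that by (rule matches_exchange)
  qed (use assms(4,6) less bs abs_imbalance_le in \<open>auto simp: valid_def\<close>)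
  then obtain ms where
    ms: "length ms \<le> group_bound (2 * X) (card ?D)" "set ms \<subseteq> cf ` V \<times> f' ` V"
      "valid z (fold (rewrite_first bs) ms cf)"
      "(\<Sum>b\<in>V. code_cost X (fold (rewrite_first bs) ms cf b)) < (\<Sum>b\<in>V. code_cost X (cf b))"
    using bs(2) unfolding valid_def by blast
  have "card ?D \<le> card {..<X}" by (intro card_mono) auto
  then have D: "card ?D \<le> X" by simp
  have "group_bound (2 * X) (card ?D) \<le> (3 * (2 * X)) ^ (2 ^ card ?D)"
    using X_large by (intro group_bound_le) simp
  also have "\<dots> \<le> (3 * (2 * X)) ^ (2 ^ X)"
    using X_large D by (intro power_increasing) auto
  also have "\<dots> \<le> g" using g by (simp add: mult.assoc[symmetric])
  finally have "length ms \<le> g" using ms(1) by simp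
  moreover have "set ms \<subseteq> {..<W} \<times> {..<W}" using ms(2) assms(5,7) by auto
  ultimately obtain w where w: "w < W ^ (2 * g)" "moves W g w = ms @ replicate (g - length ms) (0, 0)"
    using ex_moves assms(8) by blast
  have "fold (rewrite_first bs) (replicate n (0, 0)) f = f" for n f
    by (induction n) (simp_all add: rewrite_first_same)
  then have "fold (rewrite_first bs) (moves W g w) cf = fold (rewrite_first bs) ms cf"
    by (simp add: w(2))
  then show ?thesis using w(1) ms(3,4) by auto
qed

section \<open>A loop language compiled to the machine\<close>

text \<open>Bounded sums replace search and quantifiers. All loops, here and in the commands below,
  are bounded by a register that is read on entry, so programs terminate and their time can be
  bounded by looking at these registers only.\<close>

datatype ex =
    N nat
  | R string ex
  | Add ex ex
  | Sub ex ex
  | IfLt ex ex ex ex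
  | IfEq ex ex ex ex
  | LetE string ex ex
  | SumE string string ex

abbreviation setreg :: "store \<Rightarrow> string \<Rightarrow> nat \<Rightarrow> store" where
  "setreg s y v \<equiv> s(y := (s y)(0 := v))"

abbreviation setcell :: "store \<Rightarrow> string \<Rightarrow> nat \<Rightarrow> nat \<Rightarrow> store" where
  "setcell s y i v \<equiv> s(y := (s y)(i := v))"

fun ev :: "ex \<Rightarrow> store \<Rightarrow> nat" where
  "ev (N n) s = n"
| "ev (R x a) s = s x (ev a s)"
| "ev (Add a b) s = ev a s + ev b s"
| "ev (Sub a b) s = ev a s - ev b s"
| "ev (IfLt a b c e) s = (if ev a s < ev b s then ev c s else ev e s)"
| "ev (IfEq a b c e) s = (if ev a s = ev b s then ev c s else ev e s)"
| "ev (LetE y a e) s = ev e (setreg s y (ev a s))"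
| "ev (SumE x y e) s = (\<Sum>i<s x 0. ev e (setreg s y i))"

datatype rc =
    Asg string ex ex
  | RSeq rc rc (infixr ";;" 60)
  | For string string rc

fun sem :: "rc \<Rightarrow> store \<Rightarrow> store" where
  "sem (Asg x i a) s = setcell s x (ev i s) (ev a s)"
| "sem (c ;; c') s = sem c' (sem c s)"
| "sem (For y x c) s = fold (\<lambda>i s. sem c (setreg s y i)) [0..<s x 0] s"

fun rds :: "ex \<Rightarrow> string set" where
  "rds (N n) = {}"
| "rds (R x a) = insert x (rds a)"
| "rds (Add a b) = rds a \<union> rds b"
| "rds (Sub a b) = rds a \<union> rds b"
| "rds (IfLt a b c e) = rds a \<union> rds b \<union> rds c \<union> rds e"
| "rds (IfEq a b c e) = rds a \<union> rds b \<union> rds c \<union> rds e"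
| "rds (LetE y a e) = insert y (rds a \<union> rds e)"
| "rds (SumE x y e) = insert x (insert y (rds e))"

fun bnds :: "ex \<Rightarrow> string set" where
  "bnds (N n) = {}"
| "bnds (R x a) = bnds a"
| "bnds (Add a b) = bnds a \<union> bnds b"
| "bnds (Sub a b) = bnds a \<union> bnds b"
| "bnds (IfLt a b c e) = bnds a \<union> bnds b \<union> bnds c \<union> bnds e"
| "bnds (IfEq a b c e) = bnds a \<union> bnds b \<union> bnds c \<union> bnds e"
| "bnds (LetE y a e) = insert y (bnds a \<union> bnds e)"
| "bnds (SumE x y e) = insert y (bnds e)"

fun cnts :: "ex \<Rightarrow> string set" where
  "cnts (N n) = {}"
| "cnts (R x a) = cnts a"
| "cnts (Add a b) = cnts a \<union> cnts b"
| "cnts (Sub a b) = cnts a \<union> cnts b"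
| "cnts (IfLt a b c e) = cnts a \<union> cnts b \<union> cnts c \<union> cnts e"
| "cnts (IfEq a b c e) = cnts a \<union> cnts b \<union> cnts c \<union> cnts e"
| "cnts (LetE y a e) = cnts a \<union> cnts e"
| "cnts (SumE x y e) = insert x (cnts e)"

fun rdsc :: "rc \<Rightarrow> string set" where
  "rdsc (Asg x i a) = insert x (rds i \<union> rds a)"
| "rdsc (c ;; c') = rdsc c \<union> rdsc c'"
| "rdsc (For y x c) = insert x (insert y (rdsc c))"

fun bndsc :: "rc \<Rightarrow> string set" where
  "bndsc (Asg x i a) = bnds i \<union> bnds a"
| "bndsc (c ;; c') = bndsc c \<union> bndsc c'"
| "bndsc (For y x c) = bndsc c"

fun wrs :: "rc \<Rightarrow> string set" where
  "wrs (Asg x i a) = {x}"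
| "wrs (c ;; c') = wrs c \<union> wrs c'"
| "wrs (For y x c) = insert y (wrs c)"

fun cntsc :: "rc \<Rightarrow> string set" where
  "cntsc (Asg x i a) = cnts i \<union> cnts a"
| "cntsc (c ;; c') = cntsc c \<union> cntsc c'"
| "cntsc (For y x c) = insert x (cntsc c)"

text \<open>Registers that bound loops are changed neither by assignments nor by binders inside
  expressions, so that a bound on their values on entry holds throughout the run.\<close>

definition wfc :: "rc \<Rightarrow> bool" where
  "wfc c \<longleftrightarrow> ''#'' \<notin> rdsc c \<and> cntsc c \<inter> (wrs c \<union> bndsc c) = {}"

text \<open>Array \<open>''#''\<close> is the evaluation stack of compiled programs.\<close>

abbreviation tmp :: "nat \<Rightarrow> aexp" where
  "tmp d \<equiv> Cell ''#'' (Const d)"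

abbreviation settmp :: "nat \<Rightarrow> aexp \<Rightarrow> com" where
  "settmp d a \<equiv> Store ''#'' (Const d) a"

abbreviation reg :: "string \<Rightarrow> aexp" where
  "reg y \<equiv> Cell y (Const 0)"

section \<open>Compiler and step counts\<close>

text \<open>The value arrives in stack cell \<open>d\<close>, and cells below \<open>d\<close> are
  left alone. A bound register is saved on the stack and restored afterwards, so evaluation has no
  side effect outside the stack. A sum keeps accumulator, saved register, bound and index in the
  cells \<open>d\<close> to \<open>d + 3\<close>.\<close>

fun cex :: "nat \<Rightarrow> ex \<Rightarrow> com" where
  "cex d (N n) = settmp d (Const n)"
| "cex d (R x a) = Seq (cex d a) (settmp d (Cell x (tmp d)))"
| "cex d (Add a b) = Seq (cex d a) (Seq (cex (d+1) b) (settmp d (Plus (tmp d) (tmp (d+1)))))"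
| "cex d (Sub a b) = Seq (cex d a) (Seq (cex (d+1) b) (settmp d (Minus (tmp d) (tmp (d+1)))))"
| "cex d (IfLt a b c e) = Seq (cex d a) (Seq (cex (d+1) b)
     (Cond (Less (tmp d) (tmp (d+1))) (cex d c) (cex d e)))"
| "cex d (IfEq a b c e) = Seq (cex d a) (Seq (cex (d+1) b)
     (Cond (Equal (tmp d) (tmp (d+1))) (cex d c) (cex d e)))"
| "cex d (LetE y a e) = Seq (cex d a) (Seq (settmp (d+1) (reg y)) (Seq (Store y (Const 0) (tmp d))
     (Seq (cex (d+2) e) (Seq (settmp d (tmp (d+2))) (Store y (Const 0) (tmp (d+1)))))))"
| "cex d (SumE x y e) = Seq (settmp d (Const 0)) (Seq (settmp (d+1) (reg y))
     (Seq (settmp (d+2) (reg x)) (Seq (settmp (d+3) (Const 0))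
     (Seq (While (Less (tmp (d+3)) (tmp (d+2)))
        (Seq (Store y (Const 0) (tmp (d+3))) (Seq (cex (d+4) e)
        (Seq (settmp d (Plus (tmp d) (tmp (d+4)))) (settmp (d+3) (Plus (tmp (d+3)) (Const 1)))))))
     (Store y (Const 0) (tmp (d+1)))))))"

text \<open>Bound and index of a loop live on the stack; the register \<open>y\<close> receives a
  copy of the index in each round, so assignments to it inside the body cannot disturb the
  loop.\<close>

fun crc :: "nat \<Rightarrow> rc \<Rightarrow> com" where
  "crc d (Asg x i a) = Seq (cex d i) (Seq (cex (d+1) a) (Store x (tmp d) (tmp (d+1))))"
| "crc d (c ;; c') = Seq (crc d c) (crc d c')"
| "crc d (For y x c) = Seq (settmp d (reg x)) (Seq (settmp (d+1) (Const 0))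
     (While (Less (tmp (d+1)) (tmp d))
        (Seq (Store y (Const 0) (tmp (d+1))) (Seq (crc (d+2) c)
        (settmp (d+1) (Plus (tmp (d+1)) (Const 1)))))))"

text \<open>A polynomial in the common bound \<open>V\<close> of all loop bounds; its degree comes
  from the nesting of loops, hence from the syntax alone. Both branches of a conditional are
  charged.\<close>

fun tex :: "nat \<Rightarrow> ex \<Rightarrow> nat" where
  "tex V (N n) = 1"
| "tex V (R x a) = tex V a + 1"
| "tex V (Add a b) = tex V a + tex V b + 1"
| "tex V (Sub a b) = tex V a + tex V b + 1"
| "tex V (IfLt a b c e) = tex V a + tex V b + tex V c + tex V e + 1"
| "tex V (IfEq a b c e) = tex V a + tex V b + tex V c + tex V e + 1"
| "tex V (LetE y a e) = tex V a + tex V e + 4"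
| "tex V (SumE x y e) = V * (tex V e + 4) + 6"

fun trc :: "nat \<Rightarrow> rc \<Rightarrow> nat" where
  "trc V (Asg x i a) = tex V i + tex V a + 1"
| "trc V (c ;; c') = trc V c + trc V c'"
| "trc V (For y x c) = V * (trc V c + 3) + 3"

lemma ev_cong: "''#'' \<notin> rds e \<Longrightarrow> (\<And>x. x \<noteq> ''#'' \<Longrightarrow> s x = s' x) \<Longrightarrow> ev e s = ev e s'"
proof (induction e arbitrary: s s')
  case (LetE y a e)
  have "ev a s = ev a s'" by (rule LetE.IH) (use LetE.prems in force)+
  moreover have "ev e (setreg s y (ev a s)) = ev e (setreg s' y (ev a s))"
    by (rule LetE.IH) (use LetE.prems in force)+
  ultimately show ?case by simp
next
  case (SumE x y e)
  have "ev e (setreg s y i) = ev e (setreg s' y i)" for i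
    by (rule SumE.IH) (use SumE.prems in force)+
  moreover have "s x 0 = s' x 0" using SumE.prems by force
  ultimately show ?case by simp
next
  case (R x a)
  have "ev a s = ev a s'" by (rule R.IH) (use R.prems in auto)
  then show ?case using R.prems by auto
next
  case (Add a b)
  have "ev a s = ev a s'" "ev b s = ev b s'" by (rule Add.IH; use Add.prems in force)+
  then show ?case by simp
next
  case (Sub a b)
  have "ev a s = ev a s'" "ev b s = ev b s'" by (rule Sub.IH; use Sub.prems in force)+
  then show ?case by simp
next
  case (IfLt a b c e)
  have "ev a s = ev a s'" "ev b s = ev b s'" "ev c s = ev c s'" "ev e s = ev e s'"
    by (rule IfLt.IH; use IfLt.prems in force)+
  then show ?case by simp
next
  case (IfEq a b c e)
  have "ev a s = ev a s'" "ev b s = ev b s'" "ev c s = ev c s'" "ev e s = ev e s'"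
    by (rule IfEq.IH; use IfEq.prems in force)+
  then show ?case by simp
qed simp

lemma exec_Store': "s' = s(x := (s x)(aval i s := aval a s)) \<Longrightarrow> exec (Store x i a) s 1 s'"
  by (hypsubst, rule exec.Store)

text \<open>Final stores are given up to the stack cells from \<open>d\<close> upwards.\<close>

definition same :: "nat \<Rightarrow> store \<Rightarrow> store \<Rightarrow> bool" where
  "same d s s' \<longleftrightarrow> (\<forall>x. x \<noteq> ''#'' \<longrightarrow> s x = s' x) \<and> (\<forall>i<d. s ''#'' i = s' ''#'' i)"


definition okx :: "nat \<Rightarrow> ex \<Rightarrow> store \<Rightarrow> bool" where
  "okx V e s \<longleftrightarrow> ''#'' \<notin> rds e \<and> cnts e \<inter> bnds e = {} \<and> (\<forall>x\<in>cnts e. s x 0 \<le> V)"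

lemma cnts_rds: "cnts e \<subseteq> rds e"
  by (induction e) auto

lemma okx_same: "okx V e s \<Longrightarrow> same d s s' \<Longrightarrow> okx V e s'"
  unfolding okx_def same_def using cnts_rds[of e] by (metis subsetD)

lemma same_trans: "same d s s' \<Longrightarrow> same d' s' s'' \<Longrightarrow> d \<le> d' \<Longrightarrow> same d s s''"
  by (auto simp: same_def)

lemma same_upd: "same d s s' \<Longrightarrow> d \<le> i \<Longrightarrow> same d s (setcell s' ''#'' i v)"
  by (auto simp: same_def)

lemma same_setreg:
  assumes "same d (setreg s y v) s'" "y \<noteq> ''#''"
  shows "same d (setreg s y w) (setreg s' y w)"
proof -
  have "(setreg s y v) y = s' y" using assms unfolding same_def by blast
  then have "s' y = (s y)(0 := v)" by simp
  then show ?thesis using assms by (auto simp: same_def)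
qed

lemma same_restore:
  "same d (setreg s y v) s' \<Longrightarrow> y \<noteq> ''#'' \<Longrightarrow> same d s (setreg s' y (s y 0))"
  using same_setreg[of d s y v s' "s y 0"] by simp

lemma ev_same: "okx V e s \<Longrightarrow> same d s s' \<Longrightarrow> ev e s' = ev e s"
  by (rule ev_cong) (auto simp: okx_def same_def)

lemma cex_correct:
  assumes "okx V e s"
  shows "\<exists>t s'. exec (cex d e) s t s' \<and> same d s s' \<and> s' ''#'' d = ev e s \<and> t \<le> tex V e"
  using assms
proof (induction e arbitrary: d s)
  case (N n)
  show ?case
  proof (intro exI conjI)
    show "exec (cex d (N n)) s 1 (setcell s ''#'' d n)"
      unfolding cex.simps by (rule exec_Store') simp
  qed (auto simp: same_def)
next
  case (R x a)
  then have "okx V a s" by (auto simp: okx_def)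
  from R.IH[OF this] obtain t s1 where
    1: "exec (cex d a) s t s1" "same d s s1" "s1 ''#'' d = ev a s" "t \<le> tex V a" by blast
  show ?case
  proof (intro exI conjI)
    show "exec (cex d (R x a)) s (t + 1) (setcell s1 ''#'' d (s1 x (s1 ''#'' d)))"
      unfolding cex.simps by (rule exec.Seq[OF 1(1)], rule exec_Store') simp
  qed (use 1 R.prems in \<open>auto simp: same_def okx_def\<close>)
next
  case (Add a b)
  then have ok: "okx V a s" "okx V b s" by (auto simp: okx_def)
  from Add.IH(1)[OF ok(1)] obtain t s1 where
    1: "exec (cex d a) s t s1" "same d s s1" "s1 ''#'' d = ev a s" "t \<le> tex V a" by blast
  from Add.IH(2)[OF okx_same[OF ok(2) 1(2)]] obtain u s2 where
    2: "exec (cex (d+1) b) s1 u s2" "same (d+1) s1 s2" "s2 ''#'' (d+1) = ev b s1" "u \<le> tex V b" by blast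
  have eq: "s2 ''#'' (d+1) = ev b s" "s2 ''#'' d = ev a s"
    using 1 2 ev_same[OF ok(2) 1(2)] by (auto simp: same_def)
  show ?case
  proof (intro exI conjI)
    show "exec (cex d (Add a b)) s (t + (u + 1)) (setcell s2 ''#'' d (ev a s + ev b s))"
      unfolding cex.simps by (rule exec.Seq[OF 1(1) exec.Seq[OF 2(1)]], rule exec_Store') (simp add: eq[simplified])
  qed (use 1 2 in \<open>auto simp: same_def\<close>)
next
  case (Sub a b)
  then have ok: "okx V a s" "okx V b s" by (auto simp: okx_def)
  from Sub.IH(1)[OF ok(1)] obtain t s1 where
    1: "exec (cex d a) s t s1" "same d s s1" "s1 ''#'' d = ev a s" "t \<le> tex V a" by blast
  from Sub.IH(2)[OF okx_same[OF ok(2) 1(2)]] obtain u s2 where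
    2: "exec (cex (d+1) b) s1 u s2" "same (d+1) s1 s2" "s2 ''#'' (d+1) = ev b s1" "u \<le> tex V b" by blast
  have eq: "s2 ''#'' (d+1) = ev b s" "s2 ''#'' d = ev a s"
    using 1 2 ev_same[OF ok(2) 1(2)] by (auto simp: same_def)
  show ?case
  proof (intro exI conjI)
    show "exec (cex d (Sub a b)) s (t + (u + 1)) (setcell s2 ''#'' d (ev a s - ev b s))"
      unfolding cex.simps by (rule exec.Seq[OF 1(1) exec.Seq[OF 2(1)]], rule exec_Store') (simp add: eq[simplified])
  qed (use 1 2 in \<open>auto simp: same_def\<close>)
next
  case (IfLt a b c e)
  then have ok: "okx V a s" "okx V b s" "okx V c s" "okx V e s" by (auto simp: okx_def)
  from IfLt.IH(1)[OF ok(1)] obtain t s1 where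
    1: "exec (cex d a) s t s1" "same d s s1" "s1 ''#'' d = ev a s" "t \<le> tex V a" by blast
  from IfLt.IH(2)[OF okx_same[OF ok(2) 1(2)]] obtain u s2 where
    2: "exec (cex (d+1) b) s1 u s2" "same (d+1) s1 s2" "s2 ''#'' (d+1) = ev b s1" "u \<le> tex V b" by blast
  have s2: "same d s s2" using same_trans[OF 1(2) 2(2)] by simp
  have eq: "s2 ''#'' (d+1) = ev b s" "s2 ''#'' d = ev a s"
    using 1 2 ev_same[OF ok(2) 1(2)] by (auto simp: same_def)
  show ?case
  proof (cases "ev a s < ev b s")
    case True
    from IfLt.IH(3)[OF okx_same[OF ok(3) s2]] obtain v s3 where
      3: "exec (cex d c) s2 v s3" "same d s2 s3" "s3 ''#'' d = ev c s2" "v \<le> tex V c" by blast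
    have "exec (cex d (IfLt a b c e)) s (t + (u + (v + 1))) s3"
      unfolding cex.simps
      by (rule exec.Seq[OF 1(1) exec.Seq[OF 2(1) exec.CondTrue[OF _ 3(1)]]]) (use eq True in simp)
    moreover have "same d s s3" using same_trans[OF s2 3(2)] by simp
    ultimately show ?thesis using 1 2 3 True ev_same[OF ok(3) s2]
      by (intro exI[of _ "t + (u + (v + 1))"] exI[of _ s3]) auto
  next
    case False
    from IfLt.IH(4)[OF okx_same[OF ok(4) s2]] obtain v s3 where
      3: "exec (cex d e) s2 v s3" "same d s2 s3" "s3 ''#'' d = ev e s2" "v \<le> tex V e" by blast
    have "exec (cex d (IfLt a b c e)) s (t + (u + (v + 1))) s3"
      unfolding cex.simps
      by (rule exec.Seq[OF 1(1) exec.Seq[OF 2(1) exec.CondFalse[OF _ 3(1)]]]) (use eq False in simp)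
    moreover have "same d s s3" using same_trans[OF s2 3(2)] by simp
    ultimately show ?thesis using 1 2 3 False ev_same[OF ok(4) s2]
      by (intro exI[of _ "t + (u + (v + 1))"] exI[of _ s3]) auto
  qed
next
  case (IfEq a b c e)
  then have ok: "okx V a s" "okx V b s" "okx V c s" "okx V e s" by (auto simp: okx_def)
  from IfEq.IH(1)[OF ok(1)] obtain t s1 where
    1: "exec (cex d a) s t s1" "same d s s1" "s1 ''#'' d = ev a s" "t \<le> tex V a" by blast
  from IfEq.IH(2)[OF okx_same[OF ok(2) 1(2)]] obtain u s2 where
    2: "exec (cex (d+1) b) s1 u s2" "same (d+1) s1 s2" "s2 ''#'' (d+1) = ev b s1" "u \<le> tex V b" by blast
  have s2: "same d s s2" using same_trans[OF 1(2) 2(2)] by simp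
  have eq: "s2 ''#'' (d+1) = ev b s" "s2 ''#'' d = ev a s"
    using 1 2 ev_same[OF ok(2) 1(2)] by (auto simp: same_def)
  show ?case
  proof (cases "ev a s = ev b s")
    case True
    from IfEq.IH(3)[OF okx_same[OF ok(3) s2]] obtain v s3 where
      3: "exec (cex d c) s2 v s3" "same d s2 s3" "s3 ''#'' d = ev c s2" "v \<le> tex V c" by blast
    have "exec (cex d (IfEq a b c e)) s (t + (u + (v + 1))) s3"
      unfolding cex.simps
      by (rule exec.Seq[OF 1(1) exec.Seq[OF 2(1) exec.CondTrue[OF _ 3(1)]]]) (use eq True in simp)
    moreover have "same d s s3" using same_trans[OF s2 3(2)] by simp
    ultimately show ?thesis using 1 2 3 True ev_same[OF ok(3) s2]
      by (intro exI[of _ "t + (u + (v + 1))"] exI[of _ s3]) auto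
  next
    case False
    from IfEq.IH(4)[OF okx_same[OF ok(4) s2]] obtain v s3 where
      3: "exec (cex d e) s2 v s3" "same d s2 s3" "s3 ''#'' d = ev e s2" "v \<le> tex V e" by blast
    have "exec (cex d (IfEq a b c e)) s (t + (u + (v + 1))) s3"
      unfolding cex.simps
      by (rule exec.Seq[OF 1(1) exec.Seq[OF 2(1) exec.CondFalse[OF _ 3(1)]]]) (use eq False in simp)
    moreover have "same d s s3" using same_trans[OF s2 3(2)] by simp
    ultimately show ?thesis using 1 2 3 False ev_same[OF ok(4) s2]
      by (intro exI[of _ "t + (u + (v + 1))"] exI[of _ s3]) auto
  qed
next
  case (LetE y a e)
  then have ok: "okx V a s" "okx V e (setreg s y (ev a s))" by (auto simp: okx_def)
  have y: "y \<noteq> ''#''" using LetE.prems by (auto simp: okx_def)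
  from LetE.IH(1)[OF ok(1)] obtain t s1 where
    1: "exec (cex d a) s t s1" "same d s s1" "s1 ''#'' d = ev a s" "t \<le> tex V a" by blast
  define s2 where "s2 = setcell s1 ''#'' (d+1) (s y 0)"
  define s3 where "s3 = setreg s2 y (ev a s)"
  have 2: "exec (settmp (d+1) (reg y)) s1 1 s2"
    using 1(2) y by (intro exec_Store') (auto simp: s2_def same_def)
  have 3: "exec (Store y (Const 0) (tmp d)) s2 1 s3"
    using 1(3) y by (intro exec_Store') (auto simp: s2_def s3_def)
  have s3: "same d (setreg s y (ev a s)) s3"
    using 1(2) y by (auto simp: s3_def s2_def same_def)
  from LetE.IH(2)[OF okx_same[OF ok(2) s3]] obtain u s4 where
    4: "exec (cex (d+2) e) s3 u s4" "same (d+2) s3 s4" "s4 ''#'' (d+2) = ev e s3" "u \<le> tex V e" by blast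
  define s5 where "s5 = setcell s4 ''#'' d (ev (LetE y a e) s)"
  define s6 where "s6 = setreg s5 y (s y 0)"
  have 5: "exec (settmp d (tmp (d+2))) s4 1 s5"
    using 4(3) ev_same[OF ok(2) s3] by (intro exec_Store') (auto simp: s5_def)
  have "s5 ''#'' (d+1) = s y 0"
    using 4(2) y by (auto simp: s5_def same_def s3_def s2_def)
  then have 6: "exec (Store y (Const 0) (tmp (d+1))) s5 1 s6"
    by (intro exec_Store') (auto simp: s6_def)
  have "exec (cex d (LetE y a e)) s (t + (1 + (1 + (u + (1 + 1))))) s6"
    unfolding cex.simps by (rule exec.Seq[OF 1(1) exec.Seq[OF 2 exec.Seq[OF 3 exec.Seq[OF 4(1) exec.Seq[OF 5 6]]]]])
  moreover have "same d s s6"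
    unfolding s6_def s5_def using y same_trans[OF s3 4(2)]
    by (intro same_restore same_upd) auto
  moreover have "s6 ''#'' d = ev (LetE y a e) s" using y by (auto simp: s6_def s5_def)
  ultimately show ?case using 1(4) 4(4) 
    by (intro exI[of _ "t + (1 + (1 + (u + (1 + 1))))"] exI[of _ s6]) auto
next
  case (SumE x y e)
  have xy: "x \<noteq> ''#''" "y \<noteq> ''#''" "x \<noteq> y" using SumE.prems by (auto simp: okx_def)
  have V: "s x 0 \<le> V" using SumE.prems by (auto simp: okx_def)
  let ?n = "s x 0"
  have ok: "okx V e (setreg s y i)" for i using SumE.prems by (auto simp: okx_def)
  define B where "B = Seq (Store y (Const 0) (tmp (d+3))) (Seq (cex (d+4) e)
        (Seq (settmp d (Plus (tmp d) (tmp (d+4)))) (settmp (d+3) (Plus (tmp (d+3)) (Const 1)))))"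
  let ?f = "\<lambda>i. ev e (setreg s y i)"
  \<comment> \<open>Outside the stack the store differs from \<open>s\<close> at most in cell 0 of
    the loop register; naming its current value covers the start, where it is still the old one, as
    well as all later rounds.\<close>
  define inv where "inv i s' \<longleftrightarrow> same d (setreg s y (s' y 0)) s' \<and> s' ''#'' d = (\<Sum>j<i. ?f j) \<and>
     s' ''#'' (d+1) = s y 0 \<and> s' ''#'' (d+2) = ?n \<and> s' ''#'' (d+3) = i" for i s'
  have body: "\<exists>t s2. exec B s1 t s2 \<and> inv (Suc i) s2 \<and> t \<le> tex V e + 3" if i: "inv i s1" for i s1
  proof -
    define s2 where "s2 = setreg s1 y i"
    have 1: "exec (Store y (Const 0) (tmp (d+3))) s1 1 s2"
      using i by (intro exec_Store') (auto simp: s2_def inv_def)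
    have s2: "same d (setreg s y i) s2" using i xy unfolding s2_def inv_def by (blast intro: same_setreg)
    from SumE.IH[OF okx_same[OF ok s2]] obtain t s3 where
      2: "exec (cex (d+4) e) s2 t s3" "same (d+4) s2 s3" "s3 ''#'' (d+4) = ev e s2" "t \<le> tex V e" by blast
    define s4 where "s4 = setcell s3 ''#'' d ((\<Sum>j<i. ?f j) + ?f i)"
    have "s3 ''#'' d = (\<Sum>j<i. ?f j)" using 2(2) i xy by (auto simp: same_def s2_def inv_def)
    then have 3: "exec (settmp d (Plus (tmp d) (tmp (d+4)))) s3 1 s4"
      using 2(3) ev_same[OF ok s2] by (intro exec_Store') (auto simp: s4_def)
    define s5 where "s5 = setcell s4 ''#'' (d+3) (i+1)"
    have "s4 ''#'' (d+3) = i" using 2(2) i xy by (auto simp: same_def s2_def inv_def s4_def)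
    then have 4: "exec (settmp (d+3) (Plus (tmp (d+3)) (Const 1))) s4 1 s5"
      by (intro exec_Store') (auto simp: s5_def)
    have "exec B s1 (1 + (t + (1 + 1))) s5"
      unfolding B_def by (rule exec.Seq[OF 1 exec.Seq[OF 2(1) exec.Seq[OF 3 4]]])
    moreover have "same d (setreg s y i) s5"
      using same_trans[OF s2 2(2)] unfolding s5_def s4_def by (intro same_upd) auto
    moreover have "s5 y = s2 y" using 2(2) xy by (simp add: s5_def s4_def same_def)
    then have "s5 y 0 = i" by (simp add: s2_def)
    moreover have "s3 ''#'' j = s1 ''#'' j" if "j < d + 4" for j
      using 2(2) that xy by (simp add: same_def s2_def)
    then have "s5 ''#'' d = (\<Sum>j<Suc i. ?f j)" "s5 ''#'' (d+1) = s y 0" "s5 ''#'' (d+2) = ?n" "s5 ''#'' (d+3) = Suc i"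
      using i by (simp_all add: inv_def s5_def s4_def)
    ultimately have "inv (Suc i) s5" by (simp add: inv_def)
    moreover note \<open>exec B s1 (1 + (t + (1 + 1))) s5\<close>
    ultimately show ?thesis using 2(4) by (intro exI[of _ "1 + (t + (1 + 1))"] exI[of _ s5]) auto
  qed
  have loop: "\<exists>t s2. exec (While (Less (tmp (d+3)) (tmp (d+2))) B) s1 t s2 \<and> inv ?n s2 \<and>
      t \<le> (?n - i) * (tex V e + 4) + 1" if "inv i s1" "i \<le> ?n" for i s1
    using that
  proof (induction "?n - i" arbitrary: i s1)
    case 0
    then have "i = ?n" by simp
    with 0 show ?case
      by (intro exI[of _ 1] exI[of _ s1] conjI exec.WhileFalse) (auto simp: inv_def)
  next
    case (Suc k)
    from body[OF Suc.prems(1)] obtain t s2 where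
      1: "exec B s1 t s2" "inv (Suc i) s2" "t \<le> tex V e + 3" by blast
    from Suc.hyps(2) have "k = ?n - Suc i" "Suc i \<le> ?n" by auto
    from Suc.hyps(1)[OF this(1) 1(2) this(2)] obtain u s3 where
      2: "exec (While (Less (tmp (d+3)) (tmp (d+2))) B) s2 u s3" "inv ?n s3"
        "u \<le> (?n - Suc i) * (tex V e + 4) + 1" by blast
    have "i < ?n" using Suc.hyps(2) by simp
    then have "?n - i = Suc (?n - Suc i)" by simp
    then have "t + u + 1 \<le> (?n - i) * (tex V e + 4) + 1" using 1(3) 2(3) by simp
    moreover have "bval (Less (tmp (d+3)) (tmp (d+2))) s1" using Suc.prems \<open>i < ?n\<close> by (simp add: inv_def)
    ultimately show ?case using exec.WhileTrue[OF _ 1(1) 2(1)] 2(2) by blast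
  qed
  define s4 where "s4 = setcell (setcell (setcell (setcell s ''#'' d 0) ''#'' (d+1) (s y 0)) ''#'' (d+2) ?n) ''#'' (d+3) 0"
  have init: "exec (settmp d (Const 0)) s 1 (setcell s ''#'' d 0)"
    "exec (settmp (d+1) (reg y)) (setcell s ''#'' d 0) 1 (setcell (setcell s ''#'' d 0) ''#'' (d+1) (s y 0))"
    "exec (settmp (d+2) (reg x)) (setcell (setcell s ''#'' d 0) ''#'' (d+1) (s y 0)) 1
      (setcell (setcell (setcell s ''#'' d 0) ''#'' (d+1) (s y 0)) ''#'' (d+2) ?n)"
    "exec (settmp (d+3) (Const 0)) (setcell (setcell (setcell s ''#'' d 0) ''#'' (d+1) (s y 0)) ''#'' (d+2) ?n) 1 s4"
    using xy by - (rule exec_Store', simp add: s4_def; fail)+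
  have "inv 0 s4" using xy by (auto simp: s4_def inv_def same_def fun_eq_iff)
  from loop[OF this] obtain t s5 where
    5: "exec (While (Less (tmp (d+3)) (tmp (d+2))) B) s4 t s5" "inv ?n s5" "t \<le> ?n * (tex V e + 4) + 1" by auto
  define s6 where "s6 = setreg s5 y (s y 0)"
  have 6: "exec (Store y (Const 0) (tmp (d+1))) s5 1 s6"
    using 5(2) by (intro exec_Store') (auto simp: s6_def inv_def)
  have "exec (cex d (SumE x y e)) s (1 + (1 + (1 + (1 + (t + 1))))) s6"
    unfolding cex.simps B_def[symmetric]
    by (rule exec.Seq[OF init(1) exec.Seq[OF init(2) exec.Seq[OF init(3) exec.Seq[OF init(4) exec.Seq[OF 5(1) 6]]]]])
  moreover have "same d s s6"
    unfolding s6_def using 5(2) xy by (intro same_restore) (auto simp: inv_def)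
  moreover have "s6 ''#'' d = ev (SumE x y e) s" using 5(2) xy by (simp add: s6_def inv_def)
  moreover have "?n * (tex V e + 4) \<le> V * (tex V e + 4)" using V by (intro mult_right_mono) auto
  then have "1 + (1 + (1 + (1 + (t + 1)))) \<le> tex V (SumE x y e)" using 5(3) unfolding tex.simps by linarith
  ultimately show ?case by blast
qed


definition okc :: "nat \<Rightarrow> rc \<Rightarrow> store \<Rightarrow> bool" where
  "okc V c s \<longleftrightarrow> wfc c \<and> (\<forall>x\<in>cntsc c. s x 0 \<le> V)"

lemma fold_upt_induct [consumes 0, case_names init step]:
  assumes "P 0 s" "\<And>i s. i < n \<Longrightarrow> P i s \<Longrightarrow> P (Suc i) (f i s)"
  shows "P n (fold f [0..<n] s)"
  using assms(2)
proof (induction n)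
  case 0
  show ?case using assms(1) by simp
next
  case (Suc n)
  then have "P n (fold f [0..<n] s)" by simp
  then show ?case using Suc.prems by simp
qed

lemma fold_upt_rel:
  assumes "P s s'" "\<And>i s s'. i < n \<Longrightarrow> P s s' \<Longrightarrow> P (f i s) (g i s')"
  shows "P (fold f [0..<n] s) (fold g [0..<n] s')"
  using assms(2)
proof (induction n)
  case 0
  show ?case using assms(1) by simp
next
  case (Suc n)
  then have "P (fold f [0..<n] s) (fold g [0..<n] s')" by simp
  then show ?case using Suc.prems by simp
qed

lemma sem_frame: "x \<notin> wrs c \<Longrightarrow> sem c s x = s x"
proof (induction c arbitrary: s)
  case (For y z c)
  have "fold (\<lambda>i s. sem c (setreg s y i)) [0..<n] s x = s x" for n
    by (rule fold_upt_induct[where P = "\<lambda>i s'. s' x = s x"]) (use For in auto)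
  then show ?case by simp
qed auto

lemma cntsc_rdsc: "cntsc c \<subseteq> rdsc c"
  using cnts_rds by (induction c) fastforce+

lemma okc_same: "okc V c s \<Longrightarrow> same 0 s s' \<Longrightarrow> okc V c s'"
  unfolding okc_def same_def wfc_def using cntsc_rdsc[of c] by (metis subsetD)

lemma same_fun: "same d s s' \<Longrightarrow> x \<noteq> ''#'' \<Longrightarrow> s' x = s x"
  by (simp add: same_def)

lemma sem_same:
  assumes "''#'' \<notin> rdsc c" "same 0 s s'"
  shows "same 0 (sem c s) (sem c s')"
  using assms
proof (induction c arbitrary: s s')
  case (Asg x i a)
  have "ev i s = ev i s'" "ev a s = ev a s'"
    by (rule ev_cong; use Asg in \<open>force simp: same_def\<close>)+
  then show ?case using Asg by (auto simp: same_def)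
next
  case (RSeq c1 c2)
  then show ?case by (metis UnI1 UnI2 rdsc.simps(2) sem.simps(2))
next
  case (For y x c)
  have "s x = s' x" using For.prems by (auto simp: same_def)
  moreover have "same 0 (fold (\<lambda>i s. sem c (setreg s y i)) [0..<n] s) (fold (\<lambda>i s. sem c (setreg s y i)) [0..<n] s')" for n
  proof (rule fold_upt_rel[where P = "same 0"])
    fix i s s'
    assume "same 0 s s'"
    then show "same 0 (sem c (setreg s y i)) (sem c (setreg s' y i))"
      using For.prems(1) by (intro For.IH) (auto simp: same_def)
  qed (rule For.prems(2))
  ultimately show ?case by simp
qed

text \<open>Two facts about the final store: below \<open>d\<close> the stack is as in
  \<open>s\<close>, which is expressed by putting the old stack back, and outside the stack the
  store agrees with \<open>sem c s\<close>. The stack itself is not modelled by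
  \<open>sem\<close>.\<close>

lemma crc_correct:
  assumes "okc V c s"
  shows "\<exists>t s'. exec (crc d c) s t s' \<and> same d s' (s'(''#'' := s ''#'')) \<and> same 0 (sem c s) s' \<and> t \<le> trc V c"
  using assms
proof (induction c arbitrary: d s)
  case (Asg x i a)
  have ok: "okx V i s" "okx V a s" and x: "x \<noteq> ''#''"
    using Asg by (auto simp: okc_def okx_def wfc_def)
  from cex_correct[OF ok(1)] obtain t s1 where
    1: "exec (cex d i) s t s1" "same d s s1" "s1 ''#'' d = ev i s" "t \<le> tex V i" by blast
  from cex_correct[OF okx_same[OF ok(2) 1(2)]] obtain u s2 where
    2: "exec (cex (d+1) a) s1 u s2" "same (d+1) s1 s2" "s2 ''#'' (d+1) = ev a s1" "u \<le> tex V a" by blast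
  have eq: "s2 ''#'' (d+1) = ev a s" "s2 ''#'' d = ev i s"
    using 1 2 ev_same[OF ok(2) 1(2)] by (auto simp: same_def)
  have s2: "same d s s2" using same_trans[OF 1(2) 2(2)] by simp
  show ?case
  proof (intro exI conjI)
    show "exec (crc d (Asg x i a)) s (t + (u + 1)) (setcell s2 x (ev i s) (ev a s))"
      unfolding crc.simps by (rule exec.Seq[OF 1(1) exec.Seq[OF 2(1)]], rule exec_Store') (simp add: eq[simplified])
    have "s2 x = s x" using s2 x by (simp add: same_def)
    then show "same 0 (sem (Asg x i a) s) (setcell s2 x (ev i s) (ev a s))"
      using s2 x by (auto simp: same_def)
  qed (use 1 2 s2 x in \<open>auto simp: same_def\<close>)
next
  case (RSeq c1 c2)
  have "sem c1 s x = s x" if "x \<in> cntsc c2" for x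
    using RSeq.prems that by (intro sem_frame) (auto simp: okc_def wfc_def)
  then have ok: "okc V c1 s" "okc V c2 (sem c1 s)"
    using RSeq.prems by (auto simp: okc_def wfc_def)
  from RSeq.IH(1)[OF ok(1)] obtain t s1 where
    1: "exec (crc d c1) s t s1" "same d s1 (s1(''#'' := s ''#''))" "same 0 (sem c1 s) s1" "t \<le> trc V c1" by blast
  have ok2: "okc V c2 s1" by (rule okc_same[OF ok(2) 1(3)])
  from RSeq.IH(2)[OF ok2] obtain u s2 where
    2: "exec (crc d c2) s1 u s2" "same d s2 (s2(''#'' := s1 ''#''))" "same 0 (sem c2 s1) s2" "u \<le> trc V c2" by blast
  have "same 0 (sem c2 (sem c1 s)) (sem c2 s1)"
    using 1(3) ok by (intro sem_same) (auto simp: okc_def wfc_def)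
  then have "same 0 (sem (c1 ;; c2) s) s2" using 2(3) by (simp add: same_def)
  then show ?case using exec.Seq[OF 1(1) 2(1)] 1 2
    by (intro exI[of _ "t + u"] exI[of _ s2]) (auto simp: same_def)
next
  case (For y x c)
  have xy: "x \<noteq> ''#''" "y \<noteq> ''#''" "x \<noteq> y" "''#'' \<notin> rdsc c" using For.prems by (auto simp: okc_def wfc_def)
  have V: "s x 0 \<le> V" using For.prems by (auto simp: okc_def)
  let ?n = "s x 0"
  define st where "st i = fold (\<lambda>i s. sem c (setreg s y i)) [0..<i] s" for i
  define B where "B = Seq (Store y (Const 0) (tmp (d+1))) (Seq (crc (d+2) c)
        (settmp (d+1) (Plus (tmp (d+1)) (Const 1))))"
  have fr: "st i z = s z" if "z \<in> cntsc (For y x c)" for i z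
  proof -
    have "z \<notin> wrs (For y x c)" using that For.prems by (auto simp: okc_def wfc_def)
    then show ?thesis unfolding st_def
      by (intro fold_upt_induct[where P = "\<lambda>i s'. s' z = s z"]) (auto simp: sem_frame)
  qed
  define inv where "inv i s' \<longleftrightarrow> same 0 (st i) s' \<and> (\<forall>j<d. s' ''#'' j = s ''#'' j) \<and>
     s' ''#'' d = ?n \<and> s' ''#'' (d+1) = i" for i s'
  have body: "\<exists>t s2. exec B s1 t s2 \<and> inv (Suc i) s2 \<and> t \<le> trc V c + 2" if i: "inv i s1" for i s1
  proof -
    define s2 where "s2 = setreg s1 y i"
    have 1: "exec (Store y (Const 0) (tmp (d+1))) s1 1 s2"
      using i by (intro exec_Store') (auto simp: s2_def inv_def)
    have s2: "same 0 (setreg (st i) y i) s2" using i xy by (auto simp: s2_def inv_def same_def)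
    have "s2 z 0 \<le> V" if "z \<in> cntsc c" for z
    proof -
      have "z \<noteq> ''#''" "z \<noteq> y" using that For.prems cntsc_rdsc[of c] by (auto simp: okc_def wfc_def)
      moreover have "s1 z = st i z" using i \<open>z \<noteq> ''#''\<close> by (simp add: inv_def same_fun[of 0])
      ultimately show ?thesis using fr[of z i] that For.prems by (simp add: okc_def s2_def)
    qed
    then have "okc V c s2" using For.prems by (auto simp: okc_def wfc_def)
    from For.IH[OF this] obtain t s3 where
      2: "exec (crc (d+2) c) s2 t s3" "same (d+2) s3 (s3(''#'' := s2 ''#''))" "same 0 (sem c s2) s3" "t \<le> trc V c" by blast
    define s4 where "s4 = setcell s3 ''#'' (d+1) (i+1)"
    have h: "s3 ''#'' j = s1 ''#'' j" if "j < d + 2" for j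
      using 2(2) that xy by (simp add: same_def s2_def)
    have "s3 ''#'' (d+1) = i" using h i by (simp add: inv_def)
    then have 3: "exec (settmp (d+1) (Plus (tmp (d+1)) (Const 1))) s3 1 s4"
      by (intro exec_Store') (auto simp: s4_def)
    have "exec B s1 (1 + (t + 1)) s4"
      unfolding B_def by (rule exec.Seq[OF 1 exec.Seq[OF 2(1) 3]])
    moreover have "same 0 (sem c (setreg (st i) y i)) (sem c s2)"
      by (rule sem_same[OF xy(4) s2])
    then have "same 0 (st (Suc i)) s4"
      using 2(3) by (auto simp: s4_def same_def st_def)
    then have "inv (Suc i) s4"
      using i h by (auto simp: inv_def s4_def)
    ultimately show ?thesis using 2(4) by (intro exI[of _ "1 + (t + 1)"] exI[of _ s4]) auto
  qed
  have loop: "\<exists>t s2. exec (While (Less (tmp (d+1)) (tmp d)) B) s1 t s2 \<and> inv ?n s2 \<and>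
      t \<le> (?n - i) * (trc V c + 3) + 1" if "inv i s1" "i \<le> ?n" for i s1
    using that
  proof (induction "?n - i" arbitrary: i s1)
    case 0
    then have "i = ?n" by simp
    with 0 show ?case
      by (intro exI[of _ 1] exI[of _ s1] conjI exec.WhileFalse) (auto simp: inv_def)
  next
    case (Suc k)
    from body[OF Suc.prems(1)] obtain t s2 where
      1: "exec B s1 t s2" "inv (Suc i) s2" "t \<le> trc V c + 2" by blast
    from Suc.hyps(2) have "k = ?n - Suc i" "Suc i \<le> ?n" by auto
    from Suc.hyps(1)[OF this(1) 1(2) this(2)] obtain u s3 where
      2: "exec (While (Less (tmp (d+1)) (tmp d)) B) s2 u s3" "inv ?n s3"
        "u \<le> (?n - Suc i) * (trc V c + 3) + 1" by blast
    have "i < ?n" using Suc.hyps(2) by simp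
    then have "?n - i = Suc (?n - Suc i)" by simp
    then have "t + u + 1 \<le> (?n - i) * (trc V c + 3) + 1" using 1(3) 2(3) by simp
    moreover have "bval (Less (tmp (d+1)) (tmp d)) s1" using Suc.prems \<open>i < ?n\<close> by (simp add: inv_def)
    ultimately show ?case using exec.WhileTrue[OF _ 1(1) 2(1)] 2(2) by blast
  qed
  define s2 where "s2 = setcell (setcell s ''#'' d ?n) ''#'' (d+1) 0"
  have init: "exec (settmp d (reg x)) s 1 (setcell s ''#'' d ?n)"
    "exec (settmp (d+1) (Const 0)) (setcell s ''#'' d ?n) 1 s2"
    using xy by - (rule exec_Store', simp add: s2_def; fail)+
  have "inv 0 s2" using xy by (auto simp: s2_def inv_def same_def st_def)
  from loop[OF this] obtain t s3 where
    3: "exec (While (Less (tmp (d+1)) (tmp d)) B) s2 t s3" "inv ?n s3" "t \<le> ?n * (trc V c + 3) + 1" by auto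
  have "exec (crc d (For y x c)) s (1 + (1 + t)) s3"
    unfolding crc.simps B_def[symmetric] by (rule exec.Seq[OF init(1) exec.Seq[OF init(2) 3(1)]])
  moreover have "same d s3 (s3(''#'' := s ''#''))" using 3(2) by (auto simp: inv_def same_def)
  moreover have "same 0 (sem (For y x c) s) s3" using 3(2) by (auto simp: inv_def st_def)
  moreover have "?n * (trc V c + 3) \<le> V * (trc V c + 3)" using V by (intro mult_right_mono) auto
  then have "1 + (1 + t) \<le> trc V (For y x c)" using 3(3) unfolding trc.simps by linarith
  ultimately show ?case by blast
qed

section \<open>Polynomial time bounds and programs in stages\<close>

definition polyb :: "(nat \<Rightarrow> nat) \<Rightarrow> bool" where
  "polyb f \<longleftrightarrow> (\<exists>K d. \<forall>V. f V \<le> K * (V + 1) ^ d)"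

lemma polyb_const: "polyb (\<lambda>V. k)"
  unfolding polyb_def by (rule exI[of _ k], rule exI[of _ 0]) simp

lemma polyb_add:
  assumes "polyb f" "polyb g"
  shows "polyb (\<lambda>V. f V + g V)"
proof -
  from assms obtain K d K' d' where h: "\<And>V. f V \<le> K * (V + 1) ^ d" "\<And>V. g V \<le> K' * (V + 1) ^ d'"
    unfolding polyb_def by blast
  have "f V + g V \<le> (K + K') * (V + 1) ^ (d + d')" for V
  proof -
    have "(V + 1) ^ d \<le> (V + 1) ^ (d + d')" "(V + 1) ^ d' \<le> (V + 1) ^ (d + d')"
      by (intro power_increasing; simp)+
    then have "K * (V + 1) ^ d \<le> K * (V + 1) ^ (d + d')" "K' * (V + 1) ^ d' \<le> K' * (V + 1) ^ (d + d')"
      by (simp_all only: mult_le_mono2)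
    then have "f V + g V \<le> K * (V + 1) ^ (d + d') + K' * (V + 1) ^ (d + d')"
      by (intro add_mono le_trans[OF h(1)] le_trans[OF h(2)])
    then show ?thesis by (simp only: add_mult_distrib)
  qed
  then show ?thesis unfolding polyb_def by blast
qed

lemma polyb_mult:
  assumes "polyb f"
  shows "polyb (\<lambda>V. V * f V)"
proof -
  from assms obtain K d where h: "\<And>V. f V \<le> K * (V + 1) ^ d" unfolding polyb_def by blast
  have "V * f V \<le> K * (V + 1) ^ (Suc d)" for V
  proof -
    have "V * f V \<le> (V + 1) * (K * (V + 1) ^ d)" using h by (intro mult_mono) auto
    then show ?thesis by (simp add: ac_simps)
  qed
  then show ?thesis unfolding polyb_def by blast
qed

lemma polyb_tex: "polyb (\<lambda>V. tex V e)"
  by (induction e) (simp_all only: tex.simps, (intro polyb_add polyb_const polyb_mult; assumption?)+)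

lemma polyb_trc: "polyb (\<lambda>V. trc V c)"
  by (induction c) (simp_all only: trc.simps, (intro polyb_add polyb_const polyb_mult polyb_tex; assumption?)+)

text \<open>A stage may use loop bounds that earlier stages computed; what has to be bounded is
  their value at the moment when the stage begins.\<close>

fun oks :: "rc list \<Rightarrow> nat \<Rightarrow> store \<Rightarrow> bool" where
  "oks [] V s = True"
| "oks (c # cs) V s = ((\<forall>x\<in>cntsc c. s x 0 \<le> V) \<and> oks cs V (sem c s))"

fun sems :: "rc list \<Rightarrow> store \<Rightarrow> store" where
  "sems [] s = s"
| "sems (c # cs) s = sems cs (sem c s)"

lemma sems_append: "sems (cs @ ds) s = sems ds (sems cs s)"
  by (induction cs arbitrary: s) auto

lemma oks_append: "oks (cs @ ds) V s \<longleftrightarrow> oks cs V s \<and> oks ds V (sems cs s)"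
  by (induction cs arbitrary: s) auto

text \<open>The program, the factor \<open>K\<close> and the exponent \<open>d\<close> depend on the
  stages alone; store and bound are quantified afterwards, as needed for one fixed program that does
  not know the parameter.\<close>

lemma compile_stages:
  assumes "\<forall>c\<in>set cs. wfc c"
  shows "\<exists>p K d. \<forall>s V. oks cs V s \<longrightarrow>
    (\<exists>t s'. exec p s t s' \<and> (\<forall>x. x \<noteq> ''#'' \<longrightarrow> s' x = sems cs s x) \<and> t \<le> K * (V + 1) ^ d)"
proof -
  \<comment> \<open>The store that is really reached differs from the ideal one in the stack, so the
    induction runs over pairs of stores that agree outside it.\<close>
  have "\<exists>p f. polyb f \<and> (\<forall>s V s0. same 0 s0 s \<longrightarrow> oks cs V s0 \<longrightarrow> (\<exists>t s'. exec p s t s' \<and> same 0 (sems cs s0) s' \<and> t \<le> f V))"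
    using assms
  proof (induction cs)
    case Nil
    show ?case
      by (rule exI[of _ Skip], rule exI[of _ "\<lambda>V. 1"])
        (metis exec.Skip order_refl sems.simps(1) polyb_const)
  next
    case (Cons c cs)
    then obtain p f where pf: "polyb f" "\<And>s V s0. same 0 s0 s \<Longrightarrow> oks cs V s0 \<Longrightarrow>
      (\<exists>t s'. exec p s t s' \<and> same 0 (sems cs s0) s' \<and> t \<le> f V)" by auto
    have "\<exists>t s'. exec (Seq (crc 0 c) p) s t s' \<and> same 0 (sems (c # cs) s0) s' \<and> t \<le> trc V c + f V"
      if "same 0 s0 s" "oks (c # cs) V s0" for s V s0
    proof -
      have w: "''#'' \<notin> rdsc c" using Cons.prems unfolding wfc_def by (meson list.set_intros(1))
      have "okc V c s" by (rule okc_same[OF _ that(1)]) (use that(2) Cons.prems in \<open>simp add: okc_def\<close>)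
      from crc_correct[OF this] obtain t s1 where
        1: "exec (crc 0 c) s t s1" "same 0 (sem c s) s1" "t \<le> trc V c" by blast
      have "same 0 (sem c s0) s1" using sem_same[OF w that(1)] 1(2) by (simp add: same_def)
      moreover have "oks cs V (sem c s0)" using that(2) by simp
      ultimately obtain u s2 where
        "exec p s1 u s2" "same 0 (sems cs (sem c s0)) s2" "u \<le> f V" using pf(2) by blast
      then show ?thesis using exec.Seq[OF 1(1)] 1(3)
        by (intro exI[of _ "t + u"] exI[of _ s2]) auto
    qed
    moreover have "polyb (\<lambda>V. trc V c + f V)" using polyb_add[OF polyb_trc pf(1)] .
    ultimately show ?case
      by (intro exI[of _ "Seq (crc 0 c) p"] exI[of _ "\<lambda>V. trc V c + f V"]) blast
  qed
  then obtain p f where "polyb f" and f: "\<And>s V s0. same 0 s0 s \<Longrightarrow> oks cs V s0 \<Longrightarrow>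
      (\<exists>t s'. exec p s t s' \<and> same 0 (sems cs s0) s' \<and> t \<le> f V)" by auto
  then obtain K d where K: "\<And>V. f V \<le> K * (V + 1) ^ d" unfolding polyb_def by blast
  have "\<exists>t s'. exec p s t s' \<and> (\<forall>x. x \<noteq> ''#'' \<longrightarrow> s' x = sems cs s x) \<and> t \<le> K * (V + 1) ^ d"
    if ok: "oks cs V s" for s V
  proof -
    have "same 0 s s" by (simp add: same_def)
    from f[OF this ok] obtain t s' where t: "exec p s t s'" "same 0 (sems cs s) s'" "t \<le> f V"
      by blast
    have "t \<le> K * (V + 1) ^ d" using t(3) K[of V] by (rule le_trans)
    moreover have "\<forall>x. x \<noteq> ''#'' \<longrightarrow> s' x = sems cs s x" using t(2) by (auto simp: same_def)
    ultimately show ?thesis using t(1) by blast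
  qed
  then show ?thesis by blast
qed

lemma oks_mono: "oks cs V s \<Longrightarrow> V \<le> V' \<Longrightarrow> oks cs V' s"
  by (induction cs arbitrary: s) (auto intro: le_trans)

lemma finite_cnts: "finite (cnts e)"
  by (induction e) auto

lemma finite_cntsc: "finite (cntsc c)"
  by (induction c) (auto simp: finite_cnts)

text \<open>Finitely many registers bound loops, so some \<open>V\<close> always exists; this
  suffices for computability, where time does not count.\<close>

lemma oks_ex: "\<exists>V. oks cs V s"
proof (induction cs arbitrary: s)
  case Nil
  show ?case by (rule exI[of _ 0]) (rule oks.simps(1)[THEN iffD2, OF TrueI])
next
  case (Cons c cs)
  from Cons.IH[of "sem c s"] obtain V where V: "oks cs V (sem c s)" by blast
  let ?S = "\<Sum>x\<in>cntsc c. s x 0"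
  have "s x 0 \<le> ?S" if "x \<in> cntsc c" for x
    by (rule member_le_sum) (use that finite_cntsc in auto)
  then have "\<forall>x\<in>cntsc c. s x 0 \<le> V + ?S" by (intro ballI trans_le_add2)
  then have "oks (c # cs) (V + ?S) s"
    using oks_mono[OF V le_add1] by (simp only: oks.simps)
  then show ?case by (rule exI[of _ "V + ?S"])
qed

lemma computable_stages:
  assumes "\<forall>c\<in>set cs. wfc c"
  shows "computable (\<lambda>n. sems cs (input_store [n]) ''out'' 0)"
proof -
  from compile_stages[OF assms] obtain p K d where
    p: "\<forall>s V. oks cs V s \<longrightarrow> (\<exists>t s'. exec p s t s' \<and> (\<forall>x. x \<noteq> ''#'' \<longrightarrow> s' x = sems cs s x) \<and>
      t \<le> K * (V + 1) ^ d)" by (elim exE) (erule that)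
  show ?thesis unfolding computable_def
  proof (rule exI[of _ p], rule allI)
    fix n
    obtain V where "oks cs V (input_store [n])" using oks_ex by blast
    with p obtain t s' where "exec p (input_store [n]) t s'"
      "\<forall>x. x \<noteq> ''#'' \<longrightarrow> s' x = sems cs (input_store [n]) x" by metis
    moreover from this(2) have "output_of s' = sems cs (input_store [n]) ''out'' 0"
      unfolding output_of_def by simp
    ultimately show "\<exists>t s. exec p (input_store [n]) t s \<and> output_of s = sems cs (input_store [n]) ''out'' 0"
      by blast
  qed
qed

section \<open>Arithmetic in the loop language\<close>

abbreviation rg :: "string \<Rightarrow> ex" where "rg x \<equiv> R x (N 0)"

lemma wfcI:
  assumes "rdsc c \<subseteq> - {''#''}" "cntsc c \<subseteq> C" "wrs c \<subseteq> - C" "bndsc c \<subseteq> - C"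
  shows "wfc c"
  using assms unfolding wfc_def by blast

text \<open>A loop that updates cells by idempotent functions of their index does not depend on how often a
  cell is visited.\<close>

lemma sem_For_map:
  fixes f :: "nat \<Rightarrow> nat" and g :: "nat \<Rightarrow> nat \<Rightarrow> nat"
  assumes "a \<noteq> y" "\<And>i v. g i (g i v) = g i v"
    and ev: "\<And>s' j. (\<And>z. z \<noteq> a \<Longrightarrow> z \<noteq> y \<Longrightarrow> s' z = s z) \<Longrightarrow> j < s x 0 \<Longrightarrow>
      ev I (setreg s' y j) = f j \<and> ev E (setreg s' y j) = g (f j) (s' a (f j))"
  shows "sem (For y x (Asg a I E)) s a i = (if i \<in> f ` {..<s x 0} then g i (s a i) else s a i)"
proof -
  let ?n = "s x 0"
  define P where "P j s' \<longleftrightarrow> (\<forall>z. z \<noteq> a \<longrightarrow> z \<noteq> y \<longrightarrow> s' z = s z) \<and>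
    (\<forall>i. s' a i = (if i \<in> f ` {..<j} then g i (s a i) else s a i))" for j s'
  have "P ?n (fold (\<lambda>j s. sem (Asg a I E) (setreg s y j)) [0..<?n] s)"
  proof (rule fold_upt_induct[where P = P])
    show "P 0 s" by (simp add: P_def)
    fix j s' assume j: "j < ?n" and P: "P j s'"
    then have e: "ev I (setreg s' y j) = f j" "ev E (setreg s' y j) = g (f j) (s' a (f j))"
      using ev[of s' j] unfolding P_def by blast+
    show "P (Suc j) (sem (Asg a I E) (setreg s' y j))"
      unfolding P_def
    proof (intro conjI allI impI)
      fix z assume "z \<noteq> a" "z \<noteq> y"
      then show "sem (Asg a I E) (setreg s' y j) z = s z" using P by (simp add: P_def)
    next
      fix i
      have s'a: "s' a i = (if i \<in> f ` {..<j} then g i (s a i) else s a i)" using P by (simp add: P_def)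
      have *: "sem (Asg a I E) (setreg s' y j) a i = (if i = f j then g i (s' a i) else s' a i)"
        using e assms(1) by simp
      show "sem (Asg a I E) (setreg s' y j) a i = (if i \<in> f ` {..<Suc j} then g i (s a i) else s a i)"
        unfolding * s'a by (auto simp: lessThan_Suc assms(2))
    qed
  qed
  then show ?thesis by (simp add: P_def)
qed

text \<open>There is no multiplication: summing the current value over as many indices as register
  \<open>b\<close> says multiplies it by that number.\<close>

definition powc :: "string \<Rightarrow> string \<Rightarrow> string \<Rightarrow> rc" where
  "powc r b e = Asg r (N 0) (N 1) ;; For ''pi'' e (Asg r (N 0) (SumE b ''pj'' (rg r)))"

lemma sem_powc:
  assumes "distinct [r, b, e, ''pi'', ''pj''] \<or> (b = e \<and> distinct [r, b, ''pi'', ''pj''])"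
  shows "sem (powc r b e) s r 0 = s b 0 ^ s e 0"
proof -
  define s1 where "s1 = setreg s r 1"
  define P where "P j s' \<longleftrightarrow> s' b = s b \<and> s' r 0 = s b 0 ^ j" for j and s' :: store
  have "P (s1 e 0) (fold (\<lambda>j s. sem (Asg r (N 0) (SumE b ''pj'' (rg r))) (setreg s ''pi'' j)) [0..<s1 e 0] s1)"
  proof (rule fold_upt_induct[where P = P])
    show "P 0 s1" using assms by (auto simp: P_def s1_def)
    fix j s' assume "P j s'"
    then show "P (Suc j) (sem (Asg r (N 0) (SumE b ''pj'' (rg r))) (setreg s' ''pi'' j))"
      using assms by (auto simp: P_def)
  qed
  moreover have "s1 e 0 = s e 0" using assms by (auto simp: s1_def)
  ultimately show ?thesis by (simp add: powc_def P_def s1_def)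
qed

lemma wrs_powc: "wrs (powc r b e) = {r, ''pi''}"
  by (auto simp: powc_def)

text \<open>The quotient is the number of \<open>i\<close> with \<open>(i + 1) * b <= a\<close>,
  where the inner sum adds \<open>b\<close> once for each \<open>j <= i\<close>. The register
  \<open>Z\<close> has to be at least the dividend.\<close>

definition divE :: "ex \<Rightarrow> ex \<Rightarrow> ex" where
  "divE a b = LetE ''da'' a (LetE ''db'' b (SumE ''Z'' ''di'' (IfLt (rg ''da'')
     (SumE ''Z'' ''dj'' (IfLt (rg ''di'') (rg ''dj'') (N 0) (rg ''db''))) (N 0) (N 1))))"

definition modE :: "ex \<Rightarrow> ex \<Rightarrow> ex" where
  "modE a b = LetE ''ma'' a (LetE ''mb'' b (LetE ''mc'' (divE (rg ''ma'') (rg ''mb''))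
     (Sub (rg ''ma'') (SumE ''Z'' ''mi'' (IfLt (rg ''mi'') (rg ''mc'') (rg ''mb'') (N 0))))))"

lemma sum_if_less: "(\<Sum>i<n. if i < m then k else 0) = min m n * (k::nat)"
proof -
  have "(\<Sum>i<n. if i < m then k else 0) = (\<Sum>i\<in>{i\<in>{..<n}. i < m}. k)"
    by (rule sum.inter_filter[symmetric]) simp
  also have "{i\<in>{..<n}. i < m} = {..<min m n}" by auto
  finally show ?thesis by simp
qed

lemma div_as_count:
  assumes "a \<le> Z" "0 < (b::nat)"
  shows "(\<Sum>i<Z. if a < Suc i * b then 0 else 1) = a div b"
proof -
  have "a < Suc i * b \<longleftrightarrow> \<not> i < a div b" for i
    using assms(2) by (metis Suc_leI div_less_iff_less_mult less_Suc_eq_le not_less)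
  then have "(\<Sum>i<Z. if a < Suc i * b then 0 else 1) = (\<Sum>i<Z. if i < a div b then 1 else 0)"
    by (intro sum.cong) auto
  also have "\<dots> = min (a div b) Z" using sum_if_less[of "a div b" 1 Z] by simp
  also have "\<dots> = a div b" 
    using le_trans[OF div_le_dividend assms(1)] by (rule min_absorb1)
  finally show ?thesis .
qed

text \<open>The divisor is evaluated after the dividend was stored in \<open>da\<close>, hence the
  store in the second assumption.\<close>

lemma ev_divE:
  assumes "ev a s \<le> s ''Z'' 0" "ev b (setreg s ''da'' (ev a s)) = bv" "0 < bv"
  shows "ev (divE a b) s = ev a s div bv"
proof -
  let ?Z = "s ''Z'' 0"
  have "(\<Sum>j<?Z. if i < j then 0 else bv) = Suc i * bv" if "i < ?Z" for i
  proof -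
    have "(\<Sum>j<?Z. if i < j then 0 else bv) = (\<Sum>j<?Z. if j < Suc i then bv else 0)"
      by (intro sum.cong) auto
    then show ?thesis using sum_if_less[where m = "Suc i" and n = ?Z and k = bv] that by (simp add: min_def)
  qed
  then have "ev (divE a b) s = (\<Sum>i<?Z. if ev a s < Suc i * bv then 0 else 1)"
    unfolding divE_def using assms(2) by (simp del: mult_Suc cong: if_cong)
  then show ?thesis using div_as_count[OF assms(1,3)] by simp
qed

lemma ev_modE:
  assumes "ev a s \<le> s ''Z'' 0" "ev b (setreg s ''ma'' (ev a s)) = bv" "0 < bv"
  shows "ev (modE a b) s = ev a s mod bv"
proof -
  let ?Z = "s ''Z'' 0" and ?a = "ev a s"
  define s2 where "s2 = setreg (setreg s ''ma'' ?a) ''mb'' bv"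
  have d: "ev (divE (rg ''ma'') (rg ''mb'')) s2 = ?a div bv"
    using assms by (subst ev_divE[where bv = bv]) (simp_all add: s2_def)
  have "ev (modE a b) s = ?a - (\<Sum>i<?Z. if i < ?a div bv then bv else 0)"
    unfolding modE_def using assms(2) d by (simp add: s2_def cong: if_cong)
  also have "(\<Sum>i<?Z. if i < ?a div bv then bv else 0) = ?a div bv * bv"
    
    using sum_if_less[where m = "?a div bv" and n = ?Z and k = bv] min_absorb1[OF le_trans[OF div_le_dividend assms(1)]] by simp
  finally show ?thesis by (simp add: minus_div_mult_eq_mod)
qed

text \<open>\<open>p\<close> names an array holding the powers of the register \<open>b\<close>.\<close>

definition digE :: "string \<Rightarrow> string \<Rightarrow> ex \<Rightarrow> ex \<Rightarrow> ex" where
  "digE b p c i = modE (divE c (R p i)) (rg b)"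

lemma ev_digE:
  assumes "ev c s \<le> s ''Z'' 0" "ev i (setreg s ''da'' (ev c s)) = iv"
    "p \<noteq> ''da''" "b \<noteq> ''ma''" "s p iv = s b 0 ^ iv" "0 < s b 0"
  shows "ev (digE b p c i) s = dig (s b 0) (ev c s) iv"
proof -
  have d: "ev (divE c (R p i)) s = ev c s div s b 0 ^ iv"
    using assms by (intro ev_divE) auto
  then have "ev (divE c (R p i)) s \<le> s ''Z'' 0" using assms(1) div_le_dividend le_trans by metis
  from ev_modE[OF this, of "rg b" "s b 0"] show ?thesis
    unfolding digE_def using assms d by (simp add: dig_def)
qed

text \<open>Table of the powers up to exponent \<open>Z\<close>, so that extracting a digit takes
  only a division and a remainder.\<close>

definition powers :: "string \<Rightarrow> string \<Rightarrow> rc" where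
  "powers p b = Asg p (N 0) (N 1) ;; For ''pi'' ''Z'' (Asg p (Add (rg ''pi'') (N 1)) (SumE b ''pj'' (R p (rg ''pi''))))"

lemma sem_powers:
  assumes "distinct [p, b, ''pi'', ''pj'', ''Z'']" "i \<le> s ''Z'' 0"
  shows "sem (powers p b) s p i = s b 0 ^ i"
proof -
  define s1 where "s1 = setreg s p 1"
  let ?c = "Asg p (Add (rg ''pi'') (N 1)) (SumE b ''pj'' (R p (rg ''pi'')))"
  define P where "P j s' \<longleftrightarrow> s' b = s b \<and> (\<forall>i\<le>j. s' p i = s b 0 ^ i)" for j and s' :: store
  have "P (s1 ''Z'' 0) (fold (\<lambda>j s. sem ?c (setreg s ''pi'' j)) [0..<s1 ''Z'' 0] s1)"
  proof (rule fold_upt_induct[where P = P])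
    show "P 0 s1" using assms by (auto simp: P_def s1_def)
    fix j s' assume "P j s'"
    then show "P (Suc j) (sem ?c (setreg s' ''pi'' j))"
      using assms(1) by (auto simp: P_def le_Suc_eq)
  qed
  moreover have "s1 ''Z'' 0 = s ''Z'' 0" using assms by (auto simp: s1_def)
  ultimately show ?thesis using assms(2) by (simp add: powers_def P_def s1_def)
qed

lemma wrs_powers: "wrs (powers p b) = {p, ''pi''}"
  by (auto simp: powers_def)

section \<open>Reading the input\<close>

abbreviation nE :: ex where "nE \<equiv> R ''in'' (N 2)"
abbreviation vx :: "ex \<Rightarrow> ex" where "vx i \<equiv> R ''in'' (Add (N 3) i)"
abbreviation apos :: "ex \<Rightarrow> ex" where "apos j \<equiv> Add (Add (N 3) nE) (Add j j)"
abbreviation tle :: "ex \<Rightarrow> ex" where "tle j \<equiv> R ''in'' (apos j)"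
abbreviation hde :: "ex \<Rightarrow> ex" where "hde j \<equiv> R ''in'' (Add (apos j) (N 1))"

text \<open>A loop bound has to be cell 0 of an array, while the number of vertices stands in cell 2
  of the input; so the sum runs over the word length \<open>A\<close> and is cut off.\<close>

definition sumV :: "string \<Rightarrow> ex \<Rightarrow> ex" where
  "sumV i e = SumE ''A'' i (IfLt (rg i) nE e (N 0))"

text \<open>The number of arcs is not written in the word; an arc exists as long as its position
  lies before the end of the input.\<close>

definition sumA :: "string \<Rightarrow> ex \<Rightarrow> ex" where
  "sumA j e = SumE ''A'' j (IfLt (apos (rg j)) (rg ''len'') e (N 0))"

lemma syn_sumV [simp]:
  "rds (sumV i e) = {''A'', i, ''in''} \<union> rds e" "cnts (sumV i e) = insert ''A'' (cnts e)"
  "bnds (sumV i e) = insert i (bnds e)"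
  by (auto simp: sumV_def)

lemma syn_sumA [simp]:
  "rds (sumA i e) = {''A'', i, ''in'', ''len''} \<union> rds e" "cnts (sumA i e) = insert ''A'' (cnts e)"
  "bnds (sumA i e) = insert i (bnds e)"
  by (auto simp: sumA_def)

lemma syn_divE [simp]:
  "rds (divE a b) = rds a \<union> rds b \<union> {''da'', ''db'', ''di'', ''dj'', ''Z''}"
  "cnts (divE a b) = insert ''Z'' (cnts a \<union> cnts b)"
  "bnds (divE a b) = bnds a \<union> bnds b \<union> {''da'', ''db'', ''di'', ''dj''}"
  by (auto simp: divE_def)

lemma syn_modE [simp]:
  "rds (modE a b) = rds a \<union> rds b \<union> {''da'', ''db'', ''di'', ''dj'', ''Z'', ''ma'', ''mb'', ''mc'', ''mi''}"
  "cnts (modE a b) = insert ''Z'' (cnts a \<union> cnts b)"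
  "bnds (modE a b) = bnds a \<union> bnds b \<union> {''da'', ''db'', ''di'', ''dj'', ''ma'', ''mb'', ''mc'', ''mi''}"
  by (auto simp: modE_def)

lemma syn_digE [simp]:
  "rds (digE b p c i) = rds c \<union> rds i \<union> {b, p, ''da'', ''db'', ''di'', ''dj'', ''Z'', ''ma'', ''mb'', ''mc'', ''mi''}"
  "cnts (digE b p c i) = insert ''Z'' (cnts c \<union> cnts i)"
  "bnds (digE b p c i) = bnds c \<union> bnds i \<union> {''da'', ''db'', ''di'', ''dj'', ''ma'', ''mb'', ''mc'', ''mi''}"
  by (auto simp: digE_def)

locale instance_word =
  fixes G :: "nat pair_pre_digraph" and k :: int and vs :: "nat list" and es :: "(nat \<times> nat) list"
    and w :: "nat list"
  assumes G: "pair_digraph G"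
    and vs: "distinct vs" "set vs = pverts G"
    and es: "distinct es" "set es = parcs G"
    and w: "w = [if k < 0 then 1 else 0, nat \<bar>k\<bar>, length vs] @ vs @ concat (map (\<lambda>(u, v). [u, v]) es)"
begin

abbreviation "n \<equiv> length vs"
abbreviation "m \<equiv> length es"
abbreviation "A \<equiv> length w"

lemma length_pairs: "length (concat (map (\<lambda>(u, v). [u, v]) xs)) = 2 * length xs"
  by (induction xs) auto

lemma nth_pairs:
  "j < length xs \<Longrightarrow> concat (map (\<lambda>(u, v). [u, v]) xs) ! (j + j) = fst (xs ! j)"
  "j < length xs \<Longrightarrow> concat (map (\<lambda>(u, v). [u, v]) xs) ! Suc (j + j) = snd (xs ! j)"
  by (induction xs arbitrary: j) (auto simp: nth_Cons split: nat.splits)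

lemma A: "A = 3 + n + 2 * m"
  by (simp add: w length_pairs)

definition base :: "store \<Rightarrow> bool" where
  "base s \<longleftrightarrow> s ''in'' = input_store w ''in'' \<and> s ''len'' = input_store w ''len'' \<and> s ''A'' 0 = A"

lemma base_upd [simp]: "z \<noteq> ''in'' \<Longrightarrow> z \<noteq> ''len'' \<Longrightarrow> z \<noteq> ''A'' \<Longrightarrow> base (s(z := f)) = base s"
  by (simp add: base_def)

lemma base_A: "base s \<Longrightarrow> s ''A'' 0 = A"
  by (simp add: base_def)

lemma w_nth: "w ! 0 = (if k < 0 then 1 else 0)" "w ! Suc 0 = nat \<bar>k\<bar>" "w ! 2 = n"
  "i < n \<Longrightarrow> w ! (3 + i) = vs ! i"
  by (simp_all only: w) (simp_all add: nth_append)

lemma w_nth_arc: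
  assumes "j < m"
  shows "w ! (3 + n + (j + j)) = fst (es ! j)" "w ! (3 + n + (j + j) + 1) = snd (es ! j)"
proof -
  have w': "w = ([if k < 0 then 1 else 0, nat \<bar>k\<bar>, n] @ vs) @ concat (map (\<lambda>(u, v). [u, v]) es)"
    by (simp add: w)
  have "w ! (3 + n + i) = concat (map (\<lambda>(u, v). [u, v]) es) ! i" for i
    unfolding w' by (subst nth_append) simp
  from this[of "j + j"] this[of "Suc (j + j)"] show
    "w ! (3 + n + (j + j)) = fst (es ! j)" "w ! (3 + n + (j + j) + 1) = snd (es ! j)"
    using nth_pairs[OF assms] by simp_all
qed

lemma base_in: "base s \<Longrightarrow> i < A \<Longrightarrow> s ''in'' i = w ! i"
  by (simp add: base_def input_store_def)

lemma base_n: "base s \<Longrightarrow> s ''in'' 2 = n"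
  using base_in[of s 2] w_nth(3) A by simp

lemma base_k: "base s \<Longrightarrow> s ''in'' 0 = (if k < 0 then 1 else 0)" "base s \<Longrightarrow> s ''in'' (Suc 0) = nat \<bar>k\<bar>"
  using base_in[of s 0] base_in[of s "Suc 0"] w_nth(1,2) A by simp_all

lemma base_len: "base s \<Longrightarrow> s ''len'' 0 = A"
  by (simp add: base_def input_store_def)

lemma base_vx: "base s \<Longrightarrow> i < n \<Longrightarrow> s ''in'' (3 + i) = vs ! i"
  using base_in[of s "3 + i"] w_nth(4)[of i] A by simp

lemma base_tle:
  assumes "base s" "j < m"
  shows "s ''in'' (3 + n + (j + j)) = fst (es ! j)" "s ''in'' (3 + n + (j + j) + 1) = snd (es ! j)"
proof -
  have "3 + n + (j + j) < A" "3 + n + (j + j) + 1 < A" using assms(2) A by auto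
  from base_in[OF assms(1) this(1)] base_in[OF assms(1) this(2)] w_nth_arc[OF assms(2)]
  show "s ''in'' (3 + n + (j + j)) = fst (es ! j)" "s ''in'' (3 + n + (j + j) + 1) = snd (es ! j)"
    by simp_all
qed

lemma ev_sumV:
  assumes "base s" "''in'' \<noteq> i" "''len'' \<noteq> i" "''A'' \<noteq> i"
  shows "ev (sumV i e) s = (\<Sum>x<n. ev e (setreg s i x))"
proof -
  have "ev (sumV i e) s = (\<Sum>x<A. if x < n then ev e (setreg s i x) else 0)"
    using assms by (simp add: sumV_def base_A base_n cong: if_cong)
  also have "\<dots> = (\<Sum>x\<in>{x\<in>{..<A}. x < n}. ev e (setreg s i x))"
    by (rule sum.inter_filter[symmetric]) simp
  also have "{x\<in>{..<A}. x < n} = {..<n}" using A by auto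
  finally show ?thesis .
qed

lemma ev_sumA:
  assumes "base s" "''in'' \<noteq> i" "''len'' \<noteq> i" "''A'' \<noteq> i"
  shows "ev (sumA i e) s = (\<Sum>x<m. ev e (setreg s i x))"
proof -
  have "ev (sumA i e) s = (\<Sum>x<A. if 3 + n + (x + x) < A then ev e (setreg s i x) else 0)"
    using assms by (simp add: sumA_def base_A base_n base_len cong: if_cong)
  also have "\<dots> = (\<Sum>x\<in>{x\<in>{..<A}. 3 + n + (x + x) < A}. ev e (setreg s i x))"
    by (rule sum.inter_filter[symmetric]) simp
  also have "{x\<in>{..<A}. 3 + n + (x + x) < A} = {..<m}" using A by auto
  finally show ?thesis .
qed

lemma sum_vs: "(\<Sum>i<n. h (vs ! i)) = (\<Sum>v\<in>pverts G. h v)" for h :: "nat \<Rightarrow> nat"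
proof -
  have inj: "inj_on ((!) vs) {..<n}" by (rule inj_on_nth[OF vs(1)]) simp
  have eq: "pverts G = (!) vs ` {..<n}"
    unfolding vs(2)[symmetric] set_conv_nth by blast
  show ?thesis unfolding eq sum.reindex[OF inj] comp_def by (rule refl)
qed

lemma vs_V: "i < n \<Longrightarrow> vs ! i \<in> pverts G"
  using nth_mem[of i vs] unfolding vs(2) .

end

section \<open>Finding hubs and blocks\<close>

definition degrees_rc :: rc where
  "degrees_rc = For ''i'' ''A'' (Asg ''dg'' (vx (rg ''i'')) (sumA ''a''
     (IfEq (tle (rg ''a'')) (vx (rg ''i'')) (N 1) (IfEq (hde (rg ''a'')) (vx (rg ''i'')) (N 1) (N 0)))))"

definition linkE :: ex where
  "linkE = IfLt (rg ''i'') nE (IfLt (rg ''j'') nE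
     (IfLt (rg ''q'') (R ''dg'' (vx (rg ''i''))) (IfLt (rg ''q'') (R ''dg'' (vx (rg ''j''))) (N 1) (N 0))
       (IfLt (rg ''q'') (R ''dg'' (vx (rg ''j''))) (N 0)
         (IfLt (N 0) (sumA ''a''
           (IfEq (tle (rg ''a'')) (vx (rg ''i'')) (IfEq (hde (rg ''a'')) (vx (rg ''j'')) (N 1) (N 0))
           (IfEq (tle (rg ''a'')) (vx (rg ''j'')) (IfEq (hde (rg ''a'')) (vx (rg ''i'')) (N 1) (N 0)) (N 0))))
         (N 1) (N 0)))) (N 0)) (N 0)"

text \<open>Merges two classes by relabelling. Both labels are saved beforehand, since the loop
  changes \<open>blk\<close> while it runs; without a link every visited cell is rewritten by its
  own value.\<close>

definition union_rc :: rc where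
  "union_rc = Asg ''lk'' (N 0) linkE ;; Asg ''bu'' (N 0) (R ''blk'' (vx (rg ''i''))) ;;
     Asg ''bv'' (N 0) (R ''blk'' (vx (rg ''j''))) ;;
     For ''h'' ''A'' (Asg ''blk'' (vx (rg ''h'')) (IfEq (rg ''lk'') (N 1)
       (IfEq (R ''blk'' (vx (rg ''h''))) (rg ''bu'') (rg ''bv'') (R ''blk'' (vx (rg ''h''))))
       (R ''blk'' (vx (rg ''h'')))))"

definition blocks_rc :: rc where
  "blocks_rc = For ''i'' ''A'' (Asg ''blk'' (vx (rg ''i'')) (vx (rg ''i''))) ;;
     For ''i'' ''A'' (For ''j'' ''A'' union_rc)"

text \<open>Both loops run to \<open>A\<close>, so the value is the cube as long as
  \<open>q + 2 <= A\<close>.\<close>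

definition cubeE :: ex where
  "cubeE = LetE ''qq'' (Add (rg ''q'') (N 2)) (SumE ''A'' ''a'' (IfLt (rg ''a'') (rg ''qq'')
     (SumE ''A'' ''b'' (IfLt (rg ''b'') (rg ''qq'') (rg ''qq'') (N 0))) (N 0)))"

definition badE :: ex where
  "badE = sumV ''i'' (IfLt cubeE (sumV ''h''
     (IfEq (R ''blk'' (vx (rg ''h''))) (R ''blk'' (vx (rg ''i''))) (N 1) (N 0))) (N 1) (N 0))"

text \<open>Once \<open>badE\<close> vanishes, \<open>q\<close> no longer changes and the blocks are
  merely recomputed, so a fixed number of rounds can be run instead of a loop with a stopping
  condition.\<close>

definition search_rc :: rc where
  "search_rc = For ''t'' ''A'' (blocks_rc ;; Asg ''q'' (N 0) (IfEq badE (N 0) (rg ''q'') (Add (rg ''q'') (N 1))))"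

section \<open>Correctness of the search for hubs and blocks\<close>

context instance_word
begin

abbreviation "V \<equiv> pverts G"

lemma finite_V: "finite V"
  using vs(2) finite_set by metis

lemma base_cong: "s' ''in'' = s ''in'' \<Longrightarrow> s' ''len'' = s ''len'' \<Longrightarrow> s' ''A'' = s ''A'' \<Longrightarrow> base s \<Longrightarrow> base s'"
  by (simp add: base_def)

lemma ex_vs: "v \<in> V \<Longrightarrow> \<exists>i<n. v = vs ! i"
  unfolding vs(2)[symmetric] set_conv_nth by blast

text \<open>The loop runs past the vertices and also visits the cells named by arc ends, and cell 0
  beyond the end of the word. Since the update is idempotent and depends on the cell only, these
  further visits do no harm.\<close>

lemma sem_For_vx:
  assumes "base s" "a \<notin> {''in'', ''len'', ''A'', y}" "y \<notin> {''in'', ''len'', ''A''}" "\<And>i v. g i (g i v) = g i v"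
    and ev: "\<And>s' j. (\<And>z. z \<noteq> a \<Longrightarrow> z \<noteq> y \<Longrightarrow> s' z = s z) \<Longrightarrow> base s' \<Longrightarrow> j < A \<Longrightarrow>
      ev E (setreg s' y j) = g (s ''in'' (3 + j)) (s' a (s ''in'' (3 + j)))"
    and v: "v \<in> V"
  shows "sem (For y ''A'' (Asg a (vx (rg y)) E)) s a v = g v (s a v)"
proof -
  have "sem (For y ''A'' (Asg a (vx (rg y)) E)) s a v =
      (if v \<in> (\<lambda>j. s ''in'' (3 + j)) ` {..<s ''A'' 0} then g v (s a v) else s a v)"
  proof (rule sem_For_map)
    show "a \<noteq> y" using assms(2) by simp
    fix s' j assume s': "\<And>z. z \<noteq> a \<Longrightarrow> z \<noteq> y \<Longrightarrow> s' z = s z" "j < s ''A'' 0"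
    have "base s'" by (rule base_cong[OF _ _ _ assms(1)]) (use s'(1) assms(2,3) in auto)
    moreover have "j < A" using s'(2) base_A[OF assms(1)] by simp
    moreover have "ev (vx (rg y)) (setreg s' y j) = s ''in'' (3 + j)" using s'(1) assms(2,3) by auto
    ultimately show "ev (vx (rg y)) (setreg s' y j) = s ''in'' (3 + j) \<and>
        ev E (setreg s' y j) = g (s ''in'' (3 + j)) (s' a (s ''in'' (3 + j)))"
      using ev[OF s'(1)] by blast
  qed (rule assms(4))
  moreover have "v \<in> (\<lambda>j. s ''in'' (3 + j)) ` {..<s ''A'' 0}"
  proof -
    obtain i where i: "i < n" "v = vs ! i" using ex_vs[OF v] by blast
    then have "v = s ''in'' (3 + i)" "i < s ''A'' 0"
      using base_vx[OF assms(1), of i] base_A[OF assms(1)] A by simp_all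
    then show ?thesis by blast
  qed
  ultimately show ?thesis by simp
qed

lemma sum_es: "(\<Sum>j<m. h (es ! j)) = (\<Sum>e\<in>parcs G. h e)" for h :: "nat \<times> nat \<Rightarrow> nat"
proof -
  have inj: "inj_on ((!) es) {..<m}" by (rule inj_on_nth[OF es(1)]) simp
  have eq: "parcs G = (!) es ` {..<m}"
    unfolding es(2)[symmetric] set_conv_nth by blast
  show ?thesis unfolding eq sum.reindex[OF inj] comp_def by (rule refl)
qed

lemma finite_parcs: "finite (parcs G)"
  using es(2) finite_set by metis

lemma ex_es: "e \<in> parcs G \<Longrightarrow> \<exists>j<m. e = es ! j"
  unfolding es(2)[symmetric] set_conv_nth by blast

lemma es_parcs: "j < m \<Longrightarrow> es ! j \<in> parcs G"
  using nth_mem[of j es] unfolding es(2) .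

lemma arc_degree_sum: "arc_degree G v = (\<Sum>j<m. if fst (es ! j) = v then 1 else if snd (es ! j) = v then 1 else 0)"
proof -
  have "arc_degree G v = (\<Sum>e\<in>parcs G. if fst e = v \<or> snd e = v then 1 else 0)"
    unfolding arc_degree_def by (rule sum_indicator[OF finite_parcs, symmetric])
  also have "\<dots> = (\<Sum>e\<in>parcs G. if fst e = v then 1 else if snd e = v then 1 else 0)"
    by (rule sum.cong[OF refl]) simp
  finally show ?thesis using sum_es[of "\<lambda>e. if fst e = v then 1 else if snd e = v then 1 else 0"] by simp
qed

lemma sem_degrees:
  assumes "base s" "v \<in> V"
  shows "sem degrees_rc s ''dg'' v = arc_degree G v"
proof -
  have "sem degrees_rc s ''dg'' v = (\<lambda>x _. arc_degree G x) v (s ''dg'' v)"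
    unfolding degrees_rc_def
  proof (rule sem_For_vx[OF assms(1)])
    fix s' j assume s': "\<And>z. z \<noteq> ''dg'' \<Longrightarrow> z \<noteq> ''i'' \<Longrightarrow> s' z = s z" and b: "base s'"
    have "s' ''in'' = s ''in''" using s' by simp
    then show "ev (sumA ''a'' (IfEq (tle (rg ''a'')) (vx (rg ''i'')) (N 1) (IfEq (hde (rg ''a'')) (vx (rg ''i'')) (N 1) (N 0))))
        (setreg s' ''i'' j) = arc_degree G (s ''in'' (3 + j))"
      using b base_tle[OF b] base_n[OF b]
      by (simp add: ev_sumA arc_degree_sum add.assoc cong: if_cong)
  qed (use assms(2) in auto)
  then show ?thesis by simp
qed

definition base1 :: "nat \<Rightarrow> store \<Rightarrow> bool" where
  "base1 q s \<longleftrightarrow> base s \<and> s ''q'' 0 = q \<and> (\<forall>v\<in>V. s ''dg'' v = arc_degree G v)"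

lemma base1_cong:
  assumes "base1 q s" "s' ''in'' = s ''in''" "s' ''len'' = s ''len''" "s' ''A'' = s ''A''" "s' ''q'' = s ''q''" "s' ''dg'' = s ''dg''"
  shows "base1 q s'"
  using assms base_cong[of s' s] by (simp add: base1_def)

lemma base1_base: "base1 q s \<Longrightarrow> base s"
  by (simp add: base1_def)

lemma links_sym: "(u, v) \<in> links G q \<Longrightarrow> (v, u) \<in> links G q"
  by (auto simp: links_def split: if_splits)

lemma links_star_sym: "(u, v) \<in> (links G q)\<^sup>* \<Longrightarrow> (v, u) \<in> (links G q)\<^sup>*"
  using sym_rtrancl[of "links G q"] links_sym by (meson symD symI)

lemma ev_linkE:
  assumes "base1 q s"
  shows "ev linkE s = (if s ''i'' 0 < n \<and> s ''j'' 0 < n \<and> (vs ! s ''i'' 0, vs ! s ''j'' 0) \<in> links G q then 1 else 0)"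
proof -
  have b: "base s" using assms by (rule base1_base)
  show ?thesis
  proof (cases "s ''i'' 0 < n \<and> s ''j'' 0 < n")
    case True
    define u where "u = vs ! s ''i'' 0"
    define v where "v = vs ! s ''j'' 0"
    have uv: "u \<in> V" "v \<in> V" using True vs_V by (auto simp: u_def v_def)
    have x: "s ''in'' (3 + s ''i'' 0) = u" "s ''in'' (3 + s ''j'' 0) = v"
      using base_vx[OF b] True by (auto simp: u_def v_def)
    have h: "s ''dg'' u = arc_degree G u" "s ''dg'' v = arc_degree G v" "s ''q'' 0 = q"
      using assms uv by (auto simp: base1_def)
    let ?S = "\<Sum>a<m. if fst (es ! a) = u then if snd (es ! a) = v then 1 else 0
      else if fst (es ! a) = v then if snd (es ! a) = u then 1 else (0::nat) else 0"
    have "ev (sumA ''a''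
           (IfEq (tle (rg ''a'')) (vx (rg ''i'')) (IfEq (hde (rg ''a'')) (vx (rg ''j'')) (N 1) (N 0))
           (IfEq (tle (rg ''a'')) (vx (rg ''j'')) (IfEq (hde (rg ''a'')) (vx (rg ''i'')) (N 1) (N 0)) (N 0)))) s =
       ?S"
      using b base_tle[OF b] base_n[OF b] x by (simp add: ev_sumA add.assoc cong: if_cong)
    moreover have "0 < ?S \<longleftrightarrow> (u, v) \<in> parcs G \<or> (v, u) \<in> parcs G"
    proof -
      have loops: "(x, x) \<notin> parcs G" for x
        using G unfolding pair_digraph_def pair_loopfree_digraph_def pair_loopfree_digraph_axioms_def by force
      define T where "T a = (if fst (es ! a) = u then if snd (es ! a) = v then 1 else 0
        else if fst (es ! a) = v then if snd (es ! a) = u then 1 else (0::nat) else 0)" for a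
      have T: "T a = 0 \<longleftrightarrow> es ! a \<noteq> (u, v) \<and> es ! a \<noteq> (v, u)" if "a < m" for a
      proof (cases "es ! a")
        case (Pair x y)
        then have "x \<noteq> y" using es_parcs[OF that] loops by metis
        then show ?thesis unfolding T_def Pair by auto
      qed
      have "sum T {..<m} = 0 \<longleftrightarrow> (\<forall>a\<in>{..<m}. T a = 0)" by (rule sum_eq_0_iff) simp
      also have "\<dots> \<longleftrightarrow> (\<forall>a<m. es ! a \<noteq> (u, v) \<and> es ! a \<noteq> (v, u))" using T by blast
      also have "\<dots> \<longleftrightarrow> \<not> ((u, v) \<in> parcs G \<or> (v, u) \<in> parcs G)"
        using ex_es[of "(u, v)"] ex_es[of "(v, u)"] es_parcs by metis
      finally show ?thesis unfolding T_def neq0_conv[symmetric] by argo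
    qed
    ultimately show ?thesis
      using True b x h uv base_n[OF b] unfolding linkE_def u_def[symmetric] v_def[symmetric]
      by (simp add: links_def hubs_def not_less cong: if_cong)
  next
    case False
    then show ?thesis using base_n[OF b] by (auto simp: linkE_def)
  qed
qed

lemma wrs_union: "wrs union_rc = {''lk'', ''bu'', ''bv'', ''h'', ''blk''}"
  by (auto simp: union_rc_def)

lemma sem_union:
  assumes s: "base1 q s" and v: "v \<in> V"
  defines "l \<equiv> s ''i'' 0 < n \<and> s ''j'' 0 < n \<and> (vs ! s ''i'' 0, vs ! s ''j'' 0) \<in> links G q"
  shows "sem union_rc s ''blk'' v =
    (if l \<and> s ''blk'' v = s ''blk'' (vs ! s ''i'' 0) then s ''blk'' (vs ! s ''j'' 0) else s ''blk'' v)"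
proof -
  define bu bv where "bu = s ''blk'' (s ''in'' (3 + s ''i'' 0))" and "bv = s ''blk'' (s ''in'' (3 + s ''j'' 0))"
  define s1 where "s1 = setreg (setreg (setreg s ''lk'' (if l then 1 else 0)) ''bu'' bu) ''bv'' bv"
  have b: "base s" using s by (rule base1_base)
  have b1: "base s1" using b by (simp add: s1_def)
  define r :: "nat \<Rightarrow> nat \<Rightarrow> nat" where "r = (\<lambda>_ x. if l then if x = bu then bv else x else x)"
  have "sem (For ''h'' ''A'' (Asg ''blk'' (vx (rg ''h'')) (IfEq (rg ''lk'') (N 1)
       (IfEq (R ''blk'' (vx (rg ''h''))) (rg ''bu'') (rg ''bv'') (R ''blk'' (vx (rg ''h''))))
       (R ''blk'' (vx (rg ''h'')))))) s1 ''blk'' v = r v (s1 ''blk'' v)"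
  proof (rule sem_For_vx[OF b1])
    fix s' j assume s': "\<And>z. z \<noteq> ''blk'' \<Longrightarrow> z \<noteq> ''h'' \<Longrightarrow> s' z = s1 z"
    have "s' ''in'' = s1 ''in''" "s' ''lk'' 0 = (if l then 1 else 0)" "s' ''bu'' 0 = bu" "s' ''bv'' 0 = bv"
      using s' by (simp_all add: s1_def)
    then show "ev (IfEq (rg ''lk'') (N 1)
       (IfEq (R ''blk'' (vx (rg ''h''))) (rg ''bu'') (rg ''bv'') (R ''blk'' (vx (rg ''h''))))
       (R ''blk'' (vx (rg ''h'')))) (setreg s' ''h'' j) = r (s1 ''in'' (3 + j)) (s' ''blk'' (s1 ''in'' (3 + j)))"
      by (simp add: r_def)
  qed (use v in \<open>auto simp: r_def\<close>)
  moreover have "sem union_rc s = sem (For ''h'' ''A'' (Asg ''blk'' (vx (rg ''h'')) (IfEq (rg ''lk'') (N 1)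
       (IfEq (R ''blk'' (vx (rg ''h''))) (rg ''bu'') (rg ''bv'') (R ''blk'' (vx (rg ''h''))))
       (R ''blk'' (vx (rg ''h'')))))) s1"
    unfolding union_rc_def sem.simps(2)
    by (simp add: ev_linkE[OF s] s1_def bu_def bv_def l_def del: sem.simps(3) cong: if_cong)
  moreover have "s1 ''blk'' = s ''blk''" by (simp add: s1_def)
  moreover have "bu = s ''blk'' (vs ! s ''i'' 0)" "bv = s ''blk'' (vs ! s ''j'' 0)" if l
    using that base_vx[OF b] by (auto simp: l_def bu_def bv_def)
  ultimately show ?thesis by (auto simp: r_def)
qed

text \<open>Invariant of the relabelling: equal labels are always justified by links, and
  \<open>T\<close> collects the index pairs whose links are already respected.\<close>

definition joined :: "nat \<Rightarrow> (nat \<times> nat) set \<Rightarrow> (nat \<Rightarrow> nat) \<Rightarrow> bool" where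
  "joined q T f \<longleftrightarrow> (\<forall>v\<in>V. f v \<in> V) \<and> (\<forall>u\<in>V. \<forall>v\<in>V. f u = f v \<longrightarrow> (u, v) \<in> (links G q)\<^sup>*) \<and>
     (\<forall>(i, j)\<in>T. i < n \<longrightarrow> j < n \<longrightarrow> (vs ! i, vs ! j) \<in> links G q \<longrightarrow> f (vs ! i) = f (vs ! j))"

text \<open>A merge changes all vertices of one label alike, so labels that were equal stay equal;
  this is why one pass over the pairs is enough.\<close>

lemma joined_union:
  assumes s: "base1 q s" and j: "joined q T (s ''blk'')"
  shows "joined q (insert (s ''i'' 0, s ''j'' 0) T) (sem union_rc s ''blk'')"
proof -
  let ?u = "vs ! s ''i'' 0" and ?v = "vs ! s ''j'' 0"
  let ?l = "s ''i'' 0 < n \<and> s ''j'' 0 < n \<and> (?u, ?v) \<in> links G q"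
  let ?f = "s ''blk''" and ?g = "sem union_rc s ''blk''"
  have g: "?g v = (if ?l \<and> ?f v = ?f ?u then ?f ?v else ?f v)" if "v \<in> V" for v
    by (rule sem_union[OF s that])
  have fV: "?f v \<in> V" if "v \<in> V" for v using j that unfolding joined_def by blast
  have fc: "(u, v) \<in> (links G q)\<^sup>*" if "u \<in> V" "v \<in> V" "?f u = ?f v" for u v
    using j that unfolding joined_def by blast
  have fT: "?f (vs ! i) = ?f (vs ! j')" if "(i, j') \<in> T" "i < n" "j' < n" "(vs ! i, vs ! j') \<in> links G q" for i j'
    using j that unfolding joined_def by blast
  have lV: "?u \<in> V" "?v \<in> V" "(?u, ?v) \<in> (links G q)\<^sup>*" "(?v, ?u) \<in> (links G q)\<^sup>*" if ?l
    using that vs_V links_sym by blast+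
  have 1: "?g v \<in> V" if "v \<in> V" for v using g[OF that] fV lV that by simp
  have 2: "(u, v) \<in> (links G q)\<^sup>*" if uv: "u \<in> V" "v \<in> V" "?g u = ?g v" for u v
  proof (cases ?l)
    case True
    note l = lV[OF True]
    consider "?f u = ?f v" | "?f u = ?f ?u" "?f ?v = ?f v" | "?f v = ?f ?u" "?f ?v = ?f u"
      using uv(3) unfolding g[OF uv(1)] g[OF uv(2)] using True by (auto split: if_splits)
    then show ?thesis
    proof cases
      case 1
      then show ?thesis using fc uv by blast
    next
      case 2
      then show ?thesis using fc[OF uv(1) l(1)] fc[OF l(2) uv(2)] l(3) by (meson rtrancl_trans)
    next
      case 3
      then have "(v, ?u) \<in> (links G q)\<^sup>*" "(?v, u) \<in> (links G q)\<^sup>*" using fc[OF uv(2) l(1)] fc[OF l(2) uv(1)] by blast+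
      then have "(v, u) \<in> (links G q)\<^sup>*" using l(3) by (meson rtrancl_trans)
      then show ?thesis by (rule links_star_sym)
    qed
  next
    case False
    then have "?g u = ?f u" "?g v = ?f v"
      unfolding g[OF uv(1)] g[OF uv(2)] by (intro if_not_P; blast)+
    then have "?f u = ?f v" using uv(3) by simp
    then show ?thesis using fc uv by blast
  qed
  have 3: "?g (vs ! i) = ?g (vs ! j')" if h: "(i, j') \<in> insert (s ''i'' 0, s ''j'' 0) T" "i < n" "j' < n"
    "(vs ! i, vs ! j') \<in> links G q" for i j'
  proof (cases "(i, j') \<in> T")
    case True
    then show ?thesis using fT[OF True h(2-4)] g[OF vs_V[OF h(2)]] g[OF vs_V[OF h(3)]] by simp
  next
    case False
    then show ?thesis using h g[OF vs_V[OF h(2)]] g[OF vs_V[OF h(3)]] by auto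
  qed
  show ?thesis unfolding joined_def using 1 2 3 by blast
qed

lemma wrs_blocks: "wrs blocks_rc = {''i'', ''j'', ''lk'', ''bu'', ''bv'', ''h'', ''blk''}"
  unfolding blocks_rc_def wrs.simps wrs_union by auto

definition blocked :: "nat \<Rightarrow> (nat \<Rightarrow> nat) \<Rightarrow> bool" where
  "blocked q f \<longleftrightarrow> (\<forall>v\<in>V. f v \<in> V) \<and> (\<forall>u\<in>V. \<forall>v\<in>V. f u = f v \<longleftrightarrow> (u, v) \<in> (links G q)\<^sup>*)"

lemma base1_setreg: "base1 q s \<Longrightarrow> y \<notin> {''in'', ''len'', ''A'', ''q'', ''dg''} \<Longrightarrow> base1 q (setreg s y v)"
  using base1_cong[of q s "setreg s y v"] by auto

lemma sem_blocks:
  assumes s: "base1 q s"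
  shows "base1 q (sem blocks_rc s)" "blocked q (sem blocks_rc s ''blk'')"
proof -
  show "base1 q (sem blocks_rc s)"
    by (rule base1_cong[OF s]; rule sem_frame; simp add: wrs_blocks)
  define s0 where "s0 = sem (For ''i'' ''A'' (Asg ''blk'' (vx (rg ''i'')) (vx (rg ''i'')))) s"
  have s0: "base1 q s0"
    unfolding s0_def by (rule base1_cong[OF s]; rule sem_frame; simp)
  have blk0: "s0 ''blk'' v = v" if "v \<in> V" for v
  proof -
    have "s0 ''blk'' v = (\<lambda>x _. x) v (s ''blk'' v)"
      unfolding s0_def
    proof (rule sem_For_vx[OF base1_base[OF s]])
      fix s' j assume "\<And>z. z \<noteq> ''blk'' \<Longrightarrow> z \<noteq> ''i'' \<Longrightarrow> s' z = s z"
      then have "s' ''in'' = s ''in''" by simp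
      then show "ev (vx (rg ''i'')) (setreg s' ''i'' j) = s ''in'' (3 + j)" by simp
    qed (use that in auto)
    then show ?thesis by simp
  qed
  define P where "P i s' \<longleftrightarrow> base1 q s' \<and> joined q {(a, b). a < i \<and> b < A} (s' ''blk'')" for i s'
  have "P (s0 ''A'' 0) (fold (\<lambda>i s. sem (For ''j'' ''A'' union_rc) (setreg s ''i'' i)) [0..<s0 ''A'' 0] s0)"
  proof (rule fold_upt_induct[where P = P])
    show "P 0 s0" using s0 blk0 by (auto simp: P_def joined_def)
    fix i s1 assume P: "P i s1"
    define s2 where "s2 = setreg s1 ''i'' i"
    define Q where "Q j s' \<longleftrightarrow> base1 q s' \<and> s' ''i'' 0 = i \<and>
      joined q ({(a, b). a < i \<and> b < A} \<union> {(i, b) |b. b < j}) (s' ''blk'')" for j s'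
    have s2: "base1 q s2" unfolding s2_def using P by (intro base1_setreg) (auto simp: P_def)
    have "Q (s2 ''A'' 0) (fold (\<lambda>j s. sem union_rc (setreg s ''j'' j)) [0..<s2 ''A'' 0] s2)"
    proof (rule fold_upt_induct[where P = Q])
      show "Q 0 s2" using s2 P by (simp add: Q_def P_def s2_def)
      fix j s3 assume Q: "Q j s3"
      define s4 where "s4 = setreg s3 ''j'' j"
      have s4: "base1 q s4" "s4 ''i'' 0 = i" "s4 ''j'' 0 = j" "s4 ''blk'' = s3 ''blk''"
        using Q base1_setreg[of q s3 "''j''" j] by (auto simp: Q_def s4_def)
      have "joined q (insert (i, j) ({(a, b). a < i \<and> b < A} \<union> {(i, b) |b. b < j})) (sem union_rc s4 ''blk'')"
        using joined_union[OF s4(1)] Q s4(2-4) by (simp add: Q_def)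
      moreover have "insert (i, j) ({(a, b). a < i \<and> b < A} \<union> {(i, b) |b. b < j}) =
          {(a, b). a < i \<and> b < A} \<union> {(i, b) |b. b < Suc j}" by (auto simp: less_Suc_eq)
      moreover have "base1 q (sem union_rc s4)"
        by (rule base1_cong[OF s4(1)]; rule sem_frame; simp add: wrs_union)
      moreover have "sem union_rc s4 ''i'' = s4 ''i''" by (rule sem_frame) (simp add: wrs_union)
      ultimately show "Q (Suc j) (sem union_rc (setreg s3 ''j'' j))"
        using s4 by (simp add: Q_def s4_def[symmetric])
    qed
    moreover have "s2 ''A'' 0 = A" using base_A[OF base1_base[OF s2]] .
    moreover have "{(a, b). a < i \<and> b < A} \<union> {(i, b) |b. b < A} = {(a, b). a < Suc i \<and> b < A}"
      by (auto simp: less_Suc_eq)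
    ultimately show "P (Suc i) (sem (For ''j'' ''A'' union_rc) (setreg s1 ''i'' i))"
      by (simp add: P_def Q_def s2_def[symmetric])
  qed
  moreover have "s0 ''A'' 0 = A" using base_A[OF base1_base[OF s0]] .
  moreover have "sem blocks_rc s = sem (For ''i'' ''A'' (For ''j'' ''A'' union_rc)) s0"
    by (simp add: blocks_rc_def s0_def)
  ultimately have J: "joined q {(a, b). a < A \<and> b < A} (sem blocks_rc s ''blk'')"
    by (simp add: P_def)
  let ?f = "sem blocks_rc s ''blk''"
  have l: "?f u = ?f v" if "(u, v) \<in> links G q" for u v
  proof -
    have "u \<in> V" "v \<in> V" using that by (auto simp: links_def)
    then obtain i j where "i < n" "j < n" "u = vs ! i" "v = vs ! j" using ex_vs by metis
    moreover have "n < A" using A by simp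
    ultimately show ?thesis using J that unfolding joined_def by auto
  qed
  have "?f u = ?f v" if "(u, v) \<in> (links G q)\<^sup>*" for u v
    using that by (induction rule: rtrancl_induct) (auto dest: l)
  then show "blocked q ?f" using J unfolding blocked_def joined_def by blast
qed

definition okq :: "nat \<Rightarrow> bool" where
  "okq q \<longleftrightarrow> (\<forall>v\<in>V. card {u. (v, u) \<in> (links G q)\<^sup>*} \<le> (q + 2) ^ 3)"

lemma links_star_V: "(v, u) \<in> (links G q)\<^sup>* \<Longrightarrow> v \<in> V \<Longrightarrow> u \<in> V"
  by (induction rule: rtrancl_induct) (auto simp: links_def)

lemma block_card:
  assumes "blocked q f" "v \<in> V"
  shows "{u\<in>V. f u = f v} = {u. (v, u) \<in> (links G q)\<^sup>*}"
  using assms links_star_V links_star_sym unfolding blocked_def by blast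

lemma okq_n: "okq n"
  unfolding okq_def
proof
  fix v assume "v \<in> V"
  then have "{u. (v, u) \<in> (links G n)\<^sup>*} \<subseteq> V" using links_star_V by blast
  then have "card {u. (v, u) \<in> (links G n)\<^sup>*} \<le> card V" using finite_V by (rule card_mono[rotated])
  also have "card V = n" using distinct_card[OF vs(1)] vs(2) by simp
  also have "n \<le> (n + 2) ^ 3" using self_le_power[of "n + 2" 3] by simp
  finally show "card {u. (v, u) \<in> (links G n)\<^sup>*} \<le> (n + 2) ^ 3" .
qed

lemma ev_cubeE:
  assumes "base s" "s ''q'' 0 + 2 \<le> A"
  shows "ev cubeE s = (s ''q'' 0 + 2) ^ 3"
proof -
  have "ev cubeE s = (\<Sum>a<A. if a < s ''q'' 0 + 2 then (\<Sum>b<A. if b < s ''q'' 0 + 2 then s ''q'' 0 + 2 else 0) else 0)"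
    using base_A[OF assms(1)] by (simp add: cubeE_def cong: if_cong)
  also have "\<dots> = (s ''q'' 0 + 2) * ((s ''q'' 0 + 2) * (s ''q'' 0 + 2))"
    using assms(2) unfolding sum_if_less by (simp only: min_absorb1)
  finally show ?thesis by (simp only: power3_eq_cube mult.assoc)
qed

lemma ev_badE:
  assumes s: "base1 q s" "q + 2 \<le> A" "blocked q (s ''blk'')"
  shows "ev badE s = 0 \<longleftrightarrow> okq q"
proof -
  have b: "base s" using s(1) by (rule base1_base)
  have q: "s ''q'' 0 = q" using s(1) by (simp add: base1_def)
  have cube: "ev cubeE (setreg s ''i'' i) = (q + 2) ^ 3" for i
    using ev_cubeE[of "setreg s ''i'' i"] b q s(2) by simp
  have cnt: "ev (sumV ''h'' (IfEq (R ''blk'' (vx (rg ''h''))) (R ''blk'' (vx (rg ''i''))) (N 1) (N 0))) (setreg s ''i'' i)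
      = card {u. (vs ! i, u) \<in> (links G q)\<^sup>*}" if i: "i < n" for i
  proof -
    have "ev (sumV ''h'' (IfEq (R ''blk'' (vx (rg ''h''))) (R ''blk'' (vx (rg ''i''))) (N 1) (N 0))) (setreg s ''i'' i)
      = (\<Sum>h<n. if s ''blk'' (vs ! h) = s ''blk'' (vs ! i) then 1 else 0)"
      using b base_vx[OF b] i by (simp add: ev_sumV cong: if_cong)
    also have "\<dots> = (\<Sum>u\<in>V. if s ''blk'' u = s ''blk'' (vs ! i) then 1 else 0)"
      by (rule sum_vs)
    also have "\<dots> = card {u\<in>V. s ''blk'' u = s ''blk'' (vs ! i)}" by (rule sum_indicator[OF finite_V])
    also have "\<dots> = card {u. (vs ! i, u) \<in> (links G q)\<^sup>*}" using block_card[OF s(3) vs_V[OF i]] by simp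
    finally show ?thesis .
  qed
  have "ev badE s = (\<Sum>i<n. if (q + 2) ^ 3 < card {u. (vs ! i, u) \<in> (links G q)\<^sup>*} then 1 else 0)"
  proof -
    have "ev badE s = (\<Sum>i<n. ev (IfLt cubeE (sumV ''h''
        (IfEq (R ''blk'' (vx (rg ''h''))) (R ''blk'' (vx (rg ''i''))) (N 1) (N 0))) (N 1) (N 0)) (setreg s ''i'' i))"
      unfolding badE_def by (rule ev_sumV[OF b]) simp_all
    also have "\<dots> = (\<Sum>i<n. if (q + 2) ^ 3 < card {u. (vs ! i, u) \<in> (links G q)\<^sup>*} then 1 else 0)"
      by (rule sum.cong[OF refl]) (simp only: ev.simps(1,5) cube cnt lessThan_iff)
    finally show ?thesis .
  qed
  also have "\<dots> = (\<Sum>v\<in>V. if (q + 2) ^ 3 < card {u. (v, u) \<in> (links G q)\<^sup>*} then 1 else 0)"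
    by (rule sum_vs)
  finally have eq: "ev badE s = \<dots>" .
  show ?thesis unfolding eq okq_def sum_eq_0_iff[OF finite_V] by (rule ball_cong[OF refl]) (simp add: not_less)
qed

lemma wrs_search: "wrs search_rc = {''i'', ''j'', ''lk'', ''bu'', ''bv'', ''h'', ''blk'', ''t'', ''q''}"
  unfolding search_rc_def wrs.simps wrs_blocks by auto

lemma sem_search:
  assumes s: "base1 0 s"
  shows "\<exists>q. base1 q (sem search_rc s) \<and> okq q \<and> (\<forall>q'<q. \<not> okq q') \<and> blocked q (sem search_rc s ''blk'')"
proof -
  \<comment> \<open>Either an acceptable \<open>q\<close> is found, or every round so far has raised
    \<open>q\<close> by one, so that \<open>q = t\<close>. The second case cannot last to round
    \<open>A\<close>, because \<open>okq n\<close> holds and \<open>n < A\<close>.\<close>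
  define P where "P t s' \<longleftrightarrow> (\<exists>q. base1 q s' \<and> (\<forall>q'<q. \<not> okq q') \<and> (okq q \<and> blocked q (s' ''blk'') \<or> q = t))" for t s'
  let ?c = "blocks_rc ;; Asg ''q'' (N 0) (IfEq badE (N 0) (rg ''q'') (Add (rg ''q'') (N 1)))"
  have "P (s ''A'' 0) (fold (\<lambda>i s. sem ?c (setreg s ''t'' i)) [0..<s ''A'' 0] s)"
  proof (rule fold_upt_induct[where P = P])
    show "P 0 s" using s by (auto simp: P_def)
    fix t s1 assume "P t s1"
    then obtain q where q: "base1 q s1" "\<forall>q'<q. \<not> okq q'" "okq q \<and> blocked q (s1 ''blk'') \<or> q = t"
      unfolding P_def by blast
    have "q \<le> n" using q(2) okq_n by (meson not_less)
    then have qA: "q + 2 \<le> A" using A by simp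
    define s2 where "s2 = sem blocks_rc (setreg s1 ''t'' t)"
    have "base1 q (setreg s1 ''t'' t)" using q(1) by (rule base1_setreg) simp
    from sem_blocks[OF this] have s2: "base1 q s2" "blocked q (s2 ''blk'')" by (simp_all add: s2_def)
    define s3 where "s3 = sem ?c (setreg s1 ''t'' t)"
    have s3: "s3 = setreg s2 ''q'' (if okq q then q else Suc q)"
      using ev_badE[OF s2(1) qA s2(2)] s2(1) by (simp add: s3_def s2_def[symmetric] base1_def)
    have b3: "base1 (if okq q then q else Suc q) s3" using s2(1) unfolding s3 base1_def by simp
    have blk3: "s3 ''blk'' = s2 ''blk''" unfolding s3 by simp
    have "P (Suc t) s3"
    proof (cases "okq q")
      case True
      then show ?thesis using b3 blk3 s2(2) q(2) unfolding P_def by auto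
    next
      case False
      then have "q = t" using q(3) by blast
      moreover have "\<forall>q'<Suc q. \<not> okq q'" using False q(2) by (simp add: less_Suc_eq)
      ultimately show ?thesis using b3 False unfolding P_def by auto
    qed
    then show "P (Suc t) (sem ?c (setreg s1 ''t'' t))" by (simp only: s3_def)
  qed
  then have "P A (sem search_rc s)" using base_A[OF base1_base[OF s]] by (simp add: search_rc_def)
  then obtain q where q: "base1 q (sem search_rc s)" "\<forall>q'<q. \<not> okq q'" "okq q \<and> blocked q (sem search_rc s ''blk'') \<or> q = A"
    unfolding P_def by blast
  have "q \<noteq> A" using q(2) okq_n A by auto
  then show ?thesis using q by blast
qed

end

section \<open>Configurations on the machine\<close>

definition f4 :: "ex \<Rightarrow> nat \<Rightarrow> ex" where
  "f4 e r = Add (Add (Add e e) (Add e e)) (N r)"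

definition dX :: "ex \<Rightarrow> ex \<Rightarrow> ex" where
  "dX c i = digE ''X'' ''pX'' c i"

definition srcE :: ex where "srcE = dX (rg ''cc'') (f4 (rg ''ct'') 0)"
definition dstE :: ex where "dstE = dX (rg ''cc'') (f4 (rg ''ct'') 1)"
definition keptE :: ex where "keptE = dX (rg ''cc'') (f4 (rg ''ct'') 2)"
definition levE :: "string \<Rightarrow> ex" where
  "levE l = dX (IfLt (rg ''y'') (rg l) (rg ''zz'') (rg ''cc'')) (f4 (rg l) 3)"

definition arcE :: "ex \<Rightarrow> ex" where
  "arcE e = SumE ''X'' ''ct'' (LetE ''ls'' srcE (LetE ''ld'' dstE (LetE ''lk'' keptE
     (LetE ''l1'' (levE ''ls'') (LetE ''l2'' (levE ''ld'') e)))))"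

definition costE :: ex where
  "costE = arcE (IfEq (rg ''ls'') (N 0) (N 0) (IfEq (rg ''lk'') (N 0) (N 1) (N 0)))"

definition uncleanE :: ex where
  "uncleanE = arcE (IfEq (rg ''lk'') (N 0) (N 0) (N 1))"

definition descE :: ex where
  "descE = arcE (IfEq (rg ''ls'') (N 0) (N 0) (IfEq (rg ''lk'') (N 0) (N 0)
     (IfLt (rg ''l2'') (rg ''l1'') (N 1) (N 0))))"

definition outE :: ex where
  "outE = arcE (IfEq (rg ''ls'') (rg ''ll'') (IfEq (rg ''lk'') (N 0) (N 0)
     (IfEq (rg ''l1'') (rg ''l2'') (N 1) (N 0))) (N 0))"

definition inE :: ex where
  "inE = arcE (IfEq (rg ''ld'') (rg ''ll'') (IfEq (rg ''lk'') (N 0) (N 0)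
     (IfEq (rg ''l1'') (rg ''l2'') (N 1) (N 0))) (N 0))"

definition atE :: "ex \<Rightarrow> ex" where
  "atE v = sumA ''tj'' (IfEq (R ''eb'' (rg ''tj'')) (rg ''bb'') (IfEq (R ''es'' (rg ''tj'')) (rg ''ct'')
     (R ''ln'' v) (N 0)) (N 0))"

text \<open>Conditions are tested by counting violations: the sum is 0 exactly if none occurs, and
  adding such counts expresses a conjunction.\<close>

definition mismatchE :: ex where
  "mismatchE = SumE ''X'' ''ct'' (IfEq srcE (atE (tle (rg ''tj'')))
     (IfEq dstE (atE (hde (rg ''tj''))) (N 0) (N 1)) (N 1))"

definition badcodeE :: ex where
  "badcodeE = Add descE (SumE ''y'' ''lq'' (LetE ''ll'' (Add (rg ''lq'') (N 1)) (IfEq outE inE (N 0) (N 1))))"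

text \<open>Numbers cannot be negative, so instead of adding up imbalances the totals of outgoing
  and incoming arcs are compared for each hub name.\<close>

definition invalidE :: ex where
  "invalidE = Add
     (sumV ''vi'' (LetE ''bb'' (vx (rg ''vi'')) (LetE ''cc'' (R ''cg'' (rg ''bb'')) (Add mismatchE badcodeE))))
     (SumE ''X'' ''ll'' (IfLt (rg ''y'') (rg ''ll'')
       (IfEq (sumV ''vi'' (LetE ''cc'' (R ''cg'' (vx (rg ''vi''))) outE))
          (sumV ''vi'' (LetE ''cc'' (R ''cg'' (vx (rg ''vi''))) inE)) (N 0) (N 1)) (N 0)))"

definition costsE :: "string \<Rightarrow> ex" where
  "costsE a = sumV ''vi'' (LetE ''cc'' (R a (vx (rg ''vi''))) costE)"

text \<open>The least code that fits the block and keeps no arc equals the number of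
  \<open>c1\<close> up to which there is no such code; \<open>least_as_count\<close> justifies
  this.\<close>

definition initE :: ex where
  "initE = SumE ''Z'' ''c1'' (IfEq (SumE ''Z'' ''cc'' (IfLt (rg ''c1'') (rg ''cc'') (N 0)
     (IfEq (Add mismatchE uncleanE) (N 0) (N 1) (N 0)))) (N 0) (N 1) (N 0))"

section \<open>Concrete names, slots and bounds\<close>

text \<open>The numbers as the program derives them from the \<open>q\<close> it has found:
  \<open>W\<close> is the number of codes, \<open>g\<close> the length of a list of moves, and
  \<open>Z\<close> the number of such lists.\<close>

locale solver_run = instance_word +
  fixes q y X W g Z :: nat and blk :: "nat \<Rightarrow> nat"
  assumes blocked: "blocked q blk" and okq: "okq q"
    and y: "y = (q + 2) ^ 3" and X: "X = slots y" and W: "W = X ^ (4 * X)"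
    and g: "g = (6 * X) ^ (2 ^ X)" and Z: "Z = W ^ (2 * g)"
begin

abbreviation "M \<equiv> hubs G q"

text \<open>Ranks by size inside the block, so that names can be computed by counting; the shift by
  \<open>y\<close> separates the hubs from all other vertices.\<close>

definition ln :: "nat \<Rightarrow> nat" where
  "ln v = 1 + (if v \<in> M then y else 0) + card {u\<in>V. blk u = blk v \<and> u < v}"

definition eb :: "nat \<Rightarrow> nat" where
  "eb j = (if fst (es ! j) \<in> M then blk (snd (es ! j)) else blk (fst (es ! j)))"

definition sl :: "nat \<Rightarrow> nat" where
  "sl j = card {i\<in>{..<j}. eb i = eb j}"

lemma blk_eq: "u \<in> V \<Longrightarrow> v \<in> V \<Longrightarrow> blk u = blk v \<longleftrightarrow> (u, v) \<in> (links G q)\<^sup>*"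
  using blocked unfolding blocked_def by blast

lemma M_V: "M \<subseteq> V"
  by (auto simp: hubs_def)

lemma links_M: "(u, v) \<in> (links G q)\<^sup>* \<Longrightarrow> u \<in> M \<Longrightarrow> v \<in> M"
  by (induction rule: rtrancl_induct) (auto simp: links_def split: if_splits)

lemma blk_hub:
  assumes "u \<in> M" "v \<in> V"
  shows "blk v = blk u \<longleftrightarrow> v \<in> M"
proof
  assume "blk v = blk u"
  then have "(u, v) \<in> (links G q)\<^sup>*" using blk_eq assms M_V by (metis subsetD)
  then show "v \<in> M" using links_M assms(1) by blast
next
  assume "v \<in> M"
  then have "(v, u) \<in> links G q" using assms M_V by (auto simp: links_def)
  then show "blk v = blk u" using blk_eq[of v u] assms M_V by blast
qed

lemma arcs_V: "(u, v) \<in> parcs G \<Longrightarrow> u \<in> V \<and> v \<in> V"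
proof -
  interpret pair_digraph G by (rule G)
  show "(u, v) \<in> parcs G \<Longrightarrow> u \<in> V \<and> v \<in> V" using in_arcsD1 in_arcsD2 by blast
qed

lemma class_card: "v \<in> V \<Longrightarrow> card {u\<in>V. blk u = blk v} \<le> y"
  using block_card[OF blocked] okq y unfolding okq_def by simp

lemma below_card: "v \<in> V \<Longrightarrow> card {u\<in>V. blk u = blk v \<and> u < v} < y"
proof -
  assume v: "v \<in> V"
  have "{u\<in>V. blk u = blk v \<and> u < v} \<subset> {u\<in>V. blk u = blk v}" using v by blast
  then have "card {u\<in>V. blk u = blk v \<and> u < v} < card {u\<in>V. blk u = blk v}"
    using finite_V by (intro psubset_card_mono) auto
  then show ?thesis using class_card[OF v] by simp
qed

lemma rep_block:
  assumes "j < m"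
  obtains r where "r \<in> V" "eb j = blk r" "r \<in> {fst (es ! j), snd (es ! j)}"
    "r \<in> M \<Longrightarrow> es ! j \<in> M \<times> M"
proof -
  have "fst (es ! j) \<in> V" "snd (es ! j) \<in> V" using es_parcs[OF assms] arcs_V by (metis prod.collapse)+
  then show thesis
    using that[of "snd (es ! j)"] that[of "fst (es ! j)"]
    by (cases "fst (es ! j) \<in> M") (simp_all add: eb_def mem_Times_iff)
qed

text \<open>Arcs of the hub block join hubs, and there are at most \<open>y\<close> of these. Every
  arc of another block has an end in the block that is no hub; there are at most \<open>y\<close>
  such vertices, each of degree at most \<open>q <= y\<close>. This is where defining hubs by degree
  pays off.\<close>

lemma block_arcs_card:
  assumes "j < m"
  shows "card {i\<in>{..<m}. eb i = eb j} \<le> y * y"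
proof -
  obtain r where r: "r \<in> V" "eb j = blk r" using rep_block[OF assms] by metis
  have fin: "finite M" using M_V finite_V finite_subset by blast
  have inj: "inj_on ((!) es) {..<m}" by (rule inj_on_nth[OF es(1)]) simp
  let ?I = "{i\<in>{..<m}. eb i = eb j}"
  have card: "card ?I = card ((!) es ` ?I)"
    by (rule card_image[symmetric], rule inj_on_subset[OF inj]) auto
  show ?thesis
  proof (cases "r \<in> M")
    case True
    have "(!) es ` ?I \<subseteq> M \<times> M"
    proof (rule image_subsetI)
      fix i assume i: "i \<in> ?I"
      then obtain x where x: "x \<in> V" "eb i = blk x" "x \<in> M \<Longrightarrow> es ! i \<in> M \<times> M"
        using rep_block[of i] by (metis (no_types, lifting) lessThan_iff mem_Collect_eq)
      then have "blk x = blk r" using i r by simp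
      then show "es ! i \<in> M \<times> M" using x blk_hub[OF True x(1)] by blast
    qed
    then have "card ?I \<le> card (M \<times> M)" unfolding card using fin by (intro card_mono) auto
    also have "\<dots> = card M * card M" by (rule card_cartesian_product)
    also have "card M \<le> y"
    proof -
      have "M = {u\<in>V. blk u = blk r}" using blk_hub[OF True] M_V by blast
      then show ?thesis using class_card[OF r(1)] by simp
    qed
    then have "card M * card M \<le> y * y" by (intro mult_le_mono)
    finally show ?thesis .
  next
    case False
    have "(!) es ` ?I \<subseteq> (\<Union>x\<in>{u\<in>V. blk u = blk r}. {e\<in>parcs G. fst e = x \<or> snd e = x})"
    proof (rule image_subsetI)
      fix i assume i: "i \<in> ?I"
      then obtain x where x: "x \<in> V" "eb i = blk x" "x \<in> {fst (es ! i), snd (es ! i)}"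
        using rep_block[of i] by (metis (no_types, lifting) lessThan_iff mem_Collect_eq)
      then show "es ! i \<in> (\<Union>x\<in>{u\<in>V. blk u = blk r}. {e\<in>parcs G. fst e = x \<or> snd e = x})"
        using i r es_parcs[of i] by auto
    qed
    then have "card ?I \<le> card (\<Union>x\<in>{u\<in>V. blk u = blk r}. {e\<in>parcs G. fst e = x \<or> snd e = x})"
      unfolding card using finite_V finite_parcs by (intro card_mono) auto
    also have "\<dots> \<le> (\<Sum>x\<in>{u\<in>V. blk u = blk r}. card {e\<in>parcs G. fst e = x \<or> snd e = x})"
      using finite_V by (intro card_UN_le) auto
    also have "\<dots> \<le> (\<Sum>x\<in>{u\<in>V. blk u = blk r}. y)"
    proof (rule sum_mono)
      fix x assume x: "x \<in> {u\<in>V. blk u = blk r}"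
      have "x \<notin> M" using x blk_hub[of x r] False r(1) by auto
      then have "arc_degree G x \<le> q" using x by (auto simp: hubs_def)
      also have "q \<le> y" unfolding y using self_le_power[of "q + 2" 3] by simp
      finally show "card {e\<in>parcs G. fst e = x \<or> snd e = x} \<le> y" by (simp add: arc_degree_def)
    qed
    also have "\<dots> = card {u\<in>V. blk u = blk r} * y" by simp
    also have "\<dots> \<le> y * y" using class_card[OF r(1)] by (rule mult_le_mono1)
    finally show ?thesis .
  qed
qed

sublocale block_structure V M es blk ln eb sl y X
proof
  show "X = slots y" by (rule X)
  show "finite V" by (rule finite_V)
  show "M \<subseteq> V" by (rule M_V)
  show "distinct es" by (rule es(1))
  show "set es \<subseteq> V \<times> V" using es(2) arcs_V by auto
  show "blk v \<in> V" if "v \<in> V" for v using that blocked unfolding blocked_def by blast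
  show "eb j = (if fst (es ! j) \<in> M then blk (snd (es ! j)) else blk (fst (es ! j)))" for j by (rule eb_def)
  show "blk u = blk v" if "(u, v) \<in> set es" "u \<notin> M" "v \<notin> M" for u v
  proof -
    have "(u, v) \<in> parcs G" using that(1) es(2) by simp
    then have "(u, v) \<in> links G q" "u \<in> V" "v \<in> V" using that arcs_V by (auto simp: links_def)
    then show ?thesis using blk_eq by blast
  qed
  show "blk v = blk u \<longleftrightarrow> v \<in> M" if "u \<in> M" "v \<in> V" for u v using that by (rule blk_hub)
  show "u = v" if "u \<in> V" "v \<in> V" "blk u = blk v" "ln u = ln v" for u v
  proof (rule ccontr)
    assume ne: "u \<noteq> v"
    have lt: "ln u < ln v" if h: "u \<in> V" "v \<in> V" "blk u = blk v" "u < v" for u v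
    proof -
      have "u \<in> M \<longleftrightarrow> v \<in> M" using blk_hub[of u v] blk_hub[of v u] h by auto
      moreover have "{x\<in>V. blk x = blk u \<and> x < u} \<subset> {x\<in>V. blk x = blk v \<and> x < v}" using h by auto
      then have "card {x\<in>V. blk x = blk u \<and> x < u} < card {x\<in>V. blk x = blk v \<and> x < v}"
        using finite_V by (intro psubset_card_mono) auto
      ultimately show ?thesis by (simp add: ln_def)
    qed
    then show False using ne that by (metis linorder_neqE_nat less_irrefl)
  qed
  show "1 \<le> ln v" for v by (simp add: ln_def)
  show "ln v \<le> 2 * y" if "v \<in> V" for v using below_card[OF that] by (simp add: ln_def)
  show "y < ln v \<longleftrightarrow> v \<in> M" if "v \<in> V" for v using below_card[OF that] by (auto simp: ln_def)
  show "card {w\<in>V. blk w = blk v} \<le> y" if "v \<in> V" for v using that by (rule class_card)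
  show "i = j" if "i < m" "j < m" "eb i = eb j" "sl i = sl j" for i j
  proof (rule ccontr)
    assume ne: "i \<noteq> j"
    have lt: "sl i < sl j" if h: "eb i = eb j" "i < j" for i j
    proof -
      have "{x\<in>{..<i}. eb x = eb i} \<subset> {x\<in>{..<j}. eb x = eb j}" using h by auto
      then show ?thesis unfolding sl_def by (intro psubset_card_mono) auto
    qed
    then show False using ne that by (metis linorder_neqE_nat less_irrefl)
  qed
  show "sl j < X" if "j < m" for j
  proof -
    have "sl j \<le> card {i\<in>{..<m}. eb i = eb j}" unfolding sl_def using that by (intro card_mono) auto
    also have "\<dots> \<le> y * y" by (rule block_arcs_card[OF that])
    also have "\<dots> < X" by (simp add: X slots_def power2_eq_square)
    finally show ?thesis .
  qed
qed

definition base3 :: "store \<Rightarrow> bool" where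
  "base3 s \<longleftrightarrow> base s \<and> s ''X'' 0 = X \<and> s ''y'' 0 = y \<and> s ''W'' 0 = W \<and> s ''G'' 0 = g \<and> s ''Z'' 0 = Z \<and>
     (\<forall>v\<in>V. s ''ln'' v = ln v) \<and> (\<forall>j<m. s ''eb'' j = eb j \<and> s ''es'' j = sl j) \<and>
     (\<forall>i\<le>Z. s ''pX'' i = X ^ i \<and> s ''pW'' i = W ^ i)"

text \<open>The commands of the solver write to none of these arrays, so \<open>base3\<close>
  survives all of them.\<close>

definition names3 :: "string set" where
  "names3 = {''in'', ''len'', ''A'', ''X'', ''y'', ''W'', ''G'', ''Z'', ''ln'', ''eb'', ''es'', ''pX'', ''pW''}"

lemma base3_cong:
  assumes "base3 s" "\<And>z. z \<in> names3 \<Longrightarrow> s' z = s z"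
  shows "base3 s'"
proof -
  have "s' ''in'' = s ''in''" "s' ''len'' = s ''len''" "s' ''A'' = s ''A''" "s' ''X'' = s ''X''" "s' ''y'' = s ''y''"
    "s' ''W'' = s ''W''" "s' ''G'' = s ''G''" "s' ''Z'' = s ''Z''" "s' ''ln'' = s ''ln''" "s' ''eb'' = s ''eb''"
    "s' ''es'' = s ''es''" "s' ''pX'' = s ''pX''" "s' ''pW'' = s ''pW''"
    using assms(2) unfolding names3_def by blast+
  then show ?thesis using assms(1) base_cong[of s' s] unfolding base3_def by simp
qed

lemma base3_upd [simp]: "z \<notin> names3 \<Longrightarrow> base3 (s(z := f)) = base3 s"
  using base3_cong[of s "s(z := f)"] base3_cong[of "s(z := f)" s] by (metis fun_upd_other)

lemma names3 [simp]:
  "(z \<in> names3) = (z \<in> {''in'', ''len'', ''A'', ''X'', ''y'', ''W'', ''G'', ''Z'', ''ln'', ''eb'', ''es'', ''pX'', ''pW''})"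
  by (simp add: names3_def)

lemma base3D:
  assumes "base3 s"
  shows "base s" "s ''X'' 0 = X" "s ''y'' 0 = y" "s ''W'' 0 = W" "s ''G'' 0 = g" "s ''Z'' 0 = Z"
    "v \<in> V \<Longrightarrow> s ''ln'' v = ln v" "j < m \<Longrightarrow> s ''eb'' j = eb j" "j < m \<Longrightarrow> s ''es'' j = sl j"
    "i \<le> Z \<Longrightarrow> s ''pX'' i = X ^ i" "i \<le> Z \<Longrightarrow> s ''pW'' i = W ^ i"
  using assms by (simp_all add: base3_def)

lemma W_pos: "0 < W" "1 < W"
proof -
  show "1 < W" unfolding W using X_large by (intro one_less_power) auto
  then show "0 < W" by simp
qed

lemma g_pos: "1 \<le> g"
  unfolding g using X_large by (intro one_le_power) simp

text \<open>Division is correct for dividends up to \<open>Z\<close>, and the tables of powers reach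
  to exponent \<open>Z\<close>; these bounds cover the codes and the digit positions in base
  \<open>X\<close> and in base \<open>W\<close>.\<close>

lemma Z_large: "W \<le> Z" "4 * X + 3 \<le> Z" "2 * g \<le> Z" "g \<le> Z"
proof -
  have "W ^ 2 \<le> Z" unfolding Z using W_pos g_pos by (intro power_increasing) auto
  moreover have "W ^ 2 = W * W" by (rule power2_eq_square)
  moreover have "W \<le> W * W" by simp
  ultimately show "W \<le> Z" by linarith
  have "4 * X < X ^ (4 * X)" using X_large by (intro power_gt_expt) simp
  then have "4 * X + 1 \<le> W" by (simp add: W)
  then have "(4 * X + 1) * (4 * X + 1) \<le> W * W" by (intro mult_le_mono)
  moreover have "4 * X + 3 \<le> (4 * X + 1) * (4 * X + 1)" using X_large by simp
  ultimately show "4 * X + 3 \<le> Z" using \<open>W ^ 2 \<le> Z\<close> \<open>W ^ 2 = W * W\<close> by linarith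
  have "2 * g < W ^ (2 * g)" using W_pos by (intro power_gt_expt) simp
  then show "2 * g \<le> Z" "g \<le> Z" by (simp_all add: Z)
qed

lemma ev_f4: "ev (f4 e r) s = 4 * ev e s + r"
  by (simp add: f4_def)

lemma ev_dX:
  assumes "base3 s" "ev c s \<le> Z" "ev i s \<le> Z" "ev i (setreg s ''da'' (ev c s)) = ev i s"
  shows "ev (dX c i) s = dig X (ev c s) (ev i s)"
proof -
  have "ev (digE ''X'' ''pX'' c i) s = dig (s ''X'' 0) (ev c s) (ev i s)"
    by (rule ev_digE) (use assms base3D[OF assms(1)] X_large in auto)
  then show ?thesis using base3D(2)[OF assms(1)] by (simp add: dX_def)
qed

lemma ev_srcs:
  assumes "base3 s" "s ''cc'' 0 \<le> Z" "s ''ct'' 0 < X"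
  shows "ev srcE s = src X (s ''cc'' 0) (s ''ct'' 0)"
    "ev dstE s = dst X (s ''cc'' 0) (s ''ct'' 0)"
    "ev keptE s = kept X (s ''cc'' 0) (s ''ct'' 0)"
  using assms Z_large unfolding srcE_def dstE_def keptE_def src_def dst_def kept_def
  by (simp_all add: ev_dX ev_f4)

lemma ev_levE:
  assumes "base3 s" "s ''cc'' 0 \<le> Z" "s ''zz'' 0 \<le> Z" "s l 0 < X" "l \<noteq> ''da''"
  shows "ev (levE l) s = level X y (s ''zz'' 0) (s ''cc'' 0) (s l 0)"
  using assms Z_large base3D(3)[OF assms(1)] unfolding levE_def level_def
  by (simp add: ev_dX ev_f4)

lemma src_less: "src X c t < X" "dst X c t < X"
  using X_large by (simp_all add: src_def dst_def dig_less)

lemma ev_arcE: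
  assumes "base3 s" "s ''cc'' 0 \<le> Z" "s ''zz'' 0 \<le> Z"
  shows "ev (arcE e) s = (\<Sum>t<X. ev e (s(''ct'' := (s ''ct'')(0 := t), ''ls'' := (s ''ls'')(0 := src X (s ''cc'' 0) t),
     ''ld'' := (s ''ld'')(0 := dst X (s ''cc'' 0) t), ''lk'' := (s ''lk'')(0 := kept X (s ''cc'' 0) t),
     ''l1'' := (s ''l1'')(0 := level X y (s ''zz'' 0) (s ''cc'' 0) (src X (s ''cc'' 0) t)),
     ''l2'' := (s ''l2'')(0 := level X y (s ''zz'' 0) (s ''cc'' 0) (dst X (s ''cc'' 0) t)))))"
proof -
  have X0: "s ''X'' 0 = X" using base3D(2)[OF assms(1)] .
  show ?thesis
    unfolding arcE_def ev.simps(8) X0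
  proof (rule sum.cong[OF refl])
    fix t assume "t \<in> {..<X}"
    then show "ev (LetE ''ls'' srcE (LetE ''ld'' dstE (LetE ''lk'' keptE (LetE ''l1'' (levE ''ls'') (LetE ''l2'' (levE ''ld'') e)))))
        (setreg s ''ct'' t) =
      ev e (s(''ct'' := (s ''ct'')(0 := t), ''ls'' := (s ''ls'')(0 := src X (s ''cc'' 0) t),
     ''ld'' := (s ''ld'')(0 := dst X (s ''cc'' 0) t), ''lk'' := (s ''lk'')(0 := kept X (s ''cc'' 0) t),
     ''l1'' := (s ''l1'')(0 := level X y (s ''zz'' 0) (s ''cc'' 0) (src X (s ''cc'' 0) t)),
     ''l2'' := (s ''l2'')(0 := level X y (s ''zz'' 0) (s ''cc'' 0) (dst X (s ''cc'' 0) t))))"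
      using assms src_less by (simp add: ev_srcs ev_levE)
  qed
qed

context
  fixes s :: store
  assumes s: "base3 s" "s ''cc'' 0 \<le> Z" "s ''zz'' 0 \<le> Z"
begin

lemma ev_costE: "ev costE s = code_cost X (s ''cc'' 0)"
  unfolding costE_def ev_arcE[OF s] code_cost_def by (simp cong: if_cong)

lemma ev_uncleanE: "ev uncleanE s = 0 \<longleftrightarrow> (\<forall>t<X. kept X (s ''cc'' 0) t = 0)"
  unfolding uncleanE_def ev_arcE[OF s] by (auto simp: sum_eq_0_iff cong: if_cong split: if_splits)

lemma ev_descE: "ev descE s = descents X y (s ''zz'' 0) (s ''cc'' 0)"
  unfolding descE_def ev_arcE[OF s] descents_def by (simp cong: if_cong)

lemma ev_outE: "ev outE s = outs X y (s ''zz'' 0) (s ''cc'' 0) (s ''ll'' 0)"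
  unfolding outE_def ev_arcE[OF s] outs_def by (simp cong: if_cong)

lemma ev_inE: "ev inE s = ins X y (s ''zz'' 0) (s ''cc'' 0) (s ''ll'' 0)"
  unfolding inE_def ev_arcE[OF s] ins_def by (simp cong: if_cong)

end

lemma ev_atE:
  assumes s: "base3 s"
  shows "ev (atE (tle (rg ''tj''))) s = tail_at (s ''bb'' 0) (s ''ct'' 0)"
    "ev (atE (hde (rg ''tj''))) s = head_at (s ''bb'' 0) (s ''ct'' 0)"
proof -
  note b = base3D(1)[OF s]
  have ln: "s ''ln'' (fst (es ! j)) = ln (fst (es ! j))" "s ''ln'' (snd (es ! j)) = ln (snd (es ! j))" if "j < m" for j
    using base3D(7)[OF s] arc_V[OF that] by blast+
  have t: "ev (atE (tle (rg ''tj''))) s = (\<Sum>j<m. ev (IfEq (R ''eb'' (rg ''tj'')) (rg ''bb'') (IfEq (R ''es'' (rg ''tj'')) (rg ''ct'')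
     (R ''ln'' (tle (rg ''tj''))) (N 0)) (N 0)) (setreg s ''tj'' j))"
    unfolding atE_def by (rule ev_sumA[OF b]) simp_all
  also have "\<dots> = tail_at (s ''bb'' 0) (s ''ct'' 0)"
    unfolding tail_at_def
  proof (rule sum.cong[OF refl])
    fix j assume "j \<in> {..<m}"
    then have j: "j < m" by simp
    show "ev (IfEq (R ''eb'' (rg ''tj'')) (rg ''bb'') (IfEq (R ''es'' (rg ''tj'')) (rg ''ct'')
       (R ''ln'' (tle (rg ''tj''))) (N 0)) (N 0)) (setreg s ''tj'' j) =
       (if eb j = s ''bb'' 0 then if sl j = s ''ct'' 0 then ln (fst (es ! j)) else 0 else 0)"
      using base3D(8,9)[OF s j] base_tle[OF b j] base_n[OF b] ln[OF j] by (simp add: add.assoc)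
  qed
  finally show "ev (atE (tle (rg ''tj''))) s = tail_at (s ''bb'' 0) (s ''ct'' 0)" .
  have t: "ev (atE (hde (rg ''tj''))) s = (\<Sum>j<m. ev (IfEq (R ''eb'' (rg ''tj'')) (rg ''bb'') (IfEq (R ''es'' (rg ''tj'')) (rg ''ct'')
     (R ''ln'' (hde (rg ''tj''))) (N 0)) (N 0)) (setreg s ''tj'' j))"
    unfolding atE_def by (rule ev_sumA[OF b]) simp_all
  also have "\<dots> = head_at (s ''bb'' 0) (s ''ct'' 0)"
    unfolding head_at_def
  proof (rule sum.cong[OF refl])
    fix j assume "j \<in> {..<m}"
    then have j: "j < m" by simp
    show "ev (IfEq (R ''eb'' (rg ''tj'')) (rg ''bb'') (IfEq (R ''es'' (rg ''tj'')) (rg ''ct'')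
       (R ''ln'' (hde (rg ''tj''))) (N 0)) (N 0)) (setreg s ''tj'' j) =
       (if eb j = s ''bb'' 0 then if sl j = s ''ct'' 0 then ln (snd (es ! j)) else 0 else 0)"
      using base3D(8,9)[OF s j] base_tle[OF b j] base_n[OF b] ln[OF j] by (simp add: add.assoc)
  qed
  finally show "ev (atE (hde (rg ''tj''))) s = head_at (s ''bb'' 0) (s ''ct'' 0)" .
qed

lemma ev_mismatchE:
  assumes s: "base3 s" "s ''cc'' 0 \<le> Z"
  shows "ev mismatchE s = 0 \<longleftrightarrow> matches (s ''bb'' 0) (s ''cc'' 0)"
proof -
  have "ev mismatchE s = (\<Sum>t<X. if src X (s ''cc'' 0) t = tail_at (s ''bb'' 0) t
      then if dst X (s ''cc'' 0) t = head_at (s ''bb'' 0) t then 0 else 1 else 1)"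
    unfolding mismatchE_def ev.simps(8) base3D(2)[OF s(1)]
  proof (rule sum.cong[OF refl])
    fix t assume "t \<in> {..<X}"
    then show "ev (IfEq srcE (atE (tle (rg ''tj''))) (IfEq dstE (atE (hde (rg ''tj''))) (N 0) (N 1)) (N 1)) (setreg s ''ct'' t) =
      (if src X (s ''cc'' 0) t = tail_at (s ''bb'' 0) t
      then if dst X (s ''cc'' 0) t = head_at (s ''bb'' 0) t then 0 else 1 else 1)"
      using s ev_atE[of "setreg s ''ct'' t"] by (simp add: ev_srcs)
  qed
  then show ?thesis by (auto simp: matches_def sum_eq_0_iff)
qed

lemma ev_badcodeE:
  assumes s: "base3 s" "s ''cc'' 0 \<le> Z" "s ''zz'' 0 \<le> Z"
  shows "ev badcodeE s = 0 \<longleftrightarrow> code_ok X y (s ''zz'' 0) (s ''cc'' 0)"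
proof -
  have "ev badcodeE s = descents X y (s ''zz'' 0) (s ''cc'' 0) +
      (\<Sum>l<y. if outs X y (s ''zz'' 0) (s ''cc'' 0) (Suc l) = ins X y (s ''zz'' 0) (s ''cc'' 0) (Suc l) then 0 else 1)"
    unfolding badcodeE_def ev.simps(3,8) ev_descE[OF s] base3D(3)[OF s(1)]
    using s by (simp add: ev_outE ev_inE cong: if_cong)
  then show ?thesis by (auto simp: code_ok_def sum_eq_0_iff)
qed

end

section \<open>The main loop\<close>

text \<open>Exactly for the \<open>i\<close> below the least solution no \<open>j <= i\<close>
  satisfies \<open>P\<close>; counting them gives the least solution, or \<open>n\<close> if none
  lies below \<open>n\<close>.\<close>

lemma least_as_count:
  fixes P :: "nat \<Rightarrow> bool"
  shows "(\<Sum>i<n. if (\<Sum>j<n. if i < j then 0 else if P j then 1 else (0::nat)) = 0 then 1 else 0) =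
    (if \<exists>i<n. P i then LEAST i. P i else n)"
proof -
  have "(\<Sum>j<n. if i < j then 0 else if P j then 1 else (0::nat)) = 0 \<longleftrightarrow> (\<forall>j\<le>i. \<not> P j)" if "i < n" for i
    using that by (auto simp: sum_eq_0_iff) (meson not_le_imp_less)
  then have "(\<Sum>i<n. if (\<Sum>j<n. if i < j then 0 else if P j then 1 else (0::nat)) = 0 then 1 else 0) =
      (\<Sum>i<n. if \<forall>j\<le>i. \<not> P j then 1 else (0::nat))"
    by (intro sum.cong) auto
  also have "\<dots> = (if \<exists>i<n. P i then LEAST i. P i else n)"
  proof (cases "\<exists>i<n. P i")
    case True
    then obtain i where i: "i < n" "P i" by blast
    let ?l = "LEAST i. P i"
    have l: "P ?l" "?l \<le> i" using LeastI[of P i] Least_le[of P i] i(2) by blast+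
    have "(\<forall>j\<le>x. \<not> P j) \<longleftrightarrow> x < ?l" for x
      using l(1) not_less_Least[of _ P] by (meson le_less_trans not_less)
    then have "(\<Sum>i<n. if \<forall>j\<le>i. \<not> P j then 1 else (0::nat)) = (\<Sum>i<n. if i < ?l then 1 else 0)" by simp
    also have "\<dots> = min ?l n * 1" by (rule sum_if_less)
    finally show ?thesis using True l(2) i(1) by simp
  next
    case False
    then have "(\<Sum>i<n. if \<forall>j\<le>i. \<not> P j then 1 else (0::nat)) = (\<Sum>i<n. 1)"
      by (intro sum.cong) auto
    then show ?thesis using False by auto
  qed
  finally show ?thesis .
qed

text \<open>The form in which the program performs \<open>find\<close>: a least index, with the
  length of the list standing for failure.\<close>

lemma rewrite_first_least:
  "rewrite_first bs (c, d) f = (let i = if \<exists>i<length bs. f (bs ! i) = c then LEAST i. f (bs ! i) = c else length bs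
     in if i < length bs then f(bs ! i := d) else f)"
proof (cases "\<exists>i<length bs. f (bs ! i) = c")
  case True
  then obtain j where j: "j < length bs" "f (bs ! j) = c" by blast
  let ?P = "\<lambda>i. f (bs ! i) = c"
  let ?l = "LEAST i. ?P i"
  have l: "?P ?l" "?l \<le> j" using LeastI[of ?P j] Least_le[of ?P j] j(2) by blast+
  then have less: "?l < length bs" using j(1) by simp
  have "find (\<lambda>b. f b = c) bs = Some (bs ! ?l)"
    unfolding find_Some_iff
  proof (rule exI[of _ ?l], intro conjI allI impI)
    show "f (bs ! i) \<noteq> c" if "i < ?l" for i using not_less_Least[of i ?P] that by blast
  qed (use l(1) less in auto)
  moreover note less
  ultimately show ?thesis using True by (simp add: rewrite_first_def)
next
  case False
  then have "find (\<lambda>b. f b = c) bs = None" by (auto simp: find_None_iff in_set_conv_nth)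
  then show ?thesis using False by (auto simp: rewrite_first_def)
qed

lemma rewrite_first_cong:
  assumes "\<And>b. b \<in> set bs \<Longrightarrow> f b = f' b" "b \<in> set bs"
  shows "rewrite_first bs p f b = rewrite_first bs p f' b"
proof -
  have "find (\<lambda>b. f b = fst p) bs = find (\<lambda>b. f' b = fst p) bs"
    by (rule find_cong) (use assms(1) in auto)
  then show ?thesis using assms by (auto simp: rewrite_first_def split: option.split)
qed

lemma fold_rewrite_cong:
  assumes "\<And>b. b \<in> set bs \<Longrightarrow> f b = f' b" "b \<in> set bs"
  shows "fold (rewrite_first bs) ms f b = fold (rewrite_first bs) ms f' b"
  using assms
proof (induction ms arbitrary: f f')
  case (Cons p ms)
  have "fold (rewrite_first bs) ms (rewrite_first bs p f) b = fold (rewrite_first bs) ms (rewrite_first bs p f') b"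
  proof (rule Cons.IH)
    show "rewrite_first bs p f b = rewrite_first bs p f' b" if "b \<in> set bs" for b
      by (rule rewrite_first_cong[OF Cons.prems(1) that])
  qed (rule Cons.prems(2))
  then show ?case by simp
qed simp

lemma fold_rewrite_outside:
  assumes "b \<notin> set bs"
  shows "fold (rewrite_first bs) ms f b = f b"
proof (induction ms arbitrary: f)
  case (Cons p ms)
  have "rewrite_first bs p f b = f b"
    using assms by (auto simp: rewrite_first_def find_Some_iff split: option.split)
  then show ?case using Cons by simp
qed simp

definition posE :: ex where
  "posE = sumV ''vi'' (IfEq (sumV ''vh'' (IfLt (rg ''vi'') (rg ''vh'') (N 0)
     (IfEq (R ''cg'' (vx (rg ''vh''))) (rg ''old'') (N 1) (N 0)))) (N 0) (N 1) (N 0))"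

text \<open>There is no conditional command. If no block carries the old code, \<open>pos\<close> is
  the number of vertices, and the cell named by the next input entry is overwritten by its own
  value.\<close>

definition move_rc :: rc where
  "move_rc = Asg ''old'' (N 0) (digE ''W'' ''pW'' (rg ''w'') (Add (rg ''u'') (rg ''u''))) ;;
     Asg ''new'' (N 0) (digE ''W'' ''pW'' (rg ''w'') (Add (Add (rg ''u'') (rg ''u'')) (N 1))) ;;
     Asg ''pos'' (N 0) posE ;;
     Asg ''cg'' (vx (rg ''pos'')) (IfLt (rg ''pos'') nE (rg ''new'') (R ''cg'' (vx (rg ''pos''))))"

definition try_rc :: rc where
  "try_rc = For ''i'' ''A'' (Asg ''cg'' (vx (rg ''i'')) (R ''cf'' (vx (rg ''i'')))) ;;
     For ''u'' ''G'' move_rc ;;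
     Asg ''gd'' (N 0) (IfEq invalidE (N 0) (IfLt (costsE ''cg'') (costsE ''cf'') (N 1) (N 0)) (N 0)) ;;
     For ''i'' ''A'' (Asg ''cf'' (vx (rg ''i'')) (IfEq (rg ''gd'') (N 1) (R ''cg'' (vx (rg ''i''))) (R ''cf'' (vx (rg ''i'')))))"

definition search_codes_rc :: rc where
  "search_codes_rc = For ''i'' ''A'' (Asg ''cf'' (vx (rg ''i'')) (LetE ''bb'' (vx (rg ''i'')) initE)) ;;
     For ''r'' ''A'' (For ''w'' ''Z'' try_rc)"

text \<open>All possible codes \<open>zz\<close> for the hub levels are tried. Cell 0 of the input
  holds the sign, so a negative \<open>k\<close> is never accepted.\<close>

definition solve_rc :: rc where
  "solve_rc = For ''zz'' ''Z'' (search_codes_rc ;;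
     Asg ''out'' (N 0) (IfEq (rg ''out'') (N 1) (N 1) (IfEq (R ''in'' (N 0)) (N 0)
       (IfLt (R ''in'' (N 1)) (costsE ''cf'') (N 0) (N 1)) (N 0))))"

lemma wrs_move: "wrs move_rc = {''old'', ''new'', ''pos'', ''cg''}"
  by (auto simp: move_rc_def)

lemma wrs_try: "wrs try_rc = {''old'', ''new'', ''pos'', ''cg'', ''i'', ''u'', ''gd'', ''cf''}"
  unfolding try_rc_def wrs.simps wrs_move by auto

context solver_run
begin

definition cost :: "(nat \<Rightarrow> nat) \<Rightarrow> nat" where
  "cost f = (\<Sum>v\<in>V. code_cost X (f v))"

lemma cost_cong: "(\<And>v. v \<in> V \<Longrightarrow> f v = f' v) \<Longrightarrow> cost f = cost f'"
  by (simp add: cost_def)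

lemma valid_cong: "(\<And>v. v \<in> V \<Longrightarrow> f v = f' v) \<Longrightarrow> valid z f = valid z f'"
  by (simp add: valid_def valid_choice_def)

lemma ev_costsE:
  assumes s: "base3 s" "s ''zz'' 0 \<le> Z" "\<And>v. v \<in> V \<Longrightarrow> s a v \<le> Z" "a \<noteq> ''vi''"
  shows "ev (costsE a) s = cost (s a)"
proof -
  note b = base3D(1)[OF s(1)]
  have "ev (costsE a) s = (\<Sum>i<n. ev (LetE ''cc'' (R a (vx (rg ''vi''))) costE) (setreg s ''vi'' i))"
    unfolding costsE_def by (rule ev_sumV[OF b]) simp_all
  also have "\<dots> = (\<Sum>i<n. code_cost X (s a (vs ! i)))"
  proof (rule sum.cong[OF refl])
    fix i assume "i \<in> {..<n}"
    then have i: "i < n" by simp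
    show "ev (LetE ''cc'' (R a (vx (rg ''vi''))) costE) (setreg s ''vi'' i) = code_cost X (s a (vs ! i))"
      using s base_vx[OF b i] s(3)[OF vs_V[OF i]] by (simp add: ev_costE)
  qed
  also have "\<dots> = cost (s a)" unfolding cost_def by (rule sum_vs)
  finally show ?thesis .
qed

lemma ev_invalidE:
  assumes s: "base3 s" "s ''zz'' 0 \<le> Z" "\<And>v. v \<in> V \<Longrightarrow> s ''cg'' v \<le> Z"
  shows "ev invalidE s = 0 \<longleftrightarrow> valid (s ''zz'' 0) (s ''cg'')"
proof -
  note b = base3D(1)[OF s(1)]
  let ?z = "s ''zz'' 0" and ?f = "s ''cg''"
  let ?E = "LetE ''bb'' (vx (rg ''vi'')) (LetE ''cc'' (R ''cg'' (rg ''bb'')) (Add mismatchE badcodeE))"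
  have 1: "ev (sumV ''vi'' ?E) s = 0 \<longleftrightarrow> (\<forall>v\<in>V. matches v (?f v) \<and> code_ok X y ?z (?f v))"
  proof -
    have e: "ev ?E (setreg s ''vi'' i) = 0 \<longleftrightarrow> matches (vs ! i) (?f (vs ! i)) \<and> code_ok X y ?z (?f (vs ! i))" if i: "i < n" for i
      using s base_vx[OF b i] s(3)[OF vs_V[OF i]] by (simp add: ev_mismatchE ev_badcodeE)
    have eq: "ev (sumV ''vi'' ?E) s = (\<Sum>i<n. ev ?E (setreg s ''vi'' i))"
      by (rule ev_sumV[OF b]) simp_all
    have "ev (sumV ''vi'' ?E) s = 0 \<longleftrightarrow> (\<forall>i<n. ev ?E (setreg s ''vi'' i) = 0)"
      unfolding eq sum_eq_0_iff[OF finite_lessThan] by (simp only: Ball_def lessThan_iff)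
    also have "\<dots> \<longleftrightarrow> (\<forall>i<n. matches (vs ! i) (?f (vs ! i)) \<and> code_ok X y ?z (?f (vs ! i)))"
      by (rule all_cong) (rule e)
    also have "\<dots> \<longleftrightarrow> (\<forall>v\<in>V. matches v (?f v) \<and> code_ok X y ?z (?f v))"
      using ex_vs vs_V by metis
    finally show ?thesis .
  qed
  have so: "ev (sumV ''vi'' (LetE ''cc'' (R ''cg'' (vx (rg ''vi''))) outE)) (setreg s ''ll'' l) =
      (\<Sum>v\<in>V. outs X y ?z (?f v) l)" for l
  proof -
    have "ev (sumV ''vi'' (LetE ''cc'' (R ''cg'' (vx (rg ''vi''))) outE)) (setreg s ''ll'' l) =
      (\<Sum>i<n. ev (LetE ''cc'' (R ''cg'' (vx (rg ''vi''))) outE) (setreg (setreg s ''ll'' l) ''vi'' i))"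
      by (rule ev_sumV) (use b in simp_all)
    also have "\<dots> = (\<Sum>i<n. outs X y ?z (?f (vs ! i)) l)"
    proof (rule sum.cong[OF refl])
      fix i assume "i \<in> {..<n}"
      then have i: "i < n" by simp
      show "ev (LetE ''cc'' (R ''cg'' (vx (rg ''vi''))) outE) (setreg (setreg s ''ll'' l) ''vi'' i) = outs X y ?z (?f (vs ! i)) l"
        using s base_vx[OF b i] s(3)[OF vs_V[OF i]] by (simp add: ev_outE)
    qed
    also have "\<dots> = (\<Sum>v\<in>V. outs X y ?z (?f v) l)" by (rule sum_vs)
    finally show ?thesis .
  qed
  have si: "ev (sumV ''vi'' (LetE ''cc'' (R ''cg'' (vx (rg ''vi''))) inE)) (setreg s ''ll'' l) =
      (\<Sum>v\<in>V. ins X y ?z (?f v) l)" for l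
  proof -
    have "ev (sumV ''vi'' (LetE ''cc'' (R ''cg'' (vx (rg ''vi''))) inE)) (setreg s ''ll'' l) =
      (\<Sum>i<n. ev (LetE ''cc'' (R ''cg'' (vx (rg ''vi''))) inE) (setreg (setreg s ''ll'' l) ''vi'' i))"
      by (rule ev_sumV) (use b in simp_all)
    also have "\<dots> = (\<Sum>i<n. ins X y ?z (?f (vs ! i)) l)"
    proof (rule sum.cong[OF refl])
      fix i assume "i \<in> {..<n}"
      then have i: "i < n" by simp
      show "ev (LetE ''cc'' (R ''cg'' (vx (rg ''vi''))) inE) (setreg (setreg s ''ll'' l) ''vi'' i) = ins X y ?z (?f (vs ! i)) l"
        using s base_vx[OF b i] s(3)[OF vs_V[OF i]] by (simp add: ev_inE)
    qed
    also have "\<dots> = (\<Sum>v\<in>V. ins X y ?z (?f v) l)" by (rule sum_vs)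
    finally show ?thesis .
  qed
  have "ev invalidE s = ev (sumV ''vi'' ?E) s + (\<Sum>l<X. if y < l then
      if (\<Sum>v\<in>V. outs X y ?z (?f v) l) = (\<Sum>v\<in>V. ins X y ?z (?f v) l) then 0 else 1 else 0)"
    unfolding invalidE_def ev.simps(3,8) base3D(2)[OF s(1)]
    using so si base3D(3)[OF s(1)] by (simp cong: if_cong)
  then have "ev invalidE s = 0 \<longleftrightarrow> ev (sumV ''vi'' ?E) s = 0 \<and>
      (\<forall>l\<in>{l. y < l \<and> l < X}. (\<Sum>v\<in>V. outs X y ?z (?f v) l) = (\<Sum>v\<in>V. ins X y ?z (?f v) l))"
    by (auto simp: sum_eq_0_iff split: if_splits)
  also have "(\<forall>l\<in>{l. y < l \<and> l < X}. (\<Sum>v\<in>V. outs X y ?z (?f v) l) = (\<Sum>v\<in>V. ins X y ?z (?f v) l)) \<longleftrightarrow>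
      (\<forall>l\<in>{l. y < l \<and> l < X}. (\<Sum>v\<in>V. imbalance X y ?z (?f v) l) = 0)"
  proof (rule ball_cong[OF refl])
    fix l
    have "(\<Sum>v\<in>V. imbalance X y ?z (?f v) l) = int (\<Sum>v\<in>V. outs X y ?z (?f v) l) - int (\<Sum>v\<in>V. ins X y ?z (?f v) l)"
      by (simp only: imbalance_def sum_subtractf of_nat_sum)
    then show "(\<Sum>v\<in>V. outs X y ?z (?f v) l) = (\<Sum>v\<in>V. ins X y ?z (?f v) l) \<longleftrightarrow> (\<Sum>v\<in>V. imbalance X y ?z (?f v) l) = 0"
      by (simp del: of_nat_sum)
  qed
  finally show ?thesis unfolding 1 valid_def valid_choice_def .
qed

definition init_code :: "nat \<Rightarrow> nat" where
  "init_code b = (LEAST c. matches b c \<and> (\<forall>t<X. kept X c t = 0))"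

lemma init_code: "init_code b < W" "matches b (init_code b)" "\<forall>t<X. kept X (init_code b) t = 0"
proof -
  let ?P = "\<lambda>c. matches b c \<and> (\<forall>t<X. kept X c t = 0)"
  obtain c where c: "c < W" "?P c" using ex_initial[of b] unfolding W by blast
  show "matches b (init_code b)" "\<forall>t<X. kept X (init_code b) t = 0"
    using LeastI[of ?P c] c(2) unfolding init_code_def by blast+
  show "init_code b < W" 
    unfolding init_code_def by (rule le_less_trans[OF Least_le[of ?P c, OF c(2)] c(1)])
qed

lemma ev_initE:
  assumes s: "base3 s" "s ''zz'' 0 \<le> Z"
  shows "ev initE s = init_code (s ''bb'' 0)"
proof -
  let ?P = "\<lambda>c. matches (s ''bb'' 0) c \<and> (\<forall>t<X. kept X c t = 0)"
  have Z0: "s ''Z'' 0 = Z" by (rule base3D(6)[OF s(1)])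
  have "ev initE s = (\<Sum>i<Z. if (\<Sum>j<Z. if i < j then 0 else if ?P j then 1 else (0::nat)) = 0 then 1 else 0)"
    unfolding initE_def ev.simps(8) Z0
  proof (rule sum.cong[OF refl])
    fix i assume "i \<in> {..<Z}"
    have "ev (SumE ''Z'' ''cc'' (IfLt (rg ''c1'') (rg ''cc'') (N 0) (IfEq (Add mismatchE uncleanE) (N 0) (N 1) (N 0))))
        (setreg s ''c1'' i) = (\<Sum>j<Z. if i < j then 0 else if ?P j then 1 else 0)"
      unfolding ev.simps(8)
    proof (rule sum.cong)
      show "{..<setreg s ''c1'' i ''Z'' 0} = {..<Z}" using Z0 by simp
      fix j assume "j \<in> {..<Z}"
      then show "ev (IfLt (rg ''c1'') (rg ''cc'') (N 0) (IfEq (Add mismatchE uncleanE) (N 0) (N 1) (N 0)))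
          (setreg (setreg s ''c1'' i) ''cc'' j) = (if i < j then 0 else if ?P j then 1 else 0)"
        using s by (auto simp: ev_mismatchE ev_uncleanE)
    qed
    then show "ev (IfEq (SumE ''Z'' ''cc'' (IfLt (rg ''c1'') (rg ''cc'') (N 0)
        (IfEq (Add mismatchE uncleanE) (N 0) (N 1) (N 0)))) (N 0) (N 1) (N 0)) (setreg s ''c1'' i) =
        (if (\<Sum>j<Z. if i < j then 0 else if ?P j then 1 else (0::nat)) = 0 then 1 else 0)"
      unfolding ev.simps(6) by (simp only: ev.simps(1))
  qed
  also have "\<dots> = (if \<exists>i<Z. ?P i then LEAST i. ?P i else Z)" by (rule least_as_count)
  also have "\<dots> = init_code (s ''bb'' 0)"
  proof -
    have "\<exists>i<Z. ?P i" using init_code[of "s ''bb'' 0"] Z_large(1) less_le_trans by blast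
    then show ?thesis by (simp add: init_code_def)
  qed
  finally show ?thesis .
qed

lemma ev_posE:
  assumes "base3 s"
  shows "ev posE s = (if \<exists>i<n. s ''cg'' (vs ! i) = s ''old'' 0 then LEAST i. s ''cg'' (vs ! i) = s ''old'' 0 else n)"
proof -
  note b = base3D(1)[OF assms]
  let ?P = "\<lambda>i. s ''cg'' (vs ! i) = s ''old'' 0"
  let ?I = "IfLt (rg ''vi'') (rg ''vh'') (N 0) (IfEq (R ''cg'' (vx (rg ''vh''))) (rg ''old'') (N 1) (N 0))"
  have inner: "ev (sumV ''vh'' ?I) (setreg s ''vi'' i) = (\<Sum>j<n. if i < j then 0 else if ?P j then 1 else 0)" for i
  proof -
    have "ev (sumV ''vh'' ?I) (setreg s ''vi'' i) = (\<Sum>j<n. ev ?I (setreg (setreg s ''vi'' i) ''vh'' j))"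
      by (rule ev_sumV) (use b in simp_all)
    also have "\<dots> = (\<Sum>j<n. if i < j then 0 else if ?P j then 1 else 0)"
      using base_vx[OF b] by (intro sum.cong[OF refl]) simp
    finally show ?thesis .
  qed
  have "ev posE s = (\<Sum>i<n. ev (IfEq (sumV ''vh'' ?I) (N 0) (N 1) (N 0)) (setreg s ''vi'' i))"
    unfolding posE_def by (rule ev_sumV[OF b]) simp_all
  also have "\<dots> = (\<Sum>i<n. if (\<Sum>j<n. if i < j then 0 else if ?P j then 1 else (0::nat)) = 0 then 1 else 0)"
    by (simp only: ev.simps(1,6) inner)
  finally show ?thesis by (simp only: least_as_count)
qed

lemma sem_move:
  assumes s: "base3 s" "s ''w'' 0 < Z" "s ''u'' 0 < g"
  shows "sem move_rc s ''cg'' =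
    rewrite_first vs (dig W (s ''w'' 0) (2 * s ''u'' 0), dig W (s ''w'' 0) (2 * s ''u'' 0 + 1)) (s ''cg'')"
proof -
  let ?o = "dig W (s ''w'' 0) (2 * s ''u'' 0)" and ?d = "dig W (s ''w'' 0) (2 * s ''u'' 0 + 1)"
  have W0: "s ''W'' 0 = W" "s ''Z'' 0 = Z" by (rule base3D(4)[OF s(1)], rule base3D(6)[OF s(1)])
  have le: "2 * s ''u'' 0 + 1 \<le> Z" using s(3) Z_large(3) by simp
  have o: "ev (digE ''W'' ''pW'' (rg ''w'') (Add (rg ''u'') (rg ''u''))) s = ?o"
  proof -
    have "ev (digE ''W'' ''pW'' (rg ''w'') (Add (rg ''u'') (rg ''u''))) s = dig (s ''W'' 0) (ev (rg ''w'') s) (2 * s ''u'' 0)"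
      by (rule ev_digE) (use s W0 W_pos base3D(11)[OF s(1), of "2 * s ''u'' 0"] le in auto)
    then show ?thesis using W0 by simp
  qed
  define s1 where "s1 = setreg s ''old'' ?o"
  have s1: "base3 s1" "s1 ''w'' = s ''w''" "s1 ''u'' = s ''u''" "s1 ''W'' = s ''W''" "s1 ''cg'' = s ''cg''"
    using s(1) by (simp_all add: s1_def)
  have d: "ev (digE ''W'' ''pW'' (rg ''w'') (Add (Add (rg ''u'') (rg ''u'')) (N 1))) s1 = ?d"
  proof -
    have "ev (digE ''W'' ''pW'' (rg ''w'') (Add (Add (rg ''u'') (rg ''u'')) (N 1))) s1 = dig (s1 ''W'' 0) (ev (rg ''w'') s1) (2 * s ''u'' 0 + 1)"
      by (rule ev_digE) (use s s1 W0 W_pos base3D(6)[OF s1(1)] base3D(11)[OF s1(1), of "2 * s ''u'' 0 + 1"] le in auto)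
    then show ?thesis using W0 s1 by simp
  qed
  define s2 where "s2 = setreg s1 ''new'' ?d"
  have s2: "base3 s2" "s2 ''cg'' = s ''cg''" "s2 ''old'' 0 = ?o" using s1 by (simp_all add: s2_def s1_def)
  define p where "p = (if \<exists>i<n. s ''cg'' (vs ! i) = ?o then LEAST i. s ''cg'' (vs ! i) = ?o else n)"
  have p: "ev posE s2 = p" using ev_posE[OF s2(1)] unfolding s2(2,3) p_def .
  define s3 where "s3 = setreg s2 ''pos'' p"
  have s3: "base3 s3" "s3 ''cg'' = s ''cg''" "s3 ''new'' 0 = ?d" "s3 ''pos'' 0 = p" using s2 by (simp_all add: s3_def s2_def)
  note b = base3D(1)[OF s3(1)]
  let ?A = "Asg ''cg'' (vx (rg ''pos'')) (IfLt (rg ''pos'') nE (rg ''new'') (R ''cg'' (vx (rg ''pos''))))"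
  have fin: "sem move_rc s = sem ?A s3"
    unfolding move_rc_def sem.simps(2) by (simp only: sem.simps(1) ev.simps(1) o s1_def[symmetric] d s2_def[symmetric] p s3_def[symmetric])
  have c: "sem ?A s3 ''cg'' = (s ''cg'')(s3 ''in'' (3 + p) := if p < n then ?d else s ''cg'' (s3 ''in'' (3 + p)))"
    using s3 base_n[OF b] by simp
  have v: "p < n \<Longrightarrow> s3 ''in'' (3 + p) = vs ! p" by (rule base_vx[OF b])
  show ?thesis
  proof (cases "p < n")
    case True
    then have "sem move_rc s ''cg'' = (s ''cg'')(vs ! p := ?d)" unfolding fin c v[OF True] by simp
    then show ?thesis using True unfolding rewrite_first_least Let_def p_def[symmetric] by simp
  next
    case False
    then have "sem move_rc s ''cg'' = s ''cg''" unfolding fin c by simp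
    then show ?thesis using False unfolding rewrite_first_least Let_def p_def[symmetric] by simp
  qed
qed

lemma sem_moves:
  assumes s: "base3 s" "s ''w'' 0 < Z"
  shows "sem (For ''u'' ''G'' move_rc) s ''cg'' = fold (rewrite_first vs) (moves W g (s ''w'' 0)) (s ''cg'')"
proof -
  define P where "P i s' \<longleftrightarrow> base3 s' \<and> s' ''w'' = s ''w'' \<and>
    s' ''cg'' = fold (rewrite_first vs) (moves W i (s ''w'' 0)) (s ''cg'')" for i s'
  have g0: "s ''G'' 0 = g" by (rule base3D(5)[OF s(1)])
  have "P (s ''G'' 0) (fold (\<lambda>i s. sem move_rc (setreg s ''u'' i)) [0..<s ''G'' 0] s)"
  proof (rule fold_upt_induct[where P = P])
    show "P 0 s" using s by (simp add: P_def moves_def)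
    fix i s' assume i: "i < s ''G'' 0" and P: "P i s'"
    define s1 where "s1 = setreg s' ''u'' i"
    have s1: "base3 s1" "s1 ''w'' = s ''w''" "s1 ''u'' 0 = i" "s1 ''cg'' = s' ''cg''"
      using P by (simp_all add: s1_def P_def)
    have "sem move_rc s1 ''cg'' = fold (rewrite_first vs) (moves W (Suc i) (s ''w'' 0)) (s ''cg'')"
      using sem_move[OF s1(1)] s1 s(2) i g0 P by (simp add: P_def moves_def)
    moreover have "base3 (sem move_rc s1)"
      by (rule base3_cong[OF s1(1)], rule sem_frame) (auto simp: wrs_move)
    moreover have "sem move_rc s1 ''w'' = s1 ''w''" by (rule sem_frame) (simp add: wrs_move)
    ultimately show "P (Suc i) (sem move_rc (setreg s' ''u'' i))"
      using s1 by (simp add: P_def s1_def[symmetric])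
  qed
  then show ?thesis using g0 by (simp add: P_def)
qed

text \<open>The default 0 outside \<open>V\<close> allows configurations to be compared as
  functions, although the loops may also write to cell 0 of \<open>cf\<close> when 0 is no
  vertex.\<close>

definition config :: "store \<Rightarrow> nat \<Rightarrow> nat" where
  "config s v = (if v \<in> V then s ''cf'' v else 0)"

definition trial :: "(nat \<Rightarrow> nat) \<Rightarrow> nat \<Rightarrow> nat \<Rightarrow> nat" where
  "trial f i = fold (rewrite_first vs) (moves W g i) f"

definition step :: "nat \<Rightarrow> nat \<Rightarrow> (nat \<Rightarrow> nat) \<Rightarrow> nat \<Rightarrow> nat" where
  "step z i f = (if valid z (trial f i) \<and> cost (trial f i) < cost f then trial f i else f)"

lemma trial_less: "(\<And>v. v \<in> V \<Longrightarrow> f v < W) \<Longrightarrow> v \<in> V \<Longrightarrow> trial f i v < W"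
  unfolding trial_def by (rule fold_rewrite_less) (use W_pos in auto)

lemma sem_try:
  assumes s: "base3 s" "s ''w'' 0 < Z" "s ''zz'' 0 < Z" "\<And>v. v \<in> V \<Longrightarrow> s ''cf'' v < W"
  shows "config (sem try_rc s) = step (s ''zz'' 0) (s ''w'' 0) (config s)"
proof -
  let ?T = "trial (config s) (s ''w'' 0)"
  define s1 where "s1 = sem (For ''i'' ''A'' (Asg ''cg'' (vx (rg ''i'')) (R ''cf'' (vx (rg ''i''))))) s"
  have fr1: "s1 z = s z" if "z \<noteq> ''cg''" "z \<noteq> ''i''" for z
    unfolding s1_def by (rule sem_frame) (use that in simp)
  have b1: "base3 s1" by (rule base3_cong[OF s(1)], rule fr1) auto
  have cg1: "s1 ''cg'' v = config s v" if "v \<in> V" for v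
  proof -
    have "s1 ''cg'' v = (\<lambda>x _. s ''cf'' x) v (s ''cg'' v)"
      unfolding s1_def
    proof (rule sem_For_vx[OF base3D(1)[OF s(1)]])
      fix s' j assume s': "\<And>z. z \<noteq> ''cg'' \<Longrightarrow> z \<noteq> ''i'' \<Longrightarrow> s' z = s z"
      have "s' ''in'' = s ''in''" "s' ''cf'' = s ''cf''" using s' by simp_all
      then show "ev (R ''cf'' (vx (rg ''i''))) (setreg s' ''i'' j) = s ''cf'' (s ''in'' (3 + j))" by simp
    qed (use that in auto)
    then show ?thesis using that by (simp add: config_def)
  qed
  define s2 where "s2 = sem (For ''u'' ''G'' move_rc) s1"
  have fr2: "s2 z = s1 z" if "z \<notin> {''old'', ''new'', ''pos'', ''cg'', ''u''}" for z
    unfolding s2_def by (rule sem_frame) (use that in \<open>simp add: wrs_move\<close>)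
  have b2: "base3 s2" by (rule base3_cong[OF b1], rule fr2) auto
  have w1: "s1 ''w'' = s ''w''" by (rule fr1) simp_all
  have "s2 ''cg'' = trial (s1 ''cg'') (s ''w'' 0)"
    using sem_moves[OF b1] w1 s(2) by (simp add: s2_def trial_def)
  then have cg2: "s2 ''cg'' v = ?T v" if "v \<in> V" for v
    using fold_rewrite_cong[of vs "s1 ''cg''" "config s" v] cg1 that vs(2) by (simp add: trial_def)
  have cf2: "s2 ''cf'' = s ''cf''" and zz2: "s2 ''zz'' = s ''zz''"
    using fr1 fr2 by simp_all
  have cfW: "config s v < W" if "v \<in> V" for v using s(4) that by (simp add: config_def)
  have TW: "?T v < W" if "v \<in> V" for v by (rule trial_less[where f = "config s", OF cfW that])
  let ?gd = "valid (s ''zz'' 0) ?T \<and> cost ?T < cost (config s)"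
  let ?E = "IfEq invalidE (N 0) (IfLt (costsE ''cg'') (costsE ''cf'') (N 1) (N 0)) (N 0)"
  have ev2: "ev ?E s2 = (if ?gd then 1 else 0)"
  proof -
    have zl: "s2 ''zz'' 0 \<le> Z" using zz2 s(3) by simp
    have cgl: "s2 ''cg'' v \<le> Z" if "v \<in> V" for v using cg2[OF that] TW[OF that] Z_large(1) by simp
    have cfl: "s2 ''cf'' v \<le> Z" if "v \<in> V" for v using cf2 s(4)[OF that] Z_large(1) by simp
    have "ev invalidE s2 = 0 \<longleftrightarrow> valid (s ''zz'' 0) ?T"
      using ev_invalidE[OF b2 zl cgl] valid_cong[of "s2 ''cg''" ?T] cg2 zz2 by simp
    moreover have "ev (costsE ''cg'') s2 = cost ?T"
      using ev_costsE[OF b2 zl cgl] cost_cong[of "s2 ''cg''" ?T] cg2 by simp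
    moreover have "ev (costsE ''cf'') s2 = cost (config s)"
      using ev_costsE[OF b2 zl cfl] cost_cong[of "s2 ''cf''" "config s"] cf2 by (simp add: config_def)
    ultimately show ?thesis by simp
  qed
  define s3 where "s3 = setreg s2 ''gd'' (if ?gd then 1 else 0)"
  have s3: "base3 s3" "s3 ''cf'' = s ''cf''" "s3 ''cg'' = s2 ''cg''" "s3 ''gd'' 0 = (if ?gd then 1 else 0)"
    using b2 cf2 by (simp_all add: s3_def)
  let ?L = "For ''i'' ''A'' (Asg ''cf'' (vx (rg ''i'')) (IfEq (rg ''gd'') (N 1) (R ''cg'' (vx (rg ''i''))) (R ''cf'' (vx (rg ''i'')))))"
  have fin: "sem try_rc s = sem ?L s3"
    unfolding try_rc_def sem.simps(2) s1_def[symmetric] s2_def[symmetric]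
    by (simp only: sem.simps(1) ev2 ev.simps(1) s3_def)
  have "sem ?L s3 ''cf'' v = (if ?gd then s2 ''cg'' v else s ''cf'' v)" if "v \<in> V" for v
  proof -
    have "sem ?L s3 ''cf'' v = (\<lambda>x c. if ?gd then s3 ''cg'' x else c) v (s3 ''cf'' v)"
    proof (rule sem_For_vx[OF base3D(1)[OF s3(1)]])
      fix s' j assume s': "\<And>z. z \<noteq> ''cf'' \<Longrightarrow> z \<noteq> ''i'' \<Longrightarrow> s' z = s3 z"
      have "s' ''in'' = s3 ''in''" "s' ''cg'' = s3 ''cg''" "s' ''gd'' = s3 ''gd''" using s' by simp_all
      then show "ev (IfEq (rg ''gd'') (N 1) (R ''cg'' (vx (rg ''i''))) (R ''cf'' (vx (rg ''i'')))) (setreg s' ''i'' j) =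
          (if ?gd then s3 ''cg'' (s3 ''in'' (3 + j)) else s' ''cf'' (s3 ''in'' (3 + j)))"
        using s3(4) by simp
    qed (use that in auto)
    then show ?thesis using s3 by simp
  qed
  then have "config (sem try_rc s) v = step (s ''zz'' 0) (s ''w'' 0) (config s) v" for v
  proof (cases "v \<in> V")
    case True
    then show ?thesis using \<open>\<And>v. v \<in> V \<Longrightarrow> sem ?L s3 ''cf'' v = _ v\<close>[OF True] cg2[OF True]
      unfolding fin config_def step_def by simp
  next
    case False
    then have "?T v = 0" 
      using fold_rewrite_outside[of v vs "moves W g (s ''w'' 0)" "config s"] vs(2) by (simp add: trial_def config_def)
    then show ?thesis using False by (simp add: config_def step_def)
  qed
  then show ?thesis by blast
qed

end

section \<open>Local optima and the number of rounds\<close>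

context solver_run
begin

text \<open>Local optimality with respect to the enumerated lists of moves;
  \<open>optimal_le\<close> makes it global for fixed \<open>z\<close>.\<close>

definition optimal :: "nat \<Rightarrow> (nat \<Rightarrow> nat) \<Rightarrow> bool" where
  "optimal z f \<longleftrightarrow> (\<forall>i<Z. \<not> (valid z (trial f i) \<and> cost (trial f i) < cost f))"

definition coded :: "(nat \<Rightarrow> nat) \<Rightarrow> bool" where
  "coded f \<longleftrightarrow> (\<forall>v\<in>V. f v < W)"

text \<open>A cheaper valid configuration would, by \<open>local_search\<close>, provide a list of
  moves numbered below \<open>Z\<close> that improves \<open>f\<close>.\<close>

lemma optimal_le:
  assumes "valid z f" "coded f" "optimal z f" "valid z f'" "coded f'"
  shows "cost f \<le> cost f'"
proof (rule ccontr)
  assume "\<not> cost f \<le> cost f'"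
  then have "(\<Sum>b\<in>V. code_cost X (f' b)) < (\<Sum>b\<in>V. code_cost X (f b))" by (simp add: cost_def)
  from local_search[OF vs _ assms(1) _ assms(4) _ W_pos(1) this, of g]
  obtain i where "i < W ^ (2 * g)" "valid z (trial f i)" "cost (trial f i) < cost f"
    using assms(2,5) g unfolding coded_def trial_def cost_def by auto
  then have "i < Z" by (simp only: Z)
  then show False using assms(3) \<open>valid z (trial f i)\<close> \<open>cost (trial f i) < cost f\<close>
    unfolding optimal_def by blast
qed

lemma step_props:
  assumes "valid z f" "coded f"
  shows "valid z (step z i f)" "coded (step z i f)" "cost (step z i f) \<le> cost f"
  using assms trial_less[of f _ i] by (auto simp: step_def coded_def)

lemma config_coded: "coded (config s) \<longleftrightarrow> coded (s ''cf'')"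
  by (simp add: coded_def config_def)

definition ready :: "nat \<Rightarrow> store \<Rightarrow> store \<Rightarrow> bool" where
  "ready z s s' \<longleftrightarrow> base3 s' \<and> s' ''zz'' 0 = z \<and> s' ''out'' = s ''out'' \<and> valid z (config s') \<and> coded (config s')"

text \<open>Improvements are accepted at once, so the configuration may change several times in one
  pass. If it never does, all lists were tried on the same configuration, which is then
  optimal.\<close>

lemma sem_pass:
  assumes r: "ready z s0 s" and z: "z < Z"
  defines "s' \<equiv> sem (For ''w'' ''Z'' try_rc) s"
  shows "ready z s0 s'" "optimal z (config s') \<and> config s' = config s \<or> cost (config s') < cost (config s)"
    "optimal z (config s) \<Longrightarrow> config s' = config s"
proof -
  define P where "P i s' \<longleftrightarrow> ready z s0 s' \<and> (config s' = config s \<and>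
     (\<forall>j<i. \<not> (valid z (trial (config s) j) \<and> cost (trial (config s) j) < cost (config s))) \<or>
     cost (config s') < cost (config s)) \<and> (optimal z (config s) \<longrightarrow> config s' = config s)" for i s'
  have Z0: "s ''Z'' 0 = Z" using r by (intro base3D(6)) (simp add: ready_def)
  have "P (s ''Z'' 0) (fold (\<lambda>i s. sem try_rc (setreg s ''w'' i)) [0..<s ''Z'' 0] s)"
  proof (rule fold_upt_induct[where P = P])
    show "P 0 s" using r by (simp add: P_def)
    fix i s1 assume i: "i < s ''Z'' 0" and P: "P i s1"
    then have r1: "ready z s0 s1" by (simp add: P_def)
    define s2 where "s2 = setreg s1 ''w'' i"
    have b2: "base3 s2" "s2 ''w'' 0 = i" "s2 ''zz'' 0 = z" "s2 ''cf'' = s1 ''cf''" "s2 ''out'' = s1 ''out''"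
      using r1 by (simp_all add: s2_def ready_def)
    have c2: "config s2 = config s1" using b2 by (simp add: config_def fun_eq_iff)
    have "coded (s2 ''cf'')" using r1 config_coded b2 by (simp add: ready_def)
    then have c3: "config (sem try_rc s2) = step z i (config s1)"
      using sem_try[OF b2(1)] b2 z i Z0 c2 by (simp add: coded_def)
    have b3: "base3 (sem try_rc s2)"
      by (rule base3_cong[OF b2(1)], rule sem_frame) (auto simp: wrs_try)
    have "sem try_rc s2 ''zz'' = s2 ''zz''" "sem try_rc s2 ''out'' = s2 ''out''"
      by (rule sem_frame, simp add: wrs_try)+
    then have r3: "ready z s0 (sem try_rc s2)"
      using b2 b3 c3 step_props[of z "config s1" i] r1 by (simp add: ready_def)
    have o: "optimal z (config s) \<longrightarrow> step z i (config s1) = config s"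
    proof
      assume "optimal z (config s)"
      moreover from this have "config s1 = config s" using P by (simp add: P_def)
      ultimately show "step z i (config s1) = config s" using i Z0 by (auto simp: optimal_def step_def)
    qed
    have "P (Suc i) (sem try_rc s2)"
    proof (cases "cost (config s1) < cost (config s)")
      case True
      have "cost (step z i (config s1)) \<le> cost (config s1)"
        using step_props(3)[of z "config s1" i] r1 by (simp add: ready_def)
      then have "cost (step z i (config s1)) < cost (config s)" using True by (rule le_less_trans)
      then show ?thesis using r3 o unfolding P_def c3 by blast
    next
      case False
      then have "config s1 = config s" "\<forall>j<i. \<not> (valid z (trial (config s) j) \<and> cost (trial (config s) j) < cost (config s))"
        using P by (simp_all add: P_def)
      then show ?thesis using r3 o unfolding P_def c3 by (auto simp: step_def less_Suc_eq)
    qed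
    then show "P (Suc i) (sem try_rc (setreg s1 ''w'' i))" by (simp only: s2_def)
  qed
  then have "P Z s'" unfolding s'_def sem.simps(3) using Z0 by simp
  then show "ready z s0 s'" "optimal z (config s') \<and> config s' = config s \<or> cost (config s') < cost (config s)"
    "optimal z (config s) \<Longrightarrow> config s' = config s"
    unfolding P_def by (auto simp: optimal_def)
qed

lemma initial_cost:
  assumes "\<And>v. v \<in> V \<Longrightarrow> f v = init_code v"
  shows "valid z f" "coded f" "cost f < A"
proof -
  show "valid z f" by (rule initial_valid) (use assms init_code in auto)
  show "coded f" using assms init_code by (simp add: coded_def)
  have "cost f = card (deleted f)" unfolding cost_def by (rule cost_eq) (use assms init_code in auto)
  also have "\<dots> \<le> card (set es)" by (intro card_mono) (auto simp: deleted_def)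
  also have "\<dots> < A" using A card_length[of es] by simp
  finally show "cost f < A" .
qed

lemma sem_search_codes:
  assumes s: "base3 s" "s ''zz'' 0 < Z"
  shows "ready (s ''zz'' 0) s (sem search_codes_rc s) \<and> optimal (s ''zz'' 0) (config (sem search_codes_rc s))"
proof -
  let ?z = "s ''zz'' 0"
  let ?I = "For ''i'' ''A'' (Asg ''cf'' (vx (rg ''i'')) (LetE ''bb'' (vx (rg ''i'')) initE))"
  define s1 where "s1 = sem ?I s"
  have fr: "s1 z = s z" if "z \<noteq> ''cf''" "z \<noteq> ''i''" for z
    unfolding s1_def by (rule sem_frame) (use that in simp)
  have b1: "base3 s1" by (rule base3_cong[OF s(1)], rule fr) auto
  have cf1: "s1 ''cf'' v = init_code v" if "v \<in> V" for v
  proof -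
    have "s1 ''cf'' v = (\<lambda>x _. init_code x) v (s ''cf'' v)"
      unfolding s1_def
    proof (rule sem_For_vx[OF base3D(1)[OF s(1)]])
      fix s' j assume s': "\<And>z. z \<noteq> ''cf'' \<Longrightarrow> z \<noteq> ''i'' \<Longrightarrow> s' z = s z"
      have b': "base3 s'" by (rule base3_cong[OF s(1)], rule s') auto
      have "s' ''in'' = s ''in''" "s' ''zz'' = s ''zz''" using s' by simp_all
      then show "ev (LetE ''bb'' (vx (rg ''i'')) initE) (setreg s' ''i'' j) = init_code (s ''in'' (3 + j))"
        using b' s(2) by (simp add: ev_initE)
    qed (use that in auto)
    then show ?thesis by simp
  qed
  then have i1: "valid ?z (config s1)" "coded (config s1)" "cost (config s1) < A"
    using initial_cost[of "config s1"] by (auto simp: config_def)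
  have "s1 ''zz'' = s ''zz''" "s1 ''out'' = s ''out''" by (rule fr, simp_all)+
  then have r1: "ready ?z s s1" using b1 i1 by (simp add: ready_def)
  \<comment> \<open>Until an optimum is reached, every round has lowered the cost by at least one;
    the initial cost is below \<open>A\<close>, so \<open>A\<close> rounds cannot pass without
    reaching one.\<close>
  define P where "P r s' \<longleftrightarrow> ready ?z s s' \<and> (optimal ?z (config s') \<or> cost (config s') + r \<le> cost (config s1))" for r s'
  have "P (s1 ''A'' 0) (fold (\<lambda>i s. sem (For ''w'' ''Z'' try_rc) (setreg s ''r'' i)) [0..<s1 ''A'' 0] s1)"
  proof (rule fold_upt_induct[where P = P])
    show "P 0 s1" using r1 by (simp add: P_def)
    fix i s2 assume P: "P i s2"
    define s3 where "s3 = setreg s2 ''r'' i"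
    have c3: "config s3 = config s2" by (simp add: s3_def config_def fun_eq_iff)
    have r3: "ready ?z s s3" using P c3 by (simp add: P_def ready_def s3_def)
    define s4 where "s4 = sem (For ''w'' ''Z'' try_rc) s3"
    note pass = sem_pass[OF r3 s(2), folded s4_def]
    have "P (Suc i) s4"
    proof (cases "optimal ?z (config s2)")
      case True
      then have "config s4 = config s2" using pass(3) c3 by simp
      then show ?thesis using pass(1) True by (simp add: P_def)
    next
      case False
      then have "cost (config s2) + i \<le> cost (config s1)" using P by (simp add: P_def)
      then have "optimal ?z (config s4) \<or> cost (config s4) + Suc i \<le> cost (config s1)"
        using pass(2) unfolding c3 by auto
      then show ?thesis using pass(1) unfolding P_def by blast
    qed
    then show "P (Suc i) (sem (For ''w'' ''Z'' try_rc) (setreg s2 ''r'' i))"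
      by (simp only: s4_def s3_def)
  qed
  then have "P A (sem (For ''r'' ''A'' (For ''w'' ''Z'' try_rc)) s1)"
    using base_A[OF base3D(1)[OF b1]] unfolding sem.simps(3) by simp
  moreover have "sem search_codes_rc s = sem (For ''r'' ''A'' (For ''w'' ''Z'' try_rc)) s1"
    unfolding search_codes_rc_def sem.simps(2) s1_def ..
  ultimately show ?thesis using i1(3) unfolding P_def by auto
qed

definition good :: "nat \<Rightarrow> bool" where
  "good z \<longleftrightarrow> (\<exists>cf. coded cf \<and> valid z cf \<and> int (cost cf) \<le> k)"

lemma sem_solve:
  assumes s: "base3 s" "s ''out'' 0 = 0"
  shows "sem solve_rc s ''out'' 0 = (if sescad (G, k) then 1 else 0)"
proof -
  have Z0: "s ''Z'' 0 = Z" by (rule base3D(6)[OF s(1)])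
  let ?O = "IfEq (rg ''out'') (N 1) (N 1) (IfEq (R ''in'' (N 0)) (N 0)
       (IfLt (R ''in'' (N 1)) (costsE ''cf'') (N 0) (N 1)) (N 0))"
  let ?c = "search_codes_rc ;; Asg ''out'' (N 0) ?O"
  define P where "P i s' \<longleftrightarrow> base3 s' \<and> s' ''out'' 0 = (if \<exists>z<i. good z then 1 else 0)" for i s'
  have "P (s ''Z'' 0) (fold (\<lambda>i s. sem ?c (setreg s ''zz'' i)) [0..<s ''Z'' 0] s)"
  proof (rule fold_upt_induct[where P = P])
    show "P 0 s" using s by (simp add: P_def)
    fix z s1 assume z: "z < s ''Z'' 0" and P: "P z s1"
    define s2 where "s2 = setreg s1 ''zz'' z"
    have s2: "base3 s2" "s2 ''zz'' 0 = z" "s2 ''out'' = s1 ''out''" using P by (simp_all add: s2_def P_def)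
    define s3 where "s3 = sem search_codes_rc s2"
    have s3: "ready z s2 s3" "optimal z (config s3)"
      using sem_search_codes[OF s2(1)] s2(2) z Z0 by (simp_all add: s3_def)
    have b3: "base3 s3" "s3 ''zz'' 0 = z" "s3 ''out'' = s1 ''out''" "valid z (config s3)" "coded (config s3)"
      using s3(1) s2 by (simp_all add: ready_def)
    have cf: "s3 ''cf'' v \<le> Z" if "v \<in> V" for v
    proof -
      have "config s3 v < W" using b3(5) that by (simp add: coded_def)
      then show ?thesis using that Z_large(1) by (simp add: config_def)
    qed
    have "ev (costsE ''cf'') s3 = cost (s3 ''cf'')"
      by (rule ev_costsE) (use b3 cf z Z0 in auto)
    also have "cost (s3 ''cf'') = cost (config s3)" by (rule cost_cong) (simp add: config_def)
    finally have c: "ev (costsE ''cf'') s3 = cost (config s3)" .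
    \<comment> \<open>The configuration found is cheapest for \<open>z\<close>, so it alone decides
      whether any configuration stays within \<open>k\<close>; since costs are natural numbers, a
      negative \<open>k\<close> admits none.\<close>
    have gd: "good z \<longleftrightarrow> \<not> k < 0 \<and> cost (config s3) \<le> nat \<bar>k\<bar>"
    proof
      assume "good z"
      then obtain f where f: "coded f" "valid z f" "int (cost f) \<le> k" unfolding good_def by blast
      have "cost (config s3) \<le> cost f" by (rule optimal_le[OF b3(4,5) s3(2) f(2,1)])
      then show "\<not> k < 0 \<and> cost (config s3) \<le> nat \<bar>k\<bar>" using f(3) by linarith
    next
      assume "\<not> k < 0 \<and> cost (config s3) \<le> nat \<bar>k\<bar>"
      then have "int (cost (config s3)) \<le> k" by linarith
      then show "good z" unfolding good_def using b3(4,5) by blast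
    qed
    have "ev ?O s3 = (if \<exists>z'<Suc z. good z' then 1 else 0)"
    proof (cases "\<exists>z'<z. good z'")
      case True
      then have "s3 ''out'' 0 = 1" using P b3(3) by (simp add: P_def)
      then have "ev ?O s3 = 1" by simp
      then show ?thesis using True less_Suc_eq by auto
    next
      case False
      then have "s3 ''out'' 0 = 0" using P b3(3) by (simp add: P_def)
      then have "ev ?O s3 = (if good z then 1 else 0)"
        unfolding gd using base_k[OF base3D(1)[OF b3(1)]] c by simp
      then show ?thesis using False less_Suc_eq by auto
    qed
    then have "P (Suc z) (setreg s3 ''out'' (ev ?O s3))" using b3(1) by (simp add: P_def)
    moreover have "sem ?c s2 = setreg s3 ''out'' (ev ?O s3)"
      unfolding sem.simps(1,2) s3_def[symmetric] by (simp only: ev.simps(1))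
    ultimately show "P (Suc z) (sem ?c (setreg s1 ''zz'' z))" unfolding s2_def[symmetric] by (simp only:)
  qed
  then have "sem solve_rc s ''out'' 0 = (if \<exists>z<Z. good z then 1 else 0)"
    unfolding solve_rc_def sem.simps(3) Z0 P_def by blast
  moreover have "(\<exists>z<Z. good z) \<longleftrightarrow> sescad (G, k)"
    using sescad_iff_codes[OF G refl es(2)[symmetric], of Z k, folded W, OF Z_large(1)]
    unfolding good_def coded_def cost_def by blast
  ultimately show ?thesis by simp
qed

end

section \<open>The complete program\<close>

text \<open>For arrays indexed by the loop register itself. The loops run to the word length, and
  nothing is claimed about the entries from \<open>l\<close> on.\<close>

lemma sem_For_idx:
  assumes "a \<noteq> y" "l \<le> s x 0"
    and ev: "\<And>s' j. (\<And>z. z \<noteq> a \<Longrightarrow> z \<noteq> y \<Longrightarrow> s' z = s z) \<Longrightarrow> j < l \<Longrightarrow> ev E (setreg s' y j) = F j"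
    and "i < l"
  shows "sem (For y x (Asg a (rg y) E)) s a i = F i"
proof -
  define P where "P j s' \<longleftrightarrow> (\<forall>z. z \<noteq> a \<longrightarrow> z \<noteq> y \<longrightarrow> s' z = s z) \<and> (\<forall>i<l. i < j \<longrightarrow> s' a i = F i)" for j s'
  have "P (s x 0) (fold (\<lambda>j s. sem (Asg a (rg y) E) (setreg s y j)) [0..<s x 0] s)"
  proof (rule fold_upt_induct[where P = P])
    show "P 0 s" by (simp add: P_def)
    fix j s' assume P: "P j s'"
    have "ev E (setreg s' y j) = F j" if "j < l" by (rule ev) (use P that in \<open>auto simp: P_def\<close>)
    then show "P (Suc j) (sem (Asg a (rg y) E) (setreg s' y j))"
      using P assms(1) by (auto simp: P_def less_Suc_eq)
  qed
  then show ?thesis using assms(2,4) by (simp add: P_def)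
qed

definition setup_rc :: rc where
  "setup_rc = For ''i'' ''A'' (Asg ''ln'' (vx (rg ''i'')) (Add (N 1) (Add
       (IfLt (rg ''q'') (R ''dg'' (vx (rg ''i''))) (rg ''y'') (N 0))
       (sumV ''h'' (IfEq (R ''blk'' (vx (rg ''h''))) (R ''blk'' (vx (rg ''i'')))
          (IfLt (vx (rg ''h'')) (vx (rg ''i'')) (N 1) (N 0)) (N 0)))))) ;;
     For ''j'' ''A'' (Asg ''eb'' (rg ''j'') (IfLt (rg ''q'') (R ''dg'' (tle (rg ''j'')))
       (R ''blk'' (hde (rg ''j''))) (R ''blk'' (tle (rg ''j''))))) ;;
     For ''j'' ''A'' (Asg ''es'' (rg ''j'') (sumA ''h'' (IfLt (rg ''h'') (rg ''j'')
       (IfEq (R ''eb'' (rg ''h'')) (R ''eb'' (rg ''j'')) (N 1) (N 0)) (N 0)))) ;;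
     powers ''pX'' ''X'' ;; powers ''pW'' ''W''"

context solver_run
begin

lemma sem_setup:
  assumes s: "base1 q s" "s ''blk'' = blk" "s ''X'' 0 = X" "s ''y'' 0 = y" "s ''W'' 0 = W" "s ''G'' 0 = g" "s ''Z'' 0 = Z"
  shows "base3 (sem setup_rc s)"
proof -
  have b: "base s" using s(1) by (rule base1_base)
  have q: "s ''q'' 0 = q" and dg: "\<And>v. v \<in> V \<Longrightarrow> s ''dg'' v = arc_degree G v"
    using s(1) by (simp_all add: base1_def)
  have hub: "q < s ''dg'' v \<longleftrightarrow> v \<in> M" if "v \<in> V" for v using dg[OF that] that by (simp add: hubs_def)
  let ?L1 = "For ''i'' ''A'' (Asg ''ln'' (vx (rg ''i'')) (Add (N 1) (Add
       (IfLt (rg ''q'') (R ''dg'' (vx (rg ''i''))) (rg ''y'') (N 0))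
       (sumV ''h'' (IfEq (R ''blk'' (vx (rg ''h''))) (R ''blk'' (vx (rg ''i'')))
          (IfLt (vx (rg ''h'')) (vx (rg ''i'')) (N 1) (N 0)) (N 0))))))"
  let ?L2 = "For ''j'' ''A'' (Asg ''eb'' (rg ''j'') (IfLt (rg ''q'') (R ''dg'' (tle (rg ''j'')))
       (R ''blk'' (hde (rg ''j''))) (R ''blk'' (tle (rg ''j'')))))"
  let ?L3 = "For ''j'' ''A'' (Asg ''es'' (rg ''j'') (sumA ''h'' (IfLt (rg ''h'') (rg ''j'')
       (IfEq (R ''eb'' (rg ''h'')) (R ''eb'' (rg ''j'')) (N 1) (N 0)) (N 0))))"
  define s1 where "s1 = sem ?L1 s"
  have fr1: "s1 z = s z" if "z \<notin> {''ln'', ''i''}" for z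
    unfolding s1_def by (rule sem_frame) (use that in simp)
  have ln1: "s1 ''ln'' v = ln v" if v: "v \<in> V" for v
  proof -
    define F where "F x = 1 + ((if q < s ''dg'' x then y else 0) + (\<Sum>h<n. if blk (vs ! h) = blk x then if vs ! h < x then 1 else 0 else 0))" for x
    have "s1 ''ln'' v = (\<lambda>x _. F x) v (s ''ln'' v)"
      unfolding s1_def
    proof (rule sem_For_vx[OF b])
      fix s' j assume s': "\<And>z. z \<noteq> ''ln'' \<Longrightarrow> z \<noteq> ''i'' \<Longrightarrow> s' z = s z" and b': "base s'"
      have e: "s' ''in'' = s ''in''" "s' ''q'' = s ''q''" "s' ''dg'' = s ''dg''" "s' ''y'' = s ''y''" "s' ''blk'' = blk"
        using s' s(2) by simp_all
      have "ev (sumV ''h'' (IfEq (R ''blk'' (vx (rg ''h''))) (R ''blk'' (vx (rg ''i'')))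
          (IfLt (vx (rg ''h'')) (vx (rg ''i'')) (N 1) (N 0)) (N 0))) (setreg s' ''i'' j) =
        (\<Sum>h<n. ev (IfEq (R ''blk'' (vx (rg ''h''))) (R ''blk'' (vx (rg ''i'')))
          (IfLt (vx (rg ''h'')) (vx (rg ''i'')) (N 1) (N 0)) (N 0)) (setreg (setreg s' ''i'' j) ''h'' h))"
        by (rule ev_sumV) (use b' in simp_all)
      also have "\<dots> = (\<Sum>h<n. if blk (vs ! h) = blk (s ''in'' (3 + j)) then if vs ! h < s ''in'' (3 + j) then 1 else 0 else 0)"
        using e base_vx[OF b] by (intro sum.cong[OF refl]) simp
      finally show "ev (Add (N 1) (Add (IfLt (rg ''q'') (R ''dg'' (vx (rg ''i''))) (rg ''y'') (N 0))
         (sumV ''h'' (IfEq (R ''blk'' (vx (rg ''h''))) (R ''blk'' (vx (rg ''i'')))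
          (IfLt (vx (rg ''h'')) (vx (rg ''i'')) (N 1) (N 0)) (N 0))))) (setreg s' ''i'' j) = F (s ''in'' (3 + j))"
        using e q s(4) by (simp add: F_def)
    qed (use v in auto)
    moreover have "F v = ln v"
    proof -
      have "(\<Sum>h<n. if blk (vs ! h) = blk v then if vs ! h < v then 1 else 0 else 0) =
          (\<Sum>u\<in>V. if blk u = blk v then if u < v then 1 else (0::nat) else 0)" by (rule sum_vs)
      also have "\<dots> = (\<Sum>u\<in>V. if blk u = blk v \<and> u < v then 1 else 0)" by (intro sum.cong) auto
      also have "\<dots> = card {u\<in>V. blk u = blk v \<and> u < v}" by (rule sum_indicator[OF finite_V])
      finally show ?thesis using hub[OF v] by (simp add: F_def ln_def)
    qed
    ultimately show ?thesis by simp
  qed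
  define s2 where "s2 = sem ?L2 s1"
  have fr2: "s2 z = s1 z" if "z \<notin> {''eb'', ''j''}" for z
    unfolding s2_def by (rule sem_frame) (use that in simp)
  have b1: "base s1" by (rule base_cong[OF _ _ _ b]; rule fr1; simp)
  have mA: "m \<le> A" using A by simp
  have eb2: "s2 ''eb'' j = eb j" if "j < m" for j
    unfolding s2_def
  proof (rule sem_For_idx[where l = m])
    show "m \<le> s1 ''A'' 0" using mA base_A[OF b1] by simp
    fix s' i assume s': "\<And>z. z \<noteq> ''eb'' \<Longrightarrow> z \<noteq> ''j'' \<Longrightarrow> s' z = s1 z" and i: "i < m"
    have "s' ''in'' = s ''in''" "s' ''q'' = s ''q''" "s' ''dg'' = s ''dg''" "s' ''blk'' = blk"
      using s' fr1 s(2) by simp_all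
    then show "ev (IfLt (rg ''q'') (R ''dg'' (tle (rg ''j''))) (R ''blk'' (hde (rg ''j''))) (R ''blk'' (tle (rg ''j''))))
        (setreg s' ''j'' i) = eb i"
      using base_tle[OF b i] base_n[OF b] q hub[OF arc_V(1)[OF i]] by (simp add: eb_def add.assoc)
  qed (use that in simp_all)
  define s3 where "s3 = sem ?L3 s2"
  have fr3: "s3 z = s2 z" if "z \<notin> {''es'', ''j''}" for z
    unfolding s3_def by (rule sem_frame) (use that in simp)
  have b2: "base s2" by (rule base_cong[OF _ _ _ b1]; rule fr2; simp)
  have es3: "s3 ''es'' j = sl j" if "j < m" for j
    unfolding s3_def
  proof (rule sem_For_idx[where l = m])
    show "m \<le> s2 ''A'' 0" using mA base_A[OF b2] by simp
    fix s' i assume s': "\<And>z. z \<noteq> ''es'' \<Longrightarrow> z \<noteq> ''j'' \<Longrightarrow> s' z = s2 z" and i: "i < m"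
    have b': "base s'" by (rule base_cong[OF _ _ _ b2]; rule s'; simp)
    have e: "s' ''eb'' = s2 ''eb''" using s' by simp
    have "ev (sumA ''h'' (IfLt (rg ''h'') (rg ''j'') (IfEq (R ''eb'' (rg ''h'')) (R ''eb'' (rg ''j'')) (N 1) (N 0)) (N 0)))
        (setreg s' ''j'' i) =
      (\<Sum>h<m. ev (IfLt (rg ''h'') (rg ''j'') (IfEq (R ''eb'' (rg ''h'')) (R ''eb'' (rg ''j'')) (N 1) (N 0)) (N 0))
        (setreg (setreg s' ''j'' i) ''h'' h))"
      by (rule ev_sumA) (use b' in simp_all)
    also have "\<dots> = (\<Sum>h<m. if h < i \<and> eb h = eb i then 1 else 0)"
      using e eb2 i by (intro sum.cong[OF refl]) simp
    also have "\<dots> = card {h\<in>{..<m}. h < i \<and> eb h = eb i}" by (rule sum_indicator) simp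
    also have "{h\<in>{..<m}. h < i \<and> eb h = eb i} = {h\<in>{..<i}. eb h = eb i}" using i by auto
    finally show "ev (sumA ''h'' (IfLt (rg ''h'') (rg ''j'') (IfEq (R ''eb'' (rg ''h'')) (R ''eb'' (rg ''j'')) (N 1) (N 0)) (N 0)))
        (setreg s' ''j'' i) = sl i" by (simp only: sl_def)
  qed (use that in simp_all)
  define s4 where "s4 = sem (powers ''pX'' ''X'') s3"
  have fr4: "s4 z = s3 z" if "z \<notin> {''pX'', ''pi''}" for z
    unfolding s4_def by (rule sem_frame) (use that in \<open>simp add: wrs_powers\<close>)
  define s5 where "s5 = sem (powers ''pW'' ''W'') s4"
  have fr5: "s5 z = s4 z" if "z \<notin> {''pW'', ''pi''}" for z
    unfolding s5_def by (rule sem_frame) (use that in \<open>simp add: wrs_powers\<close>)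
  have regs: "s3 ''Z'' 0 = Z" "s3 ''X'' 0 = X" "s4 ''Z'' 0 = Z" "s4 ''W'' 0 = W"
    using s fr1 fr2 fr3 fr4 by simp_all
  have pX: "s4 ''pX'' i = X ^ i" if "i \<le> Z" for i
    using sem_powers[of "''pX''" "''X''" i s3] that regs by (simp add: s4_def)
  have pW: "s5 ''pW'' i = W ^ i" if "i \<le> Z" for i
    using sem_powers[of "''pW''" "''W''" i s4] that regs by (simp add: s5_def)
  have "base s5" by (rule base_cong[OF _ _ _ b]) (simp_all add: fr1 fr2 fr3 fr4 fr5)
  moreover have "s5 ''X'' 0 = X" "s5 ''y'' 0 = y" "s5 ''W'' 0 = W" "s5 ''G'' 0 = g" "s5 ''Z'' 0 = Z"
    using s by (simp_all add: fr1 fr2 fr3 fr4 fr5)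
  moreover have "s5 ''ln'' = s1 ''ln''" "s5 ''eb'' = s2 ''eb''" "s5 ''es'' = s3 ''es''" "s5 ''pX'' = s4 ''pX''"
    by (simp_all add: fr2 fr3 fr4 fr5)
  ultimately have "base3 s5" unfolding base3_def using ln1 eb2 es3 pX pW by simp
  then show ?thesis
    unfolding setup_rc_def sem.simps(2) s1_def[symmetric] s2_def[symmetric] s3_def[symmetric] s4_def[symmetric] s5_def[symmetric] .
qed

end

section \<open>Computing the bounds that depend on the parameter\<close>

text \<open>A register may bound loops only in a stage that does not change it, so each number is
  computed in an earlier stage than the sums and powers that run up to it.\<close>

definition param_rcs :: "rc list" where
  "param_rcs = [Asg ''q2'' (N 0) (Add (rg ''q'') (N 2)),
     Asg ''y'' (N 0) (SumE ''q2'' ''a'' (SumE ''q2'' ''b'' (rg ''q2''))) ;; Asg ''y1'' (N 0) (Add (rg ''y'') (N 1)),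
     Asg ''sq'' (N 0) (SumE ''y1'' ''a'' (rg ''y1'')) ;;
       Asg ''X'' (N 0) (Add (Add (rg ''sq'') (rg ''sq'')) (Add (rg ''sq'') (rg ''sq''))) ;;
       Asg ''X4'' (N 0) (Add (Add (rg ''X'') (rg ''X'')) (Add (rg ''X'') (rg ''X''))) ;;
       Asg ''X6'' (N 0) (Add (rg ''X4'') (Add (rg ''X'') (rg ''X''))) ;; Asg ''two'' (N 0) (N 2),
     powc ''W'' ''X'' ''X4'', powc ''E'' ''two'' ''X'', powc ''G'' ''X6'' ''E'',
     Asg ''G2'' (N 0) (Add (rg ''G'') (rg ''G'')), powc ''Z'' ''W'' ''G2'']"

definition y_of :: "nat \<Rightarrow> nat" where "y_of q = (q + 2) ^ 3"
definition X_of :: "nat \<Rightarrow> nat" where "X_of q = slots (y_of q)"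
definition W_of :: "nat \<Rightarrow> nat" where "W_of q = X_of q ^ (4 * X_of q)"
definition g_of :: "nat \<Rightarrow> nat" where "g_of q = (6 * X_of q) ^ (2 ^ X_of q)"
definition Z_of :: "nat \<Rightarrow> nat" where "Z_of q = W_of q ^ (2 * g_of q)"

lemma sem_powc_other: "x \<noteq> r \<Longrightarrow> x \<noteq> ''pi'' \<Longrightarrow> sem (powc r b e) s x = s x"
  by (rule sem_frame) (simp add: wrs_powc)

lemma cnts_powc: "cntsc (powc r b e) = {b, e}"
  by (auto simp: powc_def)

lemma of_bounds:
  "2 \<le> X_of q" "y_of q + 1 \<le> X_of q" "q + 2 \<le> y_of q" "4 * X_of q \<le> W_of q" "W_of q \<le> Z_of q" "2 * g_of q \<le> Z_of q"
  "6 * X_of q \<le> g_of q" "2 ^ X_of q \<le> g_of q" "2 \<le> W_of q"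
proof -
  let ?X = "X_of q"
  show y: "q + 2 \<le> y_of q" unfolding y_of_def by (rule self_le_power) simp_all
  have "?X = 4 * ((y_of q + 1) * (y_of q + 1))" by (simp add: X_of_def slots_def power2_eq_square)
  then show yX: "y_of q + 1 \<le> ?X" by simp
  then show X2: "2 \<le> ?X" using y by linarith
  have "4 * ?X < ?X ^ (4 * ?X)" using X2 by (intro power_gt_expt) simp
  then show XW: "4 * ?X \<le> W_of q" by (simp add: W_of_def)
  then show W2: "2 \<le> W_of q" using X2 by linarith
  have "2 ^ ?X < (6 * ?X) ^ (2 ^ ?X)" using X2 by (intro power_gt_expt) simp
  then show "2 ^ ?X \<le> g_of q" by (simp add: g_of_def)
  show g6: "6 * ?X \<le> g_of q" unfolding g_of_def using X2 by (intro self_le_power) simp_all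
  have "2 * g_of q < W_of q ^ (2 * g_of q)" using W2 by (intro power_gt_expt) simp
  then show "2 * g_of q \<le> Z_of q" by (simp add: Z_of_def)
  show "W_of q \<le> Z_of q" unfolding Z_of_def using W2 g6 X2 by (intro self_le_power) simp_all
qed

lemma param_steps:
  assumes q: "s ''q'' 0 = q"
  shows "sems param_rcs s ''X'' 0 = X_of q" "sems param_rcs s ''y'' 0 = y_of q" "sems param_rcs s ''W'' 0 = W_of q"
    "sems param_rcs s ''G'' 0 = g_of q" "sems param_rcs s ''Z'' 0 = Z_of q"
    "oks param_rcs (Z_of q) s"
proof -
  define s1 where "s1 = setreg s ''q2'' (q + 2)"
  define s2 where "s2 = setreg (setreg s1 ''y'' (y_of q)) ''y1'' (y_of q + 1)"
  define c where "c = (y_of q + 1) * (y_of q + 1)"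
  define s3 where "s3 = setreg (setreg (setreg (setreg (setreg s2 ''sq'' c)
    ''X'' (X_of q)) ''X4'' (4 * X_of q)) ''X6'' (6 * X_of q)) ''two'' 2"
  define s4 where "s4 = sem (powc ''W'' ''X'' ''X4'') s3"
  define s5 where "s5 = sem (powc ''E'' ''two'' ''X'') s4"
  define s6 where "s6 = sem (powc ''G'' ''X6'' ''E'') s5"
  define s7 where "s7 = setreg s6 ''G2'' (s6 ''G'' 0 + s6 ''G'' 0)"
  define s8 where "s8 = sem (powc ''Z'' ''W'' ''G2'') s7"
  have y: "y_of q = (q + 2) * ((q + 2) * (q + 2))" by (simp add: y_of_def power3_eq_cube)
  have X: "c + c + (c + c) = X_of q" "X_of q + X_of q + (X_of q + X_of q) = 4 * X_of q"
    "4 * X_of q + (X_of q + X_of q) = 6 * X_of q"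
    by (simp_all add: X_of_def slots_def power2_eq_square c_def)
  have sq: "ev (SumE ''y1'' ''a'' (rg ''y1'')) s2 = c" by (simp add: s2_def c_def)
  have e1: "sem (Asg ''q2'' (N 0) (Add (rg ''q'') (N 2))) s = s1" using q by (simp add: s1_def)
  have e2: "sem (Asg ''y'' (N 0) (SumE ''q2'' ''a'' (SumE ''q2'' ''b'' (rg ''q2''))) ;; Asg ''y1'' (N 0) (Add (rg ''y'') (N 1))) s1 = s2"
    by (simp add: s2_def s1_def y)
  have e3: "sem (Asg ''sq'' (N 0) (SumE ''y1'' ''a'' (rg ''y1'')) ;;
       Asg ''X'' (N 0) (Add (Add (rg ''sq'') (rg ''sq'')) (Add (rg ''sq'') (rg ''sq''))) ;;
       Asg ''X4'' (N 0) (Add (Add (rg ''X'') (rg ''X'')) (Add (rg ''X'') (rg ''X''))) ;;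
       Asg ''X6'' (N 0) (Add (rg ''X4'') (Add (rg ''X'') (rg ''X''))) ;; Asg ''two'' (N 0) (N 2)) s2 = s3"
    unfolding sem.simps(1,2) sq by (simp add: s3_def X)
  have r3: "s3 ''X'' 0 = X_of q" "s3 ''y'' 0 = y_of q" "s3 ''X4'' 0 = 4 * X_of q" "s3 ''X6'' 0 = 6 * X_of q" "s3 ''two'' 0 = 2"
    by (simp_all add: s3_def s2_def)
  have r4: "s4 ''W'' 0 = W_of q" using r3 by (simp add: s4_def sem_powc W_of_def)
  have r5: "s5 ''E'' 0 = 2 ^ X_of q" using r3 by (simp add: s5_def sem_powc s4_def sem_powc_other)
  have r6: "s6 ''G'' 0 = g_of q" using r3 r5 by (simp add: s6_def sem_powc g_of_def) (simp add: s5_def s4_def sem_powc_other)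
  have r7: "s7 ''G2'' 0 = 2 * g_of q" "s7 ''W'' 0 = W_of q"
    using r6 r4 by (simp_all add: s7_def s6_def s5_def sem_powc_other)
  have r8: "s8 ''Z'' 0 = Z_of q" using r7 by (simp add: s8_def sem_powc Z_of_def)
  have fin: "sems param_rcs s = s8"
    unfolding param_rcs_def sems.simps e1 e2 e3 s4_def[symmetric] s5_def[symmetric] s6_def[symmetric]
    by (simp add: s7_def[symmetric] s8_def[symmetric])
  show "sems param_rcs s ''X'' 0 = X_of q" "sems param_rcs s ''y'' 0 = y_of q" "sems param_rcs s ''W'' 0 = W_of q"
    "sems param_rcs s ''G'' 0 = g_of q" "sems param_rcs s ''Z'' 0 = Z_of q"
    using r3 r4 r6 r8 unfolding fin by (simp_all add: s8_def s7_def s6_def s5_def s4_def sem_powc_other)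
  have r5': "s5 ''X6'' 0 = 6 * X_of q" "s4 ''X'' 0 = X_of q" "s4 ''two'' 0 = 2"
    using r3 by (simp_all add: s5_def s4_def sem_powc_other)
  have r12: "s1 ''q2'' 0 = q + 2" "s2 ''y1'' 0 = y_of q + 1" by (simp_all add: s1_def s2_def)
  have o1: "oks [Asg ''G2'' (N 0) (Add (rg ''G'') (rg ''G'')), powc ''Z'' ''W'' ''G2''] (Z_of q) s6"
    using r7 of_bounds[of q] by (simp add: s7_def[symmetric] cnts_powc)
  have o2: "oks [powc ''W'' ''X'' ''X4'', powc ''E'' ''two'' ''X'', powc ''G'' ''X6'' ''E'',
     Asg ''G2'' (N 0) (Add (rg ''G'') (rg ''G'')), powc ''Z'' ''W'' ''G2''] (Z_of q) s3"
    unfolding oks.simps(2)[of "powc ''W'' ''X'' ''X4''"] oks.simps(2)[of "powc ''E'' ''two'' ''X''"] oks.simps(2)[of "powc ''G'' ''X6'' ''E''"]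
      s4_def[symmetric] s5_def[symmetric] s6_def[symmetric] cnts_powc
    using o1 r3 r5 r5' of_bounds[of q] by auto
  show "oks param_rcs (Z_of q) s"
    unfolding param_rcs_def oks.simps(2)[of "Asg ''q2'' _ _"] oks.simps(2)[of "Asg ''y'' _ _ ;; _"] oks.simps(2)[of "Asg ''sq'' _ _ ;; _"]
      e1 e2 e3
    using o2 r12 of_bounds[of q] by auto
qed

lemma param_frame:
  assumes "x \<notin> {''q2'', ''y'', ''y1'', ''sq'', ''X'', ''X4'', ''X6'', ''two'', ''W'', ''E'', ''G'', ''G2'', ''Z'', ''pi''}"
  shows "sems param_rcs s x = s x"
proof -
  have "sems cs s x = s x" if "\<forall>c\<in>set cs. x \<notin> wrs c" for cs s
    using that by (induction cs arbitrary: s) (auto simp: sem_frame)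
  moreover have "\<forall>c\<in>set param_rcs. x \<notin> wrs c"
    using assms by (simp add: param_rcs_def wrs_powc)
  ultimately show ?thesis by blast
qed

text \<open>The program works with the \<open>q\<close> it finds, which is at most
  \<open>2 * p\<close>; monotonicity puts \<open>2 * p\<close> in its place in the time
  bound.\<close>

lemma Z_of_mono: "q \<le> q' \<Longrightarrow> Z_of q \<le> Z_of q'"
proof -
  assume "q \<le> q'"
  then have "y_of q \<le> y_of q'" unfolding y_of_def by (intro power_mono) auto
  then have X: "X_of q \<le> X_of q'" unfolding X_of_def slots_def by (intro mult_le_mono2 power_mono) auto
  have mono: "b ^ e \<le> b' ^ e'" if "b \<le> b'" "e \<le> e'" "1 \<le> b'" for b b' e e' :: nat
  proof -
    have "b ^ e \<le> b' ^ e" using that(1) by (rule power_mono) simp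
    also have "\<dots> \<le> b' ^ e'" using that by (intro power_increasing) auto
    finally show ?thesis .
  qed
  have W: "W_of q \<le> W_of q'" unfolding W_of_def using X of_bounds(1)[of q'] by (intro mono) auto
  have "(2::nat) ^ X_of q \<le> 2 ^ X_of q'" using X by (intro power_increasing) auto
  then have "g_of q \<le> g_of q'" unfolding g_of_def using X of_bounds(1)[of q'] by (intro mono) auto
  then show "Z_of q \<le> Z_of q'" unfolding Z_of_def using W of_bounds(9)[of q'] by (intro mono) auto
qed

section \<open>Well-formedness of the program\<close>

text \<open>\<open>C\<close> fixes in advance the registers that may bound loops. This allows a
  check by recursion over the syntax, whereas \<open>wfc\<close> compares sets collected from the
  whole command.\<close>

definition okE :: "string set \<Rightarrow> ex \<Rightarrow> bool" where
  "okE C e \<longleftrightarrow> rds e \<subseteq> - {''#''} \<and> cnts e \<subseteq> C \<and> bnds e \<subseteq> - C"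

definition okC :: "string set \<Rightarrow> rc \<Rightarrow> bool" where
  "okC C c \<longleftrightarrow> rdsc c \<subseteq> - {''#''} \<and> cntsc c \<subseteq> C \<and> bndsc c \<subseteq> - C \<and> wrs c \<subseteq> - C"

lemma okC_wfc: "okC C c \<Longrightarrow> wfc c"
  unfolding okC_def by (rule wfcI[of c C]) auto

lemma okE_simps:
  "okE C (N i)" "okE C (R x a) \<longleftrightarrow> x \<noteq> ''#'' \<and> okE C a" "okE C (Add a b) \<longleftrightarrow> okE C a \<and> okE C b"
  "okE C (Sub a b) \<longleftrightarrow> okE C a \<and> okE C b"
  "okE C (IfLt a b c d) \<longleftrightarrow> okE C a \<and> okE C b \<and> okE C c \<and> okE C d"
  "okE C (IfEq a b c d) \<longleftrightarrow> okE C a \<and> okE C b \<and> okE C c \<and> okE C d"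
  "okE C (LetE z a b) \<longleftrightarrow> z \<noteq> ''#'' \<and> z \<notin> C \<and> okE C a \<and> okE C b"
  "okE C (SumE x z b) \<longleftrightarrow> x \<noteq> ''#'' \<and> z \<noteq> ''#'' \<and> x \<in> C \<and> z \<notin> C \<and> okE C b"
  by (auto simp: okE_def)

lemma okC_simps:
  "okC C (Asg x a b) \<longleftrightarrow> x \<noteq> ''#'' \<and> x \<notin> C \<and> okE C a \<and> okE C b"
  "okC C (c ;; d) \<longleftrightarrow> okC C c \<and> okC C d"
  "okC C (For z x c) \<longleftrightarrow> x \<noteq> ''#'' \<and> z \<noteq> ''#'' \<and> x \<in> C \<and> z \<notin> C \<and> okC C c"
  by (auto simp: okC_def okE_def)

lemma wfc_params: "c \<in> set param_rcs \<Longrightarrow> wfc c"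
proof -
  have p: "okC {b, e} (powc r b e)" if "r \<notin> {b, e, ''#''}" "b \<notin> {''#'', ''pi'', ''pj''}" "e \<notin> {''#'', ''pi'', ''pj''}" for r b e
    using that by (auto simp: powc_def okC_simps okE_simps)
  have "\<forall>c\<in>set param_rcs. \<exists>C. okC C c"
    unfolding param_rcs_def list.set ball_simps
  proof (intro conjI TrueI)
    show "\<exists>C. okC C (Asg ''q2'' (N 0) (Add (rg ''q'') (N 2)))" by (rule exI[of _ "{}"]) (simp add: okC_simps okE_simps)
    show "\<exists>C. okC C (Asg ''y'' (N 0) (SumE ''q2'' ''a'' (SumE ''q2'' ''b'' (rg ''q2''))) ;; Asg ''y1'' (N 0) (Add (rg ''y'') (N 1)))"
      by (rule exI[of _ "{''q2''}"]) (simp add: okC_simps okE_simps)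
    show "\<exists>C. okC C (Asg ''sq'' (N 0) (SumE ''y1'' ''a'' (rg ''y1'')) ;;
       Asg ''X'' (N 0) (Add (Add (rg ''sq'') (rg ''sq'')) (Add (rg ''sq'') (rg ''sq''))) ;;
       Asg ''X4'' (N 0) (Add (Add (rg ''X'') (rg ''X'')) (Add (rg ''X'') (rg ''X''))) ;;
       Asg ''X6'' (N 0) (Add (rg ''X4'') (Add (rg ''X'') (rg ''X''))) ;; Asg ''two'' (N 0) (N 2))"
      by (rule exI[of _ "{''y1''}"]) (simp add: okC_simps okE_simps)
    show "\<exists>C. okC C (powc ''W'' ''X'' ''X4'')" "\<exists>C. okC C (powc ''E'' ''two'' ''X'')" "\<exists>C. okC C (powc ''G'' ''X6'' ''E'')"
      "\<exists>C. okC C (powc ''Z'' ''W'' ''G2'')"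
      by (rule exI, rule p, simp_all)+
    show "\<exists>C. okC C (Asg ''G2'' (N 0) (Add (rg ''G'') (rg ''G'')))" by (rule exI[of _ "{}"]) (simp add: okC_simps okE_simps)
  qed
  then show "c \<in> set param_rcs \<Longrightarrow> wfc c" using okC_wfc by blast
qed

definition main_rcs :: "rc list" where
  "main_rcs = [Asg ''A'' (N 0) (rg ''len''), degrees_rc, search_rc] @ param_rcs @ [setup_rc, solve_rc]"

lemma wfc_main: "\<forall>c\<in>set main_rcs. wfc c"
proof -
  note okes = okC_simps okE_simps sumV_def sumA_def digE_def modE_def divE_def
  have 1: "okC {} (Asg ''A'' (N 0) (rg ''len''))" by (simp add: okes)
  have 2: "okC {''A''} degrees_rc" by (simp add: okes degrees_rc_def)
  have 3: "okC {''A''} search_rc"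
    by (simp add: okes search_rc_def blocks_rc_def union_rc_def linkE_def badE_def cubeE_def)
  have 4: "okC {''A'', ''X'', ''Z'', ''W''} setup_rc" by (simp add: okes setup_rc_def powers_def)
  let ?C = "{''A'', ''X'', ''y'', ''G'', ''Z''}"
  have s: "okE ?C srcE" "okE ?C dstE" "okE ?C keptE" "okE ?C (levE ''ls'')" "okE ?C (levE ''ld'')"
    by (simp_all add: okes srcE_def dstE_def keptE_def levE_def dX_def f4_def)
  then have a: "okE ?C (arcE e) \<longleftrightarrow> okE ?C e" for e by (simp add: arcE_def okE_simps)
  have b: "okE ?C descE" "okE ?C outE" "okE ?C inE" "okE ?C costE" "okE ?C uncleanE"
    unfolding descE_def outE_def inE_def costE_def uncleanE_def a by (simp_all add: okE_simps)
  have c: "okE ?C mismatchE" using s by (simp add: okes mismatchE_def atE_def)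
  have d: "okE ?C badcodeE" using b by (simp add: okes badcodeE_def)
  have e: "okE ?C invalidE" "okE ?C initE" "okE ?C (costsE ''cf'')" "okE ?C (costsE ''cg'')" "okE ?C posE"
    using b c d by (simp_all add: okes invalidE_def initE_def costsE_def posE_def)
  have f: "okC ?C move_rc" using e by (simp add: okes move_rc_def)
  have 5: "okC ?C solve_rc" using e f by (simp add: okes solve_rc_def search_codes_rc_def try_rc_def)
  show ?thesis
    using okC_wfc[OF 1] okC_wfc[OF 2] okC_wfc[OF 3] okC_wfc[OF 4] okC_wfc[OF 5] wfc_params
    by (auto simp: main_rcs_def)
qed

context instance_word
begin

lemma input_base:
  defines "s0 \<equiv> sem (Asg ''A'' (N 0) (rg ''len'')) (input_store w)"
  shows "base s0" "s0 ''q'' 0 = 0" "s0 ''out'' 0 = 0"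
  by (simp_all add: s0_def base_def input_store_def)

text \<open>\<open>p\<close> occurs only in the bound on the loop registers: the program never sees
  it, and \<open>links_class_bound\<close> guarantees that the search ends with some
  \<open>q <= 2 * p\<close>.\<close>

theorem main_rcs_correct:
  assumes vi: "has_vertex_integrity G p"
  shows "sems main_rcs (input_store w) ''out'' 0 = (if sescad (G, k) then 1 else 0)"
    "oks main_rcs (A + Z_of (2 * p)) (input_store w)"
proof -
  define s0 where "s0 = sem (Asg ''A'' (N 0) (rg ''len'')) (input_store w)"
  have s0: "base s0" "s0 ''q'' 0 = 0" "s0 ''out'' 0 = 0" using input_base by (simp_all add: s0_def)
  define s1 where "s1 = sem degrees_rc s0"
  have fr1: "s1 x = s0 x" if "x \<notin> {''dg'', ''i''}" for x
    unfolding s1_def by (rule sem_frame) (use that in \<open>simp add: degrees_rc_def\<close>)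
  have b1: "base s1" by (rule base_cong[OF _ _ _ s0(1)]; rule fr1; simp)
  have s1: "base1 0 s1"
    unfolding base1_def using b1 fr1[of "''q''"] s0(2) sem_degrees[OF s0(1)] by (simp add: s1_def)
  define s2 where "s2 = sem search_rc s1"
  obtain q where q: "base1 q s2" "okq q" "\<forall>q'<q. \<not> okq q'" "blocked q (s2 ''blk'')"
    using sem_search[OF s1] unfolding s2_def by blast
  have "okq (2 * p)" unfolding okq_def using links_class_bound[OF G vi] by blast
  then have q2p: "q \<le> 2 * p" using q(3) by (meson not_less)
  have sq: "s2 ''q'' 0 = q" using q(1) by (simp add: base1_def)
  define s3 where "s3 = sems param_rcs s2"
  have fr3: "s3 x = s2 x"
    if "x \<notin> {''q2'', ''y'', ''y1'', ''sq'', ''X'', ''X4'', ''X6'', ''two'', ''W'', ''E'', ''G'', ''G2'', ''Z'', ''pi''}" for x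
    unfolding s3_def by (rule param_frame) (rule that)
  note p3 = param_steps[where s = s2 and q = q, OF sq, folded s3_def]
  interpret S: solver_run G k vs es w q "y_of q" "X_of q" "W_of q" "g_of q" "Z_of q" "s2 ''blk''"
    by unfold_locales (use q in \<open>simp_all add: y_of_def X_of_def W_of_def g_of_def Z_of_def\<close>)
  have b3: "base1 q s3" by (rule base1_cong[OF q(1)]; rule fr3; simp)
  have "s3 ''blk'' = s2 ''blk''" by (rule fr3) simp
  from S.sem_setup[OF b3 this p3(1,2,3,4,5)] have s4: "S.base3 (sem setup_rc s3)" .
  define s4 where "s4 = sem setup_rc s3"
  have "s4 ''out'' = s3 ''out''" unfolding s4_def by (rule sem_frame) (simp add: setup_rc_def wrs_powers)
  also have "\<dots> = s2 ''out''" by (rule fr3) simp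
  also have "\<dots> = s1 ''out''" unfolding s2_def by (rule sem_frame) (simp add: wrs_search)
  also have "\<dots> = s0 ''out''" by (rule fr1) simp
  finally have out: "s4 ''out'' 0 = 0" using s0(3) by simp
  have "sems main_rcs (input_store w) = sem solve_rc s4"
    unfolding main_rcs_def by (simp add: sems_append s0_def s1_def s2_def s3_def s4_def del: sem.simps)
  then show "sems main_rcs (input_store w) ''out'' 0 = (if sescad (G, k) then 1 else 0)"
    using S.sem_solve[of s4] s4 out by (simp add: s4_def)
  let ?U = "A + Z_of (2 * p)"
  have ZU: "Z_of q \<le> ?U" using Z_of_mono[OF q2p] by simp
  have A: "s0 ''A'' 0 = A" "s1 ''A'' 0 = A" using base_A s0(1) b1 by blast+
  have cd: "cntsc degrees_rc \<subseteq> {''A''}" by (simp add: degrees_rc_def)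
  have cs: "cntsc search_rc \<subseteq> {''A''}"
    by (simp add: search_rc_def blocks_rc_def union_rc_def linkE_def badE_def cubeE_def)
  have c4: "cntsc setup_rc \<subseteq> {''A'', ''X'', ''Z'', ''W''}" by (simp add: setup_rc_def powers_def)
  let ?C = "{''A'', ''X'', ''y'', ''G'', ''Z''}"
  have c5: "cntsc solve_rc \<subseteq> ?C"
  proof -
    have "cnts (arcE e) \<subseteq> ?C \<longleftrightarrow> cnts e \<subseteq> ?C" for e
      by (simp add: arcE_def srcE_def dstE_def keptE_def levE_def dX_def f4_def)
    then have "cnts descE \<subseteq> ?C" "cnts outE \<subseteq> ?C" "cnts inE \<subseteq> ?C" "cnts costE \<subseteq> ?C" "cnts uncleanE \<subseteq> ?C"
      by (simp_all add: descE_def outE_def inE_def costE_def uncleanE_def)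
    then show ?thesis
      by (simp add: solve_rc_def search_codes_rc_def try_rc_def move_rc_def posE_def invalidE_def initE_def
          costsE_def mismatchE_def badcodeE_def atE_def srcE_def dstE_def dX_def f4_def)
  qed
  have b3': "base s3" using b3 by (rule base1_base)
  have v3: "s3 x 0 \<le> ?U" if "x \<in> {''A'', ''X'', ''Z'', ''W''}" for x
    using that p3 of_bounds[of q] ZU base_A[OF b3'] by auto
  have v4: "s4 x 0 \<le> ?U" if "x \<in> ?C" for x
    using that S.base3D(2,3,5,6)[OF s4] base_A[OF S.base3D(1)[OF s4]] of_bounds[of q] ZU unfolding s4_def[symmetric] by auto
  have "oks param_rcs ?U s2" using oks_mono[OF p3(6) ZU] .
  moreover have "\<forall>x\<in>cntsc degrees_rc. s0 x 0 \<le> ?U" "\<forall>x\<in>cntsc search_rc. s1 x 0 \<le> ?U"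
    using cd cs A by auto
  moreover have "\<forall>x\<in>cntsc setup_rc. s3 x 0 \<le> ?U" using c4 v3 by blast
  moreover have "\<forall>x\<in>cntsc solve_rc. s4 x 0 \<le> ?U" using c5 v4 by blast
  ultimately show "oks main_rcs ?U (input_store w)"
    unfolding main_rcs_def oks_append
    by (simp add: sems_append s0_def[symmetric] s1_def[symmetric] s2_def[symmetric] s3_def[symmetric] s4_def[symmetric] del: sem.simps)
qed

end

section \<open>Computability of the bound and final estimate\<close>

text \<open>The stages that compute \<open>Z\<close> for the solver serve once more, now started
  from \<open>q = 2 * p\<close>, to compute the factor of the time bound that depends on the
  parameter.\<close>

definition bound_rcs :: "nat \<Rightarrow> nat \<Rightarrow> rc list" where
  "bound_rcs K d = [Asg ''q'' (N 0) (Add (R ''in'' (N 0)) (R ''in'' (N 0)))] @ param_rcs @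
     [Asg ''Z1'' (N 0) (Add (rg ''Z'') (N 1)) ;; Asg ''dd'' (N 0) (N d) ;; Asg ''kk'' (N 0) (N K),
      powc ''P'' ''Z1'' ''dd'', Asg ''out'' (N 0) (SumE ''kk'' ''a'' (rg ''P''))]"

lemma computable_bound: "computable (\<lambda>p. K * (Z_of (2 * p) + 1) ^ d)"
proof -
  have w: "\<forall>c\<in>set (bound_rcs K d). wfc c"
  proof -
    have "okC {} (Asg ''q'' (N 0) (Add (R ''in'' (N 0)) (R ''in'' (N 0))))"
      "okC {} (Asg ''Z1'' (N 0) (Add (rg ''Z'') (N 1)) ;; Asg ''dd'' (N 0) (N d) ;; Asg ''kk'' (N 0) (N K))"
      "okC {''Z1'', ''dd''} (powc ''P'' ''Z1'' ''dd'')" "okC {''kk''} (Asg ''out'' (N 0) (SumE ''kk'' ''a'' (rg ''P'')))"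
      by (simp_all add: okC_simps okE_simps powc_def)
    from this[THEN okC_wfc] show ?thesis using wfc_params by (auto simp: bound_rcs_def)
  qed
  have "sems (bound_rcs K d) (input_store [p]) ''out'' 0 = K * (Z_of (2 * p) + 1) ^ d" for p
  proof -
    define s1 where "s1 = setreg (input_store [p]) ''q'' (2 * p)"
    define s2 where "s2 = sems param_rcs s1"
    have Z2: "s2 ''Z'' 0 = Z_of (2 * p)" unfolding s2_def by (rule param_steps(5)) (simp add: s1_def)
    define s3 where "s3 = setreg (setreg (setreg s2 ''Z1'' (Z_of (2 * p) + 1)) ''dd'' d) ''kk'' K"
    define s4 where "s4 = sem (powc ''P'' ''Z1'' ''dd'') s3"
    have s4: "s4 ''P'' 0 = (Z_of (2 * p) + 1) ^ d" "s4 ''kk'' 0 = K"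
      by (simp_all add: s4_def sem_powc sem_powc_other s3_def)
    have e1: "sem (Asg ''q'' (N 0) (Add (R ''in'' (N 0)) (R ''in'' (N 0)))) (input_store [p]) = s1"
      by (simp add: s1_def input_store_def mult_2)
    have e3: "sem (Asg ''Z1'' (N 0) (Add (rg ''Z'') (N 1)) ;; Asg ''dd'' (N 0) (N d) ;; Asg ''kk'' (N 0) (N K)) s2 = s3"
      using Z2 by (simp add: s3_def)
    have "sems (bound_rcs K d) (input_store [p]) = sem (Asg ''out'' (N 0) (SumE ''kk'' ''a'' (rg ''P''))) s4"
      unfolding bound_rcs_def sems_append sems.simps e1 s2_def[symmetric] e3 s4_def[symmetric] ..
    then show ?thesis using s4 by simp
  qed
  then show ?thesis using computable_stages[OF w] by simp
qed

lemma length_le_input_size: "length w \<le> input_size w"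
  unfolding input_size_def by (induction w) auto

theorem theorem6:
  shows "fixed_parameter_tractable sescad_instances sescad_encoding sescad
    (\<lambda>(G, k). vertex_integrity G)"
proof -
  obtain c K d where c: "\<And>s V. oks main_rcs V s \<Longrightarrow>
      \<exists>t s'. exec c s t s' \<and> (\<forall>x. x \<noteq> ''#'' \<longrightarrow> s' x = sems main_rcs s x) \<and> t \<le> K * (V + 1) ^ d"
    using compile_stages[OF wfc_main] by metis
  define f where "f p = K * (Z_of (2 * p) + 1) ^ d" for p
  show ?thesis
    unfolding fixed_parameter_tractable_def
  proof (rule exI[of _ c], rule exI[of _ f], rule exI[of _ "2 * d"], intro conjI ballI allI impI)
    show "computable f" unfolding f_def by (rule computable_bound)
    fix x :: "nat pair_pre_digraph \<times> int" and w
    assume x: "x \<in> sescad_instances" "sescad_encoding x w"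
    obtain G k where xGk: "x = (G, k)" by (cases x)
    have G: "pair_digraph G" using x(1) by (simp add: xGk sescad_instances_def)
    from x(2) obtain vs es where e: "distinct vs" "set vs = pverts G" "distinct es" "set es = parcs G"
      "w = [if k < 0 then 1 else 0, nat \<bar>k\<bar>, length vs] @ vs @ concat (map (\<lambda>(u, v). [u, v]) es)"
      unfolding xGk sescad_encoding_def by blast
    interpret instance_word G k vs es w by (rule instance_word.intro[OF G e])
    let ?p = "vertex_integrity G"
    have vi: "has_vertex_integrity G ?p"
      unfolding vertex_integrity_def using has_vertex_integrity_card[OF G] by (rule LeastI)
    let ?U = "length w + Z_of (2 * ?p)"
    from c[OF main_rcs_correct(2)[OF vi]] obtain t s' where t: "exec c (input_store w) t s'"
      "\<forall>x. x \<noteq> ''#'' \<longrightarrow> s' x = sems main_rcs (input_store w) x" "t \<le> K * (?U + 1) ^ d" by blast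
    have "output_of s' = (if sescad x then 1 else 0)"
      using t(2) main_rcs_correct(1)[OF vi] by (simp add: output_of_def xGk)
    moreover have "t \<le> f ?p * input_size w ^ (2 * d)"
    proof -
      let ?n = "input_size w"
      have n: "length w \<le> ?n" "3 \<le> length w" by (rule length_le_input_size, simp add: A)
      have "length w + 1 \<le> ?n * 2" using n by linarith
      also have "\<dots> \<le> ?n * ?n" using n by (intro mult_le_mono2) linarith
      finally have l: "length w + 1 \<le> ?n ^ 2" by (simp add: power2_eq_square)
      \<comment> \<open>The sum of input length and parameter bound is turned into a product, as
        fixed-parameter tractability asks for. The word has at least 3 entries, so
        \<open>length w + 1\<close> is at most the square of the input size, which doubles the
        exponent.\<close>
      have "?U + 1 \<le> (Z_of (2 * ?p) + 1) * (length w + 1)" by simp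
      also have "\<dots> \<le> (Z_of (2 * ?p) + 1) * ?n ^ 2" using l by (rule mult_le_mono2)
      finally have "(?U + 1) ^ d \<le> ((Z_of (2 * ?p) + 1) * ?n ^ 2) ^ d" by (rule power_mono) simp
      then have "K * (?U + 1) ^ d \<le> K * ((Z_of (2 * ?p) + 1) * ?n ^ 2) ^ d" by (rule mult_le_mono2)
      also have "\<dots> = f ?p * ?n ^ (2 * d)"
        by (simp only: f_def power_mult_distrib power_mult[symmetric] mult.assoc)
      finally show ?thesis using t(3) by (rule le_trans[rotated])
    qed
    ultimately show "\<exists>t s. exec c (input_store w) t s \<and> output_of s = (if sescad x then 1 else 0) \<and>
        t \<le> f (case x of (G, k) \<Rightarrow> vertex_integrity G) * input_size w ^ (2 * d)"
      using t(1) unfolding xGk prod.case by blast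
  qed
qed

end
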